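(* Let $d\in\mathbb N$, $T\ge1/2$, and $G:\mathcal P_2(\mathbb R^d)\to\mathbb R$, $G(m)=\mathbf d_1(m,\mathrm{Leb}|_{[0,1]^d})$. Let $U$ be the deterministic mean field value function with terminal cost $G$, and $U^f$ the value function over Lipschitz feedback controls, both defined in the context. Then there exists $(t_0,m_0)\in[0,T]\times\mathcal P_2(\mathbb R^d)$ such that $U(t_0,m_0)<U^f(t_0,m_0)$.
   Context: $\mathcal P_2(\mathbb R^d)$ is the space of Borel probability measures on $\mathbb R^d$ with finite second moment; $\mathbf d_1$ is the 1-Wasserstein distance. **Mean field value function:** for $(t_0,m_0)\in[0,T]\times\mathcal P_2(\mathbb R^d)$, $$U(t_0,m_0)=\inf_{(m,\alpha)}\int_{t_0}^T\int_{\mathbb R^d}\tfrac12|\alpha_t(x)|^2dm_t(x)dt+G(m_T),$$ the infimum being over pairs with $m\in AC([t_0,T];\mathcal P_2(\mathbb R^d))$ (absolutely continuous curves), $\alpha\in L^2(dt\otimes m_t;\mathbb R^d)$, and $\partial_tm_t+\mathrm{div}(\alpha_tm_t)=0$ in $(t_0,T)\times\mathbb R^d$ (in the sense of distributions), $m_{t_0}=m_0$. **Lipschitz feedback value function:** $$U^f(t_0,m_0)=\inf_{\alpha\in L^1_t(\mathrm{Lip}_x)}\ \frac12\int_{t_0}^T\int_{\mathbb R^d}|\alpha_t(x)|^2dm_t(x)dt+G(m_T),$$ where $\alpha\in L^1_t(\mathrm{Lip}_x)$ means that $\alpha:[t_0,T]\times\mathbb R^d\to\mathbb R^d$ is measurable,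 $\alpha_t$ is Lipschitz in $x$ for a.e. $t$, and $t\mapsto|\alpha_t(0)|+\mathrm{Lip}(\alpha_t)$ is integrable on $[t_0,T]$; and $m$ is the solution of $\partial_tm_t+\mathrm{div}(\alpha_tm_t)=0$ in $(t_0,T)\times\mathbb R^d$, $m_{t_0}=m_0$. *)

theory Defs
  imports "HOL-Probability.Probability"
begin

section \<open>Wasserstein spaces\<close>

definition P2 :: "'a::euclidean_space measure set" where
  "P2 = {m. prob_space m \<and> sets m = sets borel \<and> (\<integral>\<^sup>+ x. ennreal (norm x ^ 2) \<partial>m) < \<infinity>}"

definition couplings :: "'a::euclidean_space measure \<Rightarrow> 'a measure \<Rightarrow> ('a \<times> 'a) measure set" where
  "couplings \<mu> \<nu> = {\<pi>. sets \<pi> = sets borel \<and> distr \<pi> borel fst = \<mu> \<and> distr \<pi> borel snd = \<nu>}"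

text \<open>The infimum is finite for probability measures with finite \<open>p\<close>-th moment (take the product
  coupling), in particular for \<open>p \<in> {1, 2}\<close> on \<^const>\<open>P2\<close>; only there is the value meaningful,
  since \<^const>\<open>enn2real\<close> maps infinity to 0.\<close>

definition wasserstein :: "nat \<Rightarrow> 'a::euclidean_space measure \<Rightarrow> 'a measure \<Rightarrow> real" where
  "wasserstein p \<mu> \<nu> =
     root p (enn2real (INF \<pi>\<in>couplings \<mu> \<nu>. \<integral>\<^sup>+ z. ennreal (dist (fst z) (snd z) ^ p) \<partial>\<pi>))"

definition AC_P2 :: "real \<Rightarrow> real \<Rightarrow> (real \<Rightarrow> 'a::euclidean_space measure) \<Rightarrow> bool" where
  "AC_P2 a b m \<longleftrightarrow> (\<forall>t\<in>{a..b}. m t \<in> P2) \<and>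
     (\<exists>g. set_integrable lebesgue {a..b} g \<and>
        (\<forall>s t. a \<le> s \<and> s \<le> t \<and> t \<le> b \<longrightarrow> wasserstein 2 (m s) (m t) \<le> (LINT r:{s..t}|lebesgue. g r)))"

definition narrowly_continuous_P2 :: "real \<Rightarrow> real \<Rightarrow> (real \<Rightarrow> 'a::euclidean_space measure) \<Rightarrow> bool" where
  "narrowly_continuous_P2 a b m \<longleftrightarrow> (\<forall>t\<in>{a..b}. m t \<in> P2) \<and>
     (\<forall>f :: 'a \<Rightarrow> real. continuous_on UNIV f \<and> bounded (range f) \<longrightarrow>
        continuous_on {a..b} (\<lambda>t. \<integral>x. f x \<partial>m t))"

section \<open>The continuity equation\<close>

text \<open>In finite dimension a function is \<open>C\<^sup>k\<^sup>+\<^sup>1\<close> iff it is differentiable and all its directional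
  derivatives are \<open>C\<^sup>k\<close>.\<close>

fun C_k :: "nat \<Rightarrow> ('a::euclidean_space \<Rightarrow> real) \<Rightarrow> bool" where
  "C_k 0 f \<longleftrightarrow> continuous_on UNIV f"
| "C_k (Suc k) f \<longleftrightarrow> (\<forall>x. f differentiable (at x)) \<and> (\<forall>v. C_k k (\<lambda>x. frechet_derivative f (at x) v))"

definition test_functions :: "'a::euclidean_space set \<Rightarrow> ('a \<Rightarrow> real) set" where
  "test_functions S = {\<phi>. (\<forall>k. C_k k \<phi>) \<and> compact (closure {z. \<phi> z \<noteq> 0}) \<and> closure {z. \<phi> z \<noteq> 0} \<subseteq> S}"

text \<open>Distributional form of \<open>\<partial>\<^sub>t m + div (\<alpha> m) = 0\<close> in \<open>(a, b) \<times> \<real>\<^sup>d\<close>. The integrand is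
  \<open>\<partial>\<^sub>t \<phi>(t, x) + \<nabla>\<phi>(t, x) \<bullet> \<alpha>\<^sub>t(x)\<close>, i.e. the derivative of \<open>\<phi>\<close> at \<open>(t, x)\<close> in direction
  \<open>(1, \<alpha>\<^sub>t(x))\<close>. It is integrable for both classes of controls below, so the convention that
  a non-integrable function has integral 0 plays no role.\<close>

definition continuity_equation ::
  "real \<Rightarrow> real \<Rightarrow> (real \<Rightarrow> 'a::euclidean_space \<Rightarrow> 'a) \<Rightarrow> (real \<Rightarrow> 'a measure) \<Rightarrow> bool" where
  "continuity_equation a b \<alpha> m \<longleftrightarrow>
     (\<forall>\<phi>\<in>test_functions ({a<..<b} \<times> UNIV).
        (\<integral>t. (\<integral>x. frechet_derivative \<phi> (at (t, x)) (1, \<alpha> t x) \<partial>m t) \<partial>lebesgue_on {a..b}) = 0)"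

section \<open>Controls\<close>

definition measurable_control :: "real \<Rightarrow> real \<Rightarrow> (real \<Rightarrow> 'a::euclidean_space \<Rightarrow> 'a) \<Rightarrow> bool" where
  "measurable_control a b \<alpha> \<longleftrightarrow>
     (\<lambda>(t, x). \<alpha> t x) \<in> borel_measurable (restrict_space borel ({a..b} \<times> UNIV))"

definition kinetic_energy ::
  "real \<Rightarrow> real \<Rightarrow> (real \<Rightarrow> 'a::euclidean_space \<Rightarrow> 'a) \<Rightarrow> (real \<Rightarrow> 'a measure) \<Rightarrow> ennreal" where
  "kinetic_energy a b \<alpha> m =
     (\<integral>\<^sup>+ t. (\<integral>\<^sup>+ x. ennreal (norm (\<alpha> t x) ^ 2 / 2) \<partial>m t) \<partial>lebesgue_on {a..b})"

text \<open>Membership in \<open>L\<^sup>2(dt \<otimes> m\<^sub>t)\<close>, stated for Borel representatives.\<close>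

definition L2_control ::
  "real \<Rightarrow> real \<Rightarrow> (real \<Rightarrow> 'a::euclidean_space measure) \<Rightarrow> (real \<Rightarrow> 'a \<Rightarrow> 'a) \<Rightarrow> bool" where
  "L2_control a b m \<alpha> \<longleftrightarrow> measurable_control a b \<alpha> \<and>
     (\<integral>\<^sup>+ t. (\<integral>\<^sup>+ x. ennreal (norm (\<alpha> t x) ^ 2) \<partial>m t) \<partial>lebesgue_on {a..b}) < \<infinity>"

text \<open>The least Lipschitz constant; meaningful only for Lipschitz \<open>f\<close>.\<close>

definition Lip :: "('a::metric_space \<Rightarrow> 'b::metric_space) \<Rightarrow> real" where
  "Lip f = Inf {L. L-lipschitz_on UNIV f}"

definition L1_Lip :: "real \<Rightarrow> real \<Rightarrow> (real \<Rightarrow> 'a::euclidean_space \<Rightarrow> 'a) \<Rightarrow> bool" where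
  "L1_Lip a b \<alpha> \<longleftrightarrow> measurable_control a b \<alpha> \<and>
     (AE t in lebesgue_on {a..b}. \<exists>L. L-lipschitz_on UNIV (\<alpha> t)) \<and>
     integrable (lebesgue_on {a..b}) (\<lambda>t. norm (\<alpha> t 0) + Lip (\<alpha> t))"

section \<open>Value functions\<close>

definition total_cost ::
  "real \<Rightarrow> ('a::euclidean_space measure \<Rightarrow> real) \<Rightarrow> real \<Rightarrow> (real \<Rightarrow> 'a measure) \<Rightarrow> (real \<Rightarrow> 'a \<Rightarrow> 'a) \<Rightarrow> ereal"
  where
  "total_cost T G t\<^sub>0 m \<alpha> = enn2ereal (kinetic_energy t\<^sub>0 T \<alpha> m) + ereal (G (m T))"

definition mean_field_value ::
  "real \<Rightarrow> ('a::euclidean_space measure \<Rightarrow> real) \<Rightarrow> real \<Rightarrow> 'a measure \<Rightarrow> ereal" where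
  "mean_field_value T G t\<^sub>0 m\<^sub>0 =
     Inf {total_cost T G t\<^sub>0 m \<alpha> | m \<alpha>.
        AC_P2 t\<^sub>0 T m \<and> L2_control t\<^sub>0 T m \<alpha> \<and> continuity_equation t\<^sub>0 T \<alpha> m \<and> m t\<^sub>0 = m\<^sub>0}"

text \<open>For \<open>\<alpha> \<in> L\<^sup>1\<^sub>t(Lip\<^sub>x)\<close> and \<open>m\<^sub>0 \<in> P\<^sub>2\<close> the continuity equation has exactly one narrowly continuous
  \<open>P\<^sub>2\<close>-valued solution on \<open>[t\<^sub>0, T]\<close> (the push-forward of \<open>m\<^sub>0\<close> under the flow of \<open>\<alpha>\<close>), so the infimum
  over \<open>\<alpha>\<close> with \<open>m\<close> the solution is the infimum over the admissible pairs. A control with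
  infinite energy is allowed and has cost \<open>\<infinity>\<close>.\<close>

definition Lipschitz_feedback_value ::
  "real \<Rightarrow> ('a::euclidean_space measure \<Rightarrow> real) \<Rightarrow> real \<Rightarrow> 'a measure \<Rightarrow> ereal" where
  "Lipschitz_feedback_value T G t\<^sub>0 m\<^sub>0 =
     Inf {total_cost T G t\<^sub>0 m \<alpha> | m \<alpha>.
        L1_Lip t\<^sub>0 T \<alpha> \<and> narrowly_continuous_P2 t\<^sub>0 T m \<and> continuity_equation t\<^sub>0 T \<alpha> m \<and> m t\<^sub>0 = m\<^sub>0}"

section \<open>The terminal cost\<close>

definition Leb_unit_cube :: "(real ^ 'n) measure" where
  "Leb_unit_cube = density lborel (indicator {x. \<forall>i. 0 \<le> x $ i \<and> x $ i \<le> 1})"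

end

theory Submission
  imports Defs "HOL-Real_Asymp.Real_Asymp"
begin

text \<open>Start at time \<open>0\<close> from a point mass at a minimiser \<open>c\<close> of \<open>x \<mapsto> E|Y - x|\<close>, where \<open>Y\<close> is
  uniform on the cube. A Lipschitz feedback control transports a point mass to a point mass: testing
  the continuity equation with truncated quadratics shows that the variance \<open>V\<close> of the solution
  satisfies \<open>V' \<le> 2 Lip(\<alpha>\<^sub>t) V\<close>, so it stays \<open>0\<close> by Gronwall. Hence \<open>U\<^sup>f \<ge> E|Y - c|\<close>. The curve of laws of
  \<open>c + \<theta> (t / T) (Y - c)\<close>, driven by the velocity \<open>(x - c) / t\<close> whose Lipschitz constant \<open>1 / t\<close>
  is not integrable, has cost at most \<open>\<theta>\<^sup>2 E|Y - c|\<^sup>2 / (2 T) + (1 - \<theta>) E|Y - c|\<close>, which is smaller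
  for small \<open>\<theta> > 0\<close>.\<close>

section \<open>Smooth functions\<close>

text \<open>Arguing with moments directly on the continuity equation avoids constructing the flow of
  \<open>\<alpha>\<close> and proving uniqueness. Two obstacles shape this route. Test functions
  have compact support while \<open>\<alpha>\<close> grows linearly, so the quadratics are cut off
  by a profile \<open>h\<close> with \<open>s * h' s \<le> 2 * h s\<close>; this inequality closes
  the Gronwall estimate with a constant independent of the cut-off radius. And
  \<open>norm (\<alpha> t 0) + Lip (\<alpha> t)\<close> is only integrable in \<open>t\<close>, so
  moments are merely absolutely continuous: integral functions, with their own chain rule and
  Gronwall lemma, replace derivatives.

  The minimiser \<open>c\<close> is chosen because staying there, the case
  \<open>\<theta> = 0\<close>, costs exactly the lower bound for feedback controls. Spreading out
  gains at first order in \<open>\<theta>\<close> and costs energy of second order only. The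
  singular field has finite energy because along the segment from \<open>c\<close> towards
  \<open>y\<close> its value \<open>(\<theta> / T) *\<^sub>R (y - c)\<close> is constant in
  time.\<close>

lemma C_k_Suc_D: "C_k (Suc k) f \<Longrightarrow> C_k k f"
proof (induction k arbitrary: f)
  case 0
  then show ?case
    by (auto simp: continuous_on_eq_continuous_at intro: differentiable_imp_continuous_within)
qed auto

lemma C_k_SucI:
  assumes "\<And>x. (f has_derivative f' x) (at x)" "\<And>v. C_k k (\<lambda>x. f' x v)"
  shows "C_k (Suc k) f"
proof -
  have "frechet_derivative f (at x) = f' x" for x
    using assms(1) frechet_derivative_at by metis
  then show ?thesis
    using assms by (auto simp: differentiable_def)
qed

lemma C_k_const [simp]: "C_k k (\<lambda>x. c)"
proof (induction k arbitrary: c)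
  case (Suc k)
  show ?case by (rule C_k_SucI[where f' = "\<lambda>x v. 0"]) (auto intro: Suc)
qed auto

lemma C_k_bounded_linear:
  assumes "bounded_linear f"
  shows "C_k k f"
proof (cases k)
  case 0
  then show ?thesis using assms by (simp add: linear_continuous_on)
next
  case (Suc n)
  show ?thesis unfolding Suc
    by (rule C_k_SucI[where f' = "\<lambda>x. f"]) (auto intro: bounded_linear_imp_has_derivative assms)
qed

lemma C_k_add:
  assumes "C_k k f" "C_k k g"
  shows "C_k k (\<lambda>x. f x + g x)"
  using assms
proof (induction k arbitrary: f g)
  case 0
  then show ?case by (auto intro: continuous_intros)
next
  case (Suc k)
  let ?D = "\<lambda>f x. frechet_derivative f (at x)"
  have "(f has_derivative ?D f x) (at x)" "(g has_derivative ?D g x) (at x)" for x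
    using Suc.prems by (auto simp: frechet_derivative_works[symmetric])
  then show ?case
    by (intro C_k_SucI[where f' = "\<lambda>x v. ?D f x v + ?D g x v"] has_derivative_add Suc.IH)
      (use Suc.prems in auto)
qed

lemma C_k_mult:
  assumes "C_k k f" "C_k k g"
  shows "C_k k (\<lambda>x. f x * g x)"
  using assms
proof (induction k arbitrary: f g)
  case 0
  then show ?case by (auto intro: continuous_intros)
next
  case (Suc k)
  let ?D = "\<lambda>f x. frechet_derivative f (at x)"
  have "(f has_derivative ?D f x) (at x)" "(g has_derivative ?D g x) (at x)" for x
    using Suc.prems by (auto simp: frechet_derivative_works[symmetric])
  moreover have "C_k k f" "C_k k g"
    using Suc.prems C_k_Suc_D by blast+
  ultimately show ?case
    by (intro C_k_SucI[where f' = "\<lambda>x v. f x * ?D g x v + ?D f x v * g x"] has_derivative_mult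
        C_k_add Suc.IH)
      (use Suc.prems in auto)
qed

lemma C_k_diff:
  assumes "C_k k f" "C_k k g"
  shows "C_k k (\<lambda>x. f x - g x)"
  using C_k_add[OF assms(1) C_k_mult[OF C_k_const[of k "-1"] assms(2)]] by simp

text \<open>The derivative of \<open>g\<close> at a point is multiplication by the number
  \<open>?D g y 1\<close>, so the chain rule writes directional derivatives as products, which
  \<open>C_k_mult\<close> handles. The induction hypothesis is applied to that number as a function
  of \<open>y\<close>.\<close>

lemma C_k_compose:
  fixes g :: "real \<Rightarrow> real"
  assumes "C_k k g" "C_k k f"
  shows "C_k k (\<lambda>x. g (f x))"
  using assms
proof (induction k arbitrary: f g)
  case 0
  then show ?case by (auto intro: continuous_on_compose2)
next
  case (Suc k)
  let ?D = "\<lambda>f x. frechet_derivative f (at x)"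
  have f: "(f has_derivative ?D f x) (at x)" for x
    using Suc.prems by (auto simp: frechet_derivative_works[symmetric])
  have g: "(g has_derivative ?D g x) (at x)" for x
    using Suc.prems by (auto simp: frechet_derivative_works[symmetric])
  have lin: "?D g x v = ?D g x 1 * v" for x v
  proof -
    have "linear (?D g x)"
      using g has_derivative_linear by blast
    then show ?thesis
      using linear_cmul[of "?D g x" v 1] by simp
  qed
  have "((\<lambda>x. g (f x)) has_derivative (\<lambda>v. ?D g (f x) 1 * ?D f x v)) (at x)" for x
    using has_derivative_compose[OF f g] by (simp add: lin[symmetric])
  moreover have "C_k k f"
    using Suc.prems C_k_Suc_D by blast
  ultimately show ?case
    by (intro C_k_SucI[where f' = "\<lambda>x v. ?D g (f x) 1 * ?D f x v"] C_k_mult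
        Suc.IH[of "\<lambda>y. ?D g y 1"])
      (use Suc.prems in auto)
qed

lemma C_k_compose_linear:
  assumes "C_k k f" "bounded_linear L"
  shows "C_k k (\<lambda>x. f (L x))"
  using assms(1)
proof (induction k arbitrary: f)
  case 0
  have "continuous_on UNIV L"
    using assms(2) by (simp add: linear_continuous_on)
  with 0 show ?case by (auto intro: continuous_on_compose2)
next
  case (Suc k)
  let ?D = "\<lambda>f x. frechet_derivative f (at x)"
  have f: "(f has_derivative ?D f x) (at x)" for x
    using Suc.prems by (auto simp: frechet_derivative_works[symmetric])
  show ?case
    by (intro C_k_SucI[where f' = "\<lambda>x v. ?D f (L x) (L v)"] Suc.IH[of "\<lambda>y. ?D f y (L v)" for v]
        has_derivative_compose[OF bounded_linear_imp_has_derivative f] assms)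
      (use Suc.prems in auto)
qed

lemma C_k_SucI_real:
  fixes g :: "real \<Rightarrow> real"
  assumes "\<And>x. (g has_real_derivative g' x) (at x)" "C_k k g'"
  shows "C_k (Suc k) g"
  by (rule C_k_SucI[where f' = "\<lambda>x v. g' x * v"])
    (use assms in \<open>auto simp: has_field_derivative_def intro: C_k_mult\<close>)

lemma C_k_derivI:
  fixes g :: "real \<Rightarrow> real"
  assumes "\<And>x. (g has_real_derivative g' x) (at x)" "\<And>k. C_k k g'"
  shows "C_k k g"
  by (rule C_k_Suc_D[OF C_k_SucI_real[OF assms]])

text \<open>The derivative \<open>2 * inner (x - z) v\<close> is affine in \<open>x\<close>. Order
  \<open>Suc k\<close> is proved and then lowered, so that order 0 needs no separate
  argument.\<close>

lemma C_k_norm_power2: "C_k k (\<lambda>x. (norm (x - z))\<^sup>2)"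
proof (rule C_k_Suc_D, rule C_k_SucI)
  show "((\<lambda>x. (norm (x - z))\<^sup>2) has_derivative (\<lambda>v. 2 * inner (x - z) v)) (at x)" for x
    unfolding power2_norm_eq_inner
    by (auto intro!: derivative_eq_intros simp: inner_commute)
  show "C_k k (\<lambda>x. 2 * inner (x - z) v)" for v
    using C_k_diff[OF C_k_bounded_linear[of "\<lambda>x. 2 * inner x v" k] C_k_const[of k "2 * inner z v"]]
    by (simp add: inner_diff_left algebra_simps bounded_linear_mult_const
        bounded_linear_const_mult bounded_linear_inner_left)
qed

section \<open>Flat functions, smooth steps and a truncation profile\<close>

definition flat_fun :: "real poly \<Rightarrow> real \<Rightarrow> real" where
  "flat_fun p x = (if x > 0 then poly p (1/x) * exp (-1/x) else 0)"

lemma poly_exp_neg_tendsto_0: "((\<lambda>y. poly p y * exp (- y)) \<longlongrightarrow> (0::real)) at_top"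
proof -
  have "((\<lambda>y. coeff p i * (y ^ i / exp y)) \<longlongrightarrow> coeff p i * 0) at_top" for i
    by (intro tendsto_intros tendsto_power_div_exp_0)
  then have "((\<lambda>y. \<Sum>i\<le>degree p. coeff p i * (y ^ i / exp y)) \<longlongrightarrow> (\<Sum>i\<le>degree p. 0)) at_top"
    by (intro tendsto_sum) auto
  then show ?thesis
    by (simp add: poly_altdef sum_distrib_right exp_minus divide_inverse mult.assoc)
qed

text \<open>The family \<open>flat_fun p\<close> is closed under differentiation: for
  \<open>x > 0\<close> the chain rule replaces \<open>p\<close> by \<open>X^2 (p - p')\<close>,
  evaluated at \<open>1/x\<close>. Smoothness of all orders then follows by an induction with
  \<open>p\<close> arbitrary.\<close>

lemma flat_fun_has_derivative:
  "(flat_fun p has_real_derivative flat_fun ([:0, 0, 1:] * (p - pderiv p)) x) (at x)"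
proof -
  consider "x > 0" | "x < 0" | "x = 0" by linarith
  then show ?thesis
  proof cases
    case 1
    have "((\<lambda>x. poly p (1/x) * exp (-1/x)) has_real_derivative
       poly p (1/x) * (exp (-1/x) * (1/x^2)) + (poly (pderiv p) (1/x) * (-1/x^2)) * exp (-1/x)) (at x)"
      using 1 by (auto intro!: derivative_eq_intros simp: power2_eq_square)
    then have "((\<lambda>x. poly p (1/x) * exp (-1/x)) has_real_derivative
       flat_fun ([:0, 0, 1:] * (p - pderiv p)) x) (at x)"
      using 1 by (simp add: flat_fun_def field_simps power2_eq_square)
    then show ?thesis
      by (rule has_field_derivative_transform_within_open[where S = "{0<..}"])
        (use 1 in \<open>auto simp: flat_fun_def\<close>)
  next
    case 2
    have "((\<lambda>x. 0) has_real_derivative flat_fun ([:0, 0, 1:] * (p - pderiv p)) x) (at x)"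
      using 2 by (simp add: flat_fun_def)
    then show ?thesis
      by (rule has_field_derivative_transform_within_open[where S = "{..<0}"])
        (use 2 in \<open>auto simp: flat_fun_def\<close>)
  next
    case 3
    \<comment> \<open>The right-hand difference quotient at 0 is the flat function of
      \<open>X p\<close>; with \<open>y = 1/h\<close> its decay is that of a polynomial against an
      exponential.\<close>
    have "((\<lambda>h. poly ([:0,1:] * p) (1/h) * exp (- (1/h))) \<longlongrightarrow> 0) (at_right 0)"
      by (rule filterlim_compose[OF poly_exp_neg_tendsto_0]) real_asymp
    then have "((\<lambda>h. (flat_fun p h - flat_fun p 0) / h) \<longlongrightarrow> 0) (at_right 0)"
      by (rule Lim_transform_eventually)
        (auto simp: flat_fun_def eventually_at_right_less intro!: eventually_mono[OF eventually_at_right_less])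
    moreover have "((\<lambda>h. (flat_fun p h - flat_fun p 0) / h) \<longlongrightarrow> 0) (at_left 0)"
    proof (rule Lim_transform_eventually)
      show "((\<lambda>h. 0) \<longlongrightarrow> (0::real)) (at_left 0)" by simp
      show "\<forall>\<^sub>F h in at_left 0. 0 = (flat_fun p h - flat_fun p 0) / h"
        by (rule eventually_mono[OF eventually_at_left_real[of "-1"]]) (auto simp: flat_fun_def)
    qed
    ultimately have "((\<lambda>h. (flat_fun p h - flat_fun p 0) / h) \<longlongrightarrow> 0) (at 0)"
      by (simp add: filterlim_split_at)
    then show ?thesis
      using 3 by (simp add: flat_fun_def DERIV_def)
  qed
qed

lemma C_k_flat_fun: "C_k k (flat_fun p)"
proof (induction k arbitrary: p)
  case 0
  then show ?case
    using flat_fun_has_derivative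
    by (auto simp: continuous_on_eq_continuous_at intro: DERIV_isCont)
next
  case (Suc k)
  show ?case by (rule C_k_SucI_real[OF flat_fun_has_derivative Suc])
qed

lemma antiderivative:
  fixes g :: "real \<Rightarrow> real"
  assumes "continuous_on UNIV g"
  obtains F where "\<And>x. (F has_real_derivative g x) (at x)" "F 0 = 0"
proof -
  have "\<exists>F. \<forall>x. -\<infinity> < ereal x \<longrightarrow> ereal x < \<infinity> \<longrightarrow> (F has_vector_derivative g x) (at x)"
    using assms
    by (intro einterval_antiderivative) (auto simp: continuous_on_eq_continuous_at)
  then obtain F where "(F has_real_derivative g x) (at x)" for x
    by (auto simp: has_real_derivative_iff_has_vector_derivative)
  then have F: "((\<lambda>x. F x - F 0) has_real_derivative g x) (at x)" for x
    by (auto intro!: derivative_eq_intros)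
  show ?thesis by (rule that[OF F]) simp
qed

text \<open>\<open>S\<close> is the integral of the bump
  \<open>flat_fun 1 x * flat_fun 1 (1 - x)\<close>, positive exactly on the open unit interval,
  divided by the mass \<open>B 1\<close> of the bump.\<close>

lemma smooth_step:
  obtains S s :: "real \<Rightarrow> real"
  where "\<And>k. C_k k S" "\<And>k. C_k k s" "\<And>x. (S has_real_derivative s x) (at x)"
    "\<And>x. s x \<ge> 0" "\<And>x. x \<le> 0 \<Longrightarrow> S x = 0" "\<And>x. x \<ge> 1 \<Longrightarrow> S x = 1"
    "\<And>x. x \<notin> {0..1} \<Longrightarrow> s x = 0"
proof -
  define b where "b = (\<lambda>x. flat_fun 1 x * flat_fun 1 (1 - x))"
  have b_smooth: "C_k k b" for k
    unfolding b_def
    by (intro C_k_mult C_k_flat_fun C_k_compose[of k "flat_fun 1"] C_k_diff C_k_const C_k_bounded_linear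
        bounded_linear_ident)
  have b_nonneg: "b x \<ge> 0" for x by (simp add: b_def flat_fun_def)
  have b_0: "b x = 0" if "x \<le> 0 \<or> x \<ge> 1" for x using that by (auto simp: b_def flat_fun_def)
  have b_pos: "b x > 0" if "0 < x" "x < 1" for x using that by (auto simp: b_def flat_fun_def)
  have "continuous_on UNIV b" using b_smooth[of 0] by simp
  then obtain B where B: "\<And>x. (B has_real_derivative b x) (at x)" "B 0 = 0"
    by (rule antiderivative) blast
  have left: "B x = 0" if "x \<le> 0" for x
  proof (cases "x = 0")
    case False
    with that have "x < 0" by simp
    from MVT2[OF this B(1)] obtain z where "z < 0" "B 0 - B x = (0 - x) * b z" by auto
    with B b_0[of z] show ?thesis by simp
  qed (simp add: B)
  have right: "B x = B 1" if "x \<ge> 1" for x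
  proof (cases "x = 1")
    case False
    with that have "1 < x" by simp
    from MVT2[OF this B(1)] obtain z where "1 < z" "B x - B 1 = (x - 1) * b z" by auto
    with B b_0[of z] show ?thesis by simp
  qed simp
  have "B 1 > 0"
    using MVT2[OF zero_less_one B(1)] B b_pos by auto
  show ?thesis
  proof (rule that[of "\<lambda>x. B x * (1 / B 1)" "\<lambda>x. b x * (1 / B 1)"])
    show "C_k k (\<lambda>x. B x * (1 / B 1))" "C_k k (\<lambda>x. b x * (1 / B 1))" for k
      by (intro C_k_mult C_k_const b_smooth C_k_derivI[OF B(1)])+
    show "((\<lambda>x. B x * (1 / B 1)) has_real_derivative b x * (1 / B 1)) (at x)" for x
      by (intro DERIV_cmult_right B)
    show "b x * (1 / B 1) \<ge> 0" for x using b_nonneg \<open>B 1 > 0\<close> by simp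
    show "B x * (1 / B 1) = 0" if "x \<le> 0" for x using left that by simp
    show "B x * (1 / B 1) = 1" if "x \<ge> 1" for x using right[OF that] \<open>B 1 > 0\<close> by simp
    show "b x * (1 / B 1) = 0" if "x \<notin> {0..1}" for x using b_0 that by auto
  qed
qed

text \<open>\<open>h\<close> integrates the cut-off \<open>1 - S (x - 1)\<close>: slope 1 up to 1,
  slope 0 from 2 on. The last inequality holds between 1 and 2 because the left side is at most 2
  there while \<open>h x \<ge> h 1 = 1\<close>. It makes the truncated moment estimate independent
  of the truncation radius.\<close>

lemma smooth_truncation:
  obtains h h' :: "real \<Rightarrow> real"
  where "\<And>k. C_k k h" "\<And>x. (h has_real_derivative h' x) (at x)"
    "continuous_on UNIV h'" "\<And>x. 0 \<le> h' x" "\<And>x. h' x \<le> 1"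
    "\<And>x. x \<le> 1 \<Longrightarrow> h x = x" "\<And>x. x \<le> 1 \<Longrightarrow> h' x = 1"
    "\<And>x. x \<ge> 2 \<Longrightarrow> h x = h 2" "\<And>x. x \<ge> 2 \<Longrightarrow> h' x = 0"
    "\<And>x. 0 \<le> x \<Longrightarrow> 0 \<le> h x" "\<And>x. 0 \<le> x \<Longrightarrow> h x \<le> x" "\<And>x. 0 \<le> x \<Longrightarrow> x * h' x \<le> 2 * h x"
proof -
  obtain S s :: "real \<Rightarrow> real"
    where S: "\<And>k. C_k k S" "\<And>x. (S has_real_derivative s x) (at x)"
      "\<And>x. s x \<ge> 0" "\<And>x. x \<le> 0 \<Longrightarrow> S x = 0" "\<And>x. x \<ge> 1 \<Longrightarrow> S x = 1"
    by (rule smooth_step) blast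
  have mono: "S x \<le> S y" if "x \<le> y" for x y
    by (rule DERIV_nonneg_imp_nondecreasing[OF that]) (use S in blast)
  have S01: "0 \<le> S x \<and> S x \<le> 1" for x
    using mono[of "min x 0" x] mono[of x "max x 1"] S(4)[of "min x 0"] S(5)[of "max x 1"] by linarith
  define h' where "h' = (\<lambda>x. 1 - S (x - 1))"
  have h'_smooth: "C_k k h'" for k
    unfolding h'_def
    by (intro C_k_diff C_k_const C_k_compose[OF S(1)] C_k_bounded_linear bounded_linear_ident)
  have cont: "continuous_on UNIV h'" using h'_smooth[of 0] by simp
  then obtain h where h: "\<And>x. (h has_real_derivative h' x) (at x)" "h 0 = 0"
    by (rule antiderivative) blast
  have h'01: "0 \<le> h' x" "h' x \<le> 1" for x using S01 by (auto simp: h'_def)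
  have h'1: "h' x = 1" if "x \<le> 1" for x using S that by (auto simp: h'_def)
  have h'2: "h' x = 0" if "x \<ge> 2" for x using S that by (auto simp: h'_def)
  have hmono: "h x \<le> h y" if "x \<le> y" for x y
    by (rule DERIV_nonneg_imp_nondecreasing[OF that]) (use h h'01 in blast)
  have hx: "h x = x" if "x \<le> 1" for x
  proof -
    consider "x < 0" | "x = 0" | "0 < x" by linarith
    then show ?thesis
    proof cases
      case 1
      from MVT2[OF this, of h h'] h obtain z where "z < 0" "h 0 - h x = (0 - x) * h' z" by auto
      with h h'1[of z] show ?thesis by simp
    next
      case 3
      from MVT2[OF this, of h h'] h obtain z where "z < x" "h x - h 0 = (x - 0) * h' z" by auto
      with h h'1[of z] that show ?thesis by simp
    qed (use h in simp)
  qed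
  have h2: "h x = h 2" if "x \<ge> 2" for x
  proof (cases "x = 2")
    case False
    with that have "2 < x" by simp
    from MVT2[OF this, of h h'] h obtain z where "2 < z" "h x - h 2 = (x - 2) * h' z" by auto
    with h'2[of z] show ?thesis by simp
  qed simp
  have upper: "h x \<le> x" if "0 \<le> x" for x
  proof -
    have "h x - x \<le> h 0 - 0"
      by (rule DERIV_nonpos_imp_nonincreasing[OF that])
        (use h h'01 in \<open>auto intro!: exI derivative_eq_intros\<close>)
    with h show ?thesis by simp
  qed
  have xh': "x * h' x \<le> 2 * h x" if "0 \<le> x" for x
  proof -
    consider "x \<le> 1" | "1 \<le> x" "x \<le> 2" | "2 \<le> x" by linarith
    then show ?thesis
    proof cases
      case 2
      have "x * h' x \<le> 2 * 1" using 2 h'01 by (intro mult_mono) auto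
      also have "\<dots> \<le> 2 * h x" using hx[of 1] hmono[OF 2(1)] by simp
      finally show ?thesis .
    qed (use that h'2[of x] hx[of x] h'1[of x] hmono[of 0 x] h(2) in auto)
  qed
  have h0: "0 \<le> h x" if "0 \<le> x" for x using hmono[OF that] h by simp
  have h_smooth: "C_k k h" for k by (rule C_k_derivI[OF h(1) h'_smooth])
  show ?thesis
    by (rule that[of h h']) (fact h_smooth h(1) cont h'01 hx h'1 h2 h'2 h0 upper xh')+
qed

section \<open>Integral functions on an interval\<close>

lemma integral_lebesgue_on_singleton [simp]:
  fixes f :: "real \<Rightarrow> real"
  shows "integral\<^sup>L (lebesgue_on {a}) f = 0"
  using has_bochner_integral_null[of "{a}" f] by (simp add: has_bochner_integral_iff)

lemma integrable_bounded_mult: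
  fixes f g :: "real \<Rightarrow> real"
  assumes "integrable (lebesgue_on {a..b}) f" "g \<in> borel_measurable (lebesgue_on {a..b})"
    and "\<And>x. x \<in> {a..b} \<Longrightarrow> \<bar>g x\<bar> \<le> C"
  shows "integrable (lebesgue_on {a..b}) (\<lambda>x. g x * f x)"
proof (rule Bochner_Integration.integrable_bound)
  show "integrable (lebesgue_on {a..b}) (\<lambda>x. C * f x)"
    using assms by simp
  show "(\<lambda>x. g x * f x) \<in> borel_measurable (lebesgue_on {a..b})"
    using assms by measurable
  have "\<bar>g x * f x\<bar> \<le> \<bar>C * f x\<bar>" if "x \<in> {a..b}" for x
    using assms(3)[OF that] by (simp add: abs_mult mult_right_mono)
  then show "AE x in lebesgue_on {a..b}. norm (g x * f x) \<le> norm (C * f x)"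
    by (intro AE_I2) auto
qed

lemma integrable_continuous_mult:
  fixes f g :: "real \<Rightarrow> real"
  assumes "integrable (lebesgue_on {a..b}) f" "continuous_on {a..b} g"
  shows "integrable (lebesgue_on {a..b}) (\<lambda>x. g x * f x)"
proof -
  have "bounded (g ` {a..b})"
    using assms compact_continuous_image compact_imp_bounded by blast
  then obtain C where "\<And>x. x \<in> {a..b} \<Longrightarrow> \<bar>g x\<bar> \<le> C"
    unfolding bounded_iff by (metis imageI real_norm_def)
  then show ?thesis
    using assms by (intro integrable_bounded_mult continuous_imp_measurable_on_sets_lebesgue) auto
qed

text \<open>A bound valid on short intervals is summed over a uniform partition of mesh below
  \<open>\<delta>\<close>; both sides telescope.\<close>

lemma abs_diff_le_partition:
  fixes D B :: "real \<Rightarrow> real"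
  assumes "a \<le> b" "\<delta> > 0"
    and le: "\<And>s t. a \<le> s \<Longrightarrow> s \<le> t \<Longrightarrow> t \<le> b \<Longrightarrow> t - s < \<delta> \<Longrightarrow> \<bar>D t - D s\<bar> \<le> B t - B s"
  shows "\<bar>D b - D a\<bar> \<le> B b - B a"
proof -
  obtain n :: nat where n: "(b - a) / \<delta> < real n"
    using reals_Archimedean2 by blast
  have "n > 0"
    using n assms by (cases n) (auto simp: field_simps)
  define q where "q = (b - a) / real n"
  define p where "p i = a + real i * q" for i
  have q: "q \<ge> 0" "q < \<delta>"
    using n assms(1,2) \<open>n > 0\<close> by (auto simp: q_def field_simps)
  have p: "p 0 = a" "p n = b" using \<open>n > 0\<close> by (auto simp: p_def q_def)
  have step: "\<bar>D (p (Suc i)) - D (p i)\<bar> \<le> B (p (Suc i)) - B (p i)" if "i < n" for i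
  proof (rule le)
    show "a \<le> p i" "p i \<le> p (Suc i)"
      using q by (auto simp: p_def intro!: mult_right_mono)
    have "p (Suc i) \<le> p n"
      using that q unfolding p_def by (intro add_left_mono mult_right_mono) auto
    then show "p (Suc i) \<le> b"
      using p by simp
    show "p (Suc i) - p i < \<delta>"
      using q by (simp add: p_def algebra_simps)
  qed
  have "\<bar>D b - D a\<bar> = \<bar>\<Sum>i<n. D (p (Suc i)) - D (p i)\<bar>"
    by (subst sum_lessThan_telescope) (simp add: p)
  also have "\<dots> \<le> (\<Sum>i<n. \<bar>D (p (Suc i)) - D (p i)\<bar>)"
    by (rule sum_abs)
  also have "\<dots> \<le> (\<Sum>i<n. B (p (Suc i)) - B (p i))"
    by (intro sum_mono step) auto
  also have "\<dots> = B b - B a"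
    by (subst sum_lessThan_telescope) (simp add: p)
  finally show ?thesis .
qed

text \<open>On a short interval the increment of \<open>\<phi> \<circ> F\<close> is \<open>\<phi>' (F r)\<close> times the increment of \<open>F\<close> for some
  intermediate \<open>r\<close>, so uniform continuity of \<open>\<phi>' \<circ> F\<close> makes the error summable over partitions.\<close>

lemma integral_function_chain_rule:
  fixes f F \<phi> \<phi>' :: "real \<Rightarrow> real"
  assumes "a \<le> b" and f: "integrable (lebesgue_on {a..b}) f"
    and F: "\<And>t. t \<in> {a..b} \<Longrightarrow> F t = F a + integral\<^sup>L (lebesgue_on {a..t}) f"
    and \<phi>: "\<And>t. t \<in> {a..b} \<Longrightarrow> (\<phi> has_real_derivative \<phi>' (F t)) (at (F t))"
    and \<phi>': "continuous_on {a..b} (\<lambda>t. \<phi>' (F t))"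
  shows "\<phi> (F b) - \<phi> (F a) = integral\<^sup>L (lebesgue_on {a..b}) (\<lambda>t. \<phi>' (F t) * f t)"
proof -
  define g where "g = (\<lambda>t. \<phi>' (F t) * f t)"
  have g: "integrable (lebesgue_on {a..b}) g"
    unfolding g_def by (rule integrable_continuous_mult[OF f \<phi>'])
  have contF: "continuous_on {a..b} F"
  proof -
    have "continuous_on {a..b} (\<lambda>t. F a + integral\<^sup>L (lebesgue_on {a..t}) f)"
      by (intro continuous_intros indefinite_integral_continuous_real f)
    then show ?thesis
      by (rule continuous_on_eq) (rule F[symmetric])
  qed
  \<comment> \<open>The goal amounts to \<open>D b = D a\<close>; the total variation
    \<open>N\<close> of the integral of \<open>f\<close> will measure the error.\<close>
  define D where "D t = \<phi> (F t) - integral\<^sup>L (lebesgue_on {a..t}) g" for t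
  define N where "N t = integral\<^sup>L (lebesgue_on {a..t}) (\<lambda>r. \<bar>f r\<bar>)" for t
  have small: "\<bar>D b - D a\<bar> \<le> \<epsilon> * N b - \<epsilon> * N a" if "\<epsilon> > 0" for \<epsilon>
  proof -
    have "uniformly_continuous_on {a..b} (\<lambda>t. \<phi>' (F t))"
      by (intro compact_uniformly_continuous \<phi>') auto
    with that obtain \<delta> where "\<delta> > 0" and \<delta>: "\<And>s t. s \<in> {a..b} \<Longrightarrow> t \<in> {a..b} \<Longrightarrow>
        \<bar>s - t\<bar> < \<delta> \<Longrightarrow> \<bar>\<phi>' (F s) - \<phi>' (F t)\<bar> < \<epsilon>"
      unfolding uniformly_continuous_on_def dist_real_def by metis
    show ?thesis
    proof (rule abs_diff_le_partition[OF \<open>a \<le> b\<close> \<open>\<delta> > 0\<close>])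
      fix s t assume st: "a \<le> s" "s \<le> t" "t \<le> b" "t - s < \<delta>"
      have sub: "{s..t} \<subseteq> {a..b}" "{a..t} \<subseteq> {a..b}" using st by auto
      have intf: "integrable (lebesgue_on {s..t}) f" "integrable (lebesgue_on {a..t}) f"
        using integrable_subinterval[OF f] sub by blast+
      have intg: "integrable (lebesgue_on {s..t}) g" "integrable (lebesgue_on {a..t}) g"
        using integrable_subinterval[OF g] sub by blast+
      note combine = Equivalence_Measurable_On_Borel.integral_combine[OF _ st(1,2)]
      have Fst: "F t - F s = integral\<^sup>L (lebesgue_on {s..t}) f"
        using F[of s] F[of t] combine[OF intf(2)] st by simp
      \<comment> \<open>The derivative of \<open>\<phi>\<close> is known only at values of
        \<open>F\<close>. By continuity every point between \<open>F s\<close> and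
        \<open>F t\<close> is such a value, so the mean value theorem applies and its intermediate
        point has the form \<open>F r0\<close>.\<close>
      have ivt: "y \<in> F ` {s..t}" if "min (F s) (F t) \<le> y" "y \<le> max (F s) (F t)" for y
        using that IVT'[of F s y t] IVT2'[of F t y s] st contF
        by (force simp: min_def max_def split: if_splits
            intro: continuous_on_subset[OF contF sub(1)])
      obtain r0 where r0: "r0 \<in> {s..t}" "\<phi> (F t) - \<phi> (F s) = (F t - F s) * \<phi>' (F r0)"
      proof -
        have der: "(\<phi> has_real_derivative \<phi>' y) (at y)"
          if "min (F s) (F t) \<le> y" "y \<le> max (F s) (F t)" for y
          using ivt[OF that] \<phi> sub by auto
        consider "F s < F t" | "F s = F t" | "F t < F s" by linarith
        then show thesis
        proof cases
          case 1
          from MVT2[OF this, of \<phi> \<phi>'] der obtain z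
            where "F s < z" "z < F t" "\<phi> (F t) - \<phi> (F s) = (F t - F s) * \<phi>' z" by force
          with ivt[of z] that show ?thesis by auto
        next
          case 2
          then show ?thesis using that[of s] st by auto
        next
          case 3
          from MVT2[OF this, of \<phi> \<phi>'] der obtain z
            where "F t < z" "z < F s" "\<phi> (F s) - \<phi> (F t) = (F s - F t) * \<phi>' z" by force
          with ivt[of z] that show ?thesis by (force simp: algebra_simps)
        qed
      qed
      have "D t - D s = \<phi>' (F r0) * integral\<^sup>L (lebesgue_on {s..t}) f
          - integral\<^sup>L (lebesgue_on {s..t}) g"
        using combine[OF intg(2)] r0(2) Fst by (simp add: D_def)
      also have "\<dots> = integral\<^sup>L (lebesgue_on {s..t}) (\<lambda>r. \<phi>' (F r0) * f r - g r)"
        using intf intg by simp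
      also have "\<bar>\<dots>\<bar> \<le> integral\<^sup>L (lebesgue_on {s..t}) (\<lambda>r. \<epsilon> * \<bar>f r\<bar>)"
      proof (rule integral_abs_bound_integral)
        fix r assume "r \<in> space (lebesgue_on {s..t})"
        then have "\<bar>\<phi>' (F r0) - \<phi>' (F r)\<bar> \<le> \<epsilon>"
          using r0(1) st sub by (intro less_imp_le[OF \<delta>]) auto
        then have "\<bar>\<phi>' (F r0) - \<phi>' (F r)\<bar> * \<bar>f r\<bar> \<le> \<epsilon> * \<bar>f r\<bar>"
          by (rule mult_right_mono) auto
        then show "\<bar>\<phi>' (F r0) * f r - g r\<bar> \<le> \<epsilon> * \<bar>f r\<bar>"
          by (simp add: g_def abs_mult[symmetric] left_diff_distrib)
      qed (use intf intg in auto)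
      also have "\<dots> = \<epsilon> * N t - \<epsilon> * N s"
        using combine[OF integrable_abs[OF intf(2)]] by (simp add: N_def algebra_simps)
      finally show "\<bar>D t - D s\<bar> \<le> \<epsilon> * N t - \<epsilon> * N s" .
    qed
  qed
  have "\<bar>D b - D a\<bar> \<le> 0"
  proof (rule field_le_epsilon)
    fix e :: real assume "e > 0"
    have nonneg: "N b - N a \<ge> 0"
      by (simp add: N_def)
    \<comment> \<open>The summand 1 keeps the denominator positive when \<open>f\<close> vanishes
      almost everywhere.\<close>
    have "\<bar>D b - D a\<bar> \<le> e / (N b - N a + 1) * (N b - N a)"
      using small[of "e / (N b - N a + 1)"] \<open>e > 0\<close> nonneg by (simp add: right_diff_distrib)
    also have "\<dots> \<le> e"
      using \<open>e > 0\<close> nonneg by (simp add: field_simps)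
    finally show "\<bar>D b - D a\<bar> \<le> 0 + e" by simp
  qed
  then show ?thesis
    by (simp add: D_def g_def)
qed

text \<open>As \<open>k\<close> is merely integrable, the argument stays in integral form. The
  right-hand side \<open>W\<close> of the inequality is an integral function bounded below by
  \<open>c > 0\<close>, so the chain rule for \<open>ln\<close> applies to it, and the resulting
  integrand \<open>k r * u r / W r\<close> is at most \<open>k r\<close> almost everywhere.\<close>

lemma gronwall_integral:
  fixes k u :: "real \<Rightarrow> real"
  assumes k: "integrable (lebesgue_on {a..b}) k" "AE r in lebesgue_on {a..b}. 0 \<le> k r"
    and ku: "integrable (lebesgue_on {a..b}) (\<lambda>r. k r * u r)"
    and u: "\<And>t. t \<in> {a..b} \<Longrightarrow> 0 \<le> u t"
    and le: "\<And>t. t \<in> {a..b} \<Longrightarrow> u t \<le> c + integral\<^sup>L (lebesgue_on {a..t}) (\<lambda>r. k r * u r)"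
    and "c > 0" and t: "t \<in> {a..b}"
  shows "u t \<le> c * exp (integral\<^sup>L (lebesgue_on {a..t}) k)"
proof -
  define W where "W t = c + integral\<^sup>L (lebesgue_on {a..t}) (\<lambda>r. k r * u r)" for t
  have sub: "{a..t} \<subseteq> {a..b}" if "t \<in> {a..b}" for t using that by auto
  have AE_sub: "AE r in lebesgue_on {a..t}. P r" if "AE r in lebesgue_on {a..b}. P r" "t \<in> {a..b}" for t P
    using that by (auto simp: AE_restrict_space_iff elim: eventually_mono)
  have W_ge: "W t \<ge> c" if "t \<in> {a..b}" for t
  proof -
    have "AE r in lebesgue_on {a..t}. 0 \<le> k r"
      using AE_sub[OF k(2) that] .
    then have "AE r in lebesgue_on {a..t}. 0 \<le> k r * u r"
      using AE_space by eventually_elim (use that u in auto)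
    then show ?thesis by (simp add: W_def integral_nonneg_AE)
  qed
  have Wa: "W a = c"
    by (simp add: W_def)
  have contW: "continuous_on {a..b} W"
    unfolding W_def by (intro continuous_intros indefinite_integral_continuous_real ku)
  have ku_t: "integrable (lebesgue_on {a..t}) (\<lambda>r. k r * u r)" and k_t: "integrable (lebesgue_on {a..t}) k"
    using integrable_subinterval[OF ku sub[OF t]] integrable_subinterval[OF k(1) sub[OF t]] by auto
  have cont: "continuous_on {a..t} (\<lambda>r. inverse (W r))"
    using W_ge \<open>c > 0\<close> t by (intro continuous_on_inverse continuous_on_subset[OF contW]) force+
  have "ln (W t) - ln (W a) = integral\<^sup>L (lebesgue_on {a..t}) (\<lambda>r. inverse (W r) * (k r * u r))"
  proof (rule integral_function_chain_rule[OF _ ku_t])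
    show "W r = W a + integral\<^sup>L (lebesgue_on {a..r}) (\<lambda>r. k r * u r)" for r
      using Wa by (simp add: W_def)
    show "(ln has_real_derivative inverse (W r)) (at (W r))" if "r \<in> {a..t}" for r
      using W_ge[of r] \<open>c > 0\<close> that t by (intro DERIV_ln) auto
  qed (use t cont in auto)
  also have "\<dots> \<le> integral\<^sup>L (lebesgue_on {a..t}) k"
  proof (rule integral_mono_AE)
    show "integrable (lebesgue_on {a..t}) (\<lambda>r. inverse (W r) * (k r * u r))"
      by (rule integrable_continuous_mult[OF ku_t cont])
    have "AE r in lebesgue_on {a..t}. 0 \<le> k r"
      using AE_sub[OF k(2) t] .
    then show "AE r in lebesgue_on {a..t}. inverse (W r) * (k r * u r) \<le> k r"
      using AE_space
    proof eventually_elim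
      case (elim r)
      then have r: "r \<in> {a..b}" using t by auto
      have "k r * u r \<le> k r * W r"
        using le[OF r] elim by (intro mult_left_mono) (auto simp: W_def)
      then show ?case
        using W_ge[OF r] \<open>c > 0\<close> by (simp add: field_simps)
    qed
  qed (rule k_t)
  finally have "ln (W t) \<le> ln c + integral\<^sup>L (lebesgue_on {a..t}) k"
    by (simp add: Wa)
  then have "W t \<le> exp (ln c + integral\<^sup>L (lebesgue_on {a..t}) k)"
    using W_ge[OF t] \<open>c > 0\<close> by (metis exp_le_cancel_iff exp_ln less_le_trans)
  then show ?thesis
    using le[OF t] \<open>c > 0\<close> by (simp add: W_def exp_add)
qed

section \<open>Continuous functions with an integrable weak derivative\<close>

lemma integral_smooth_step_derivative_tendsto:
  fixes F S s :: "real \<Rightarrow> real"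
  assumes S: "\<And>x. (S has_real_derivative s x) (at x)" "continuous_on UNIV s" "\<And>x. s x \<ge> 0"
      "S 0 = 0" "S 1 = 1" "\<And>x. x \<notin> {0..1} \<Longrightarrow> s x = 0"
    and F: "continuous_on {a..b} F" and x: "a \<le> x" "x < b"
  shows "(\<lambda>n. integral\<^sup>L (lebesgue_on {a..b}) (\<lambda>r. real n * s (real n * (r - x)) * F r)) \<longlonglongrightarrow> F x"
proof (rule LIMSEQ_I)
  fix e :: real assume "e > 0"
  have "uniformly_continuous_on {a..b} F"
    by (intro compact_uniformly_continuous F) auto
  then obtain d where "d > 0" and d: "\<And>r. r \<in> {a..b} \<Longrightarrow> \<bar>r - x\<bar> < d \<Longrightarrow> \<bar>F r - F x\<bar> < e/2"
    using \<open>e > 0\<close> x unfolding uniformly_continuous_on_def dist_real_def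
    by (metis atLeastAtMost_iff half_gt_zero less_imp_le)
  \<comment> \<open>For \<open>n \<ge> n0\<close> the kernel \<open>w\<close>, supported between
    \<open>x\<close> and \<open>x + 1/n\<close>, lives inside \<open>{a..b}\<close> and within
    distance \<open>d\<close> of \<open>x\<close>. It looks only to the right, so
    \<open>x = a\<close> is allowed but \<open>x = b\<close> is not.\<close>
  obtain n0 :: nat where n0: "1 / min d (b - x) < real n0"
    using reals_Archimedean2 by blast
  show "\<exists>no. \<forall>n\<ge>no. norm (integral\<^sup>L (lebesgue_on {a..b})
      (\<lambda>r. real n * s (real n * (r - x)) * F r) - F x) < e"
  proof (intro exI allI impI)
    fix n assume "n \<ge> n0"
    with n0 have n1: "1 / min d (b - x) < real n" by linarith
    moreover have md: "0 < min d (b - x)" using \<open>d > 0\<close> x by simp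
    ultimately have "n > 0"
      by (metis divide_pos_pos less_trans of_nat_0_less_iff zero_less_one)
    have "1 / real n < min d (b - x)"
      using n1 md \<open>n > 0\<close> by (simp add: field_simps del: min_less_iff_conj)
    then have nd: "1 / real n < d" "x + 1 / real n < b" by auto
    define w where "w r = real n * s (real n * (r - x))" for r
    have w_cont: "continuous_on {a..b} w"
      unfolding w_def by (intro continuous_intros continuous_on_compose2[OF S(2)]) auto
    have w_nonneg: "w r \<ge> 0" for r using S(3) by (simp add: w_def)
    have w_supp: "r \<in> {x..x + 1 / real n}" if "w r \<noteq> 0" for r
    proof -
      from that have "real n * (r - x) \<in> {0..1}" using S(6) by (auto simp: w_def)
      then show ?thesis using \<open>n > 0\<close> by (auto simp: field_simps zero_le_mult_iff)
    qed
    have der: "((\<lambda>r. S (real n * (r - x))) has_real_derivative w r) (at r)" for r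
    proof -
      have "((\<lambda>r. real n * (r - x)) has_real_derivative real n) (at r)"
        by (auto intro!: derivative_eq_intros)
      from DERIV_chain2[OF S(1) this] show ?thesis by (simp add: w_def mult.commute)
    qed
    have const: "S y = S 1" if "y \<ge> 1" for y
    proof (cases "y = 1")
      case False
      with that have "1 < y" by simp
      from MVT2[OF this S(1)] S(6) show ?thesis by fastforce
    qed simp
    have const0: "S y = S 0" if "y \<le> 0" for y
    proof (cases "y = 0")
      case False
      with that have "y < 0" by simp
      from MVT2[OF this S(1)] S(6) show ?thesis by fastforce
    qed simp
    \<comment> \<open>The kernel has mass 1 because it is the derivative of
      \<open>S (n (r - x))\<close>, which rises from 0 to 1 on the interval.\<close>
    have "(w has_integral S (real n * (b - x)) - S (real n * (a - x))) {a..b}"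
      using x der
      by (intro fundamental_theorem_of_calculus)
        (auto simp: has_real_derivative_iff_has_vector_derivative[symmetric]
          intro: has_field_derivative_at_within)
    moreover have "S (real n * (b - x)) = 1"
      using const[of "real n * (b - x)"] nd \<open>n > 0\<close> S by (simp add: field_simps)
    moreover have "S (real n * (a - x)) = 0"
      using const0[of "real n * (a - x)"] x S by (simp add: mult_nonneg_nonpos)
    ultimately have w1: "integral\<^sup>L (lebesgue_on {a..b}) w = 1"
      by (subst lebesgue_integral_eq_integral)
        (auto intro: continuous_imp_integrable_real w_cont integral_unique)
    have intw: "integrable (lebesgue_on {a..b}) w"
      by (intro continuous_imp_integrable_real w_cont)
    have intwF: "integrable (lebesgue_on {a..b}) (\<lambda>r. w r * F r)"
      by (intro continuous_imp_integrable_real continuous_intros w_cont F)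
    have "\<bar>integral\<^sup>L (lebesgue_on {a..b}) (\<lambda>r. w r * F r) - F x\<bar>
        = \<bar>integral\<^sup>L (lebesgue_on {a..b}) (\<lambda>r. w r * F r - w r * F x)\<bar>"
      using w1 intw intwF by simp
    also have "\<dots> \<le> integral\<^sup>L (lebesgue_on {a..b}) (\<lambda>r. w r * (e / 2))"
    proof (rule integral_abs_bound_integral)
      fix r assume r: "r \<in> space (lebesgue_on {a..b})"
      show "\<bar>w r * F r - w r * F x\<bar> \<le> w r * (e / 2)"
      proof (cases "w r = 0")
        case False
        then have "\<bar>F r - F x\<bar> \<le> e / 2"
          using w_supp[OF False] nd r by (intro less_imp_le[OF d]) auto
        then have "w r * \<bar>F r - F x\<bar> \<le> w r * (e / 2)"
          by (rule mult_left_mono[OF _ w_nonneg])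
        then show ?thesis
          using w_nonneg[of r] by (simp add: right_diff_distrib[symmetric] abs_mult)
      qed simp
    qed (use intw intwF in auto)
    also have "\<dots> < e"
      using w1 \<open>e > 0\<close> by simp
    finally show "norm (integral\<^sup>L (lebesgue_on {a..b}) (\<lambda>r. real n * s (real n * (r - x)) * F r) - F x) < e"
      by (simp add: w_def)
  qed
qed

text \<open>Test functions \<open>S (n (r - s)) - S (n (r - t))\<close>, with \<open>S\<close> a smooth step, approximate the indicator of \<open>{s<..t}\<close>.\<close>

lemma weak_derivative_imp_integral_interior:
  fixes F f :: "real \<Rightarrow> real"
  assumes F: "continuous_on {a..b} F" and f: "integrable (lebesgue_on {a..b}) f"
    and weak: "\<forall>\<eta> \<eta>' l u. (\<forall>k. C_k k \<eta>) \<longrightarrow> (\<forall>x. (\<eta> has_real_derivative \<eta>' x) (at x)) \<longrightarrow>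
        a < l \<longrightarrow> u < b \<longrightarrow> (\<forall>x. x \<notin> {l..u} \<longrightarrow> \<eta> x = 0) \<longrightarrow>
        integral\<^sup>L (lebesgue_on {a..b}) (\<lambda>r. \<eta>' r * F r + \<eta> r * f r) = 0"
    and st: "a < s" "s \<le> t" "t < b"
  shows "F t - F s = integral\<^sup>L (lebesgue_on {s..t}) f"
proof -
  obtain S S' :: "real \<Rightarrow> real" where S: "\<And>k. C_k k S" "\<And>k. C_k k S'"
      "\<And>x. (S has_real_derivative S' x) (at x)" "\<And>x. S' x \<ge> 0" "\<And>x. x \<le> 0 \<Longrightarrow> S x = 0"
      "\<And>x. x \<ge> 1 \<Longrightarrow> S x = 1" "\<And>x. x \<notin> {0..1} \<Longrightarrow> S' x = 0"
    by (rule smooth_step) blast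
  have contS: "continuous_on UNIV S" "continuous_on UNIV S'"
    using S(1)[of 0] S(2)[of 0] by auto
  have mono: "S x \<le> S y" if "x \<le> y" for x y
    by (rule DERIV_nonneg_imp_nondecreasing[OF that]) (use S in blast)
  have S01: "0 \<le> S x" "S x \<le> 1" for x
    using mono[of "min x 0" x] mono[of x "max x 1"] S(5)[of "min x 0"] S(6)[of "max x 1"] by linarith+
  define w where "w n x r = real n * S' (real n * (r - x))" for n x r
  define \<eta> where "\<eta> n r = S (real n * (r - s)) - S (real n * (r - t))" for n r
  have w_cont: "continuous_on {a..b} (w n x)" for n x
    unfolding w_def by (intro continuous_intros continuous_on_compose2[OF contS(2)]) auto
  have \<eta>_cont: "continuous_on {a..b} (\<eta> n)" for n
    unfolding \<eta>_def by (intro continuous_intros continuous_on_compose2[OF contS(1)]) auto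
  have lim_F: "(\<lambda>n. integral\<^sup>L (lebesgue_on {a..b}) (\<lambda>r. w n x r * F r)) \<longlonglongrightarrow> F x"
    if "a \<le> x" "x < b" for x
    unfolding w_def
    by (rule integral_smooth_step_derivative_tendsto[of S S']) (use S contS F that in auto)
  have "eventually (\<lambda>n. integral\<^sup>L (lebesgue_on {a..b}) (\<lambda>r. (w n s r - w n t r) * F r + \<eta> n r * f r) = 0) sequentially"
  proof -
    \<comment> \<open>The function \<open>\<eta> n\<close> is supported between \<open>s\<close> and
      \<open>t + 1/n\<close>, which stays left of \<open>b\<close> once
      \<open>n > 1 / (b - t)\<close>.\<close>
    obtain n0 :: nat where n0: "1 / (b - t) < real n0"
      using reals_Archimedean2 by blast
    show ?thesis
    proof (rule eventually_sequentiallyI)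
      fix n assume "n0 \<le> n"
      with n0 have n1: "1 / (b - t) < real n" by linarith
      moreover have "0 < 1 / (b - t)" using st by simp
      ultimately have "n > 0" by linarith
      show "integral\<^sup>L (lebesgue_on {a..b}) (\<lambda>r. (w n s r - w n t r) * F r + \<eta> n r * f r) = 0"
      proof (rule weak[rule_format, of "\<eta> n" _ s "t + 1 / real n"])
        show "C_k k (\<eta> n)" for k
        proof -
          have "C_k k (\<lambda>r. real n * (r - x))" for x
            by (intro C_k_mult C_k_diff C_k_const C_k_bounded_linear bounded_linear_ident)
          from C_k_diff[OF C_k_compose[OF S(1) this[of s]] C_k_compose[OF S(1) this[of t]]]
          show ?thesis unfolding \<eta>_def .
        qed
        show "(\<eta> n has_real_derivative w n s r - w n t r) (at r)" for r
        proof -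
          have "((\<lambda>r. S (real n * (r - x))) has_real_derivative w n x r) (at r)" for x
          proof -
            have "((\<lambda>r. real n * (r - x)) has_real_derivative real n) (at r)"
              by (auto intro!: derivative_eq_intros)
            from DERIV_chain2[OF S(3) this] show ?thesis by (simp add: w_def mult.commute)
          qed
          from DERIV_diff[OF this[of s] this[of t]] show ?thesis
            unfolding \<eta>_def .
        qed
        show "t + 1 / real n < b"
          using n1 st \<open>n > 0\<close> by (simp add: field_simps)
        show "\<eta> n r = 0" if "r \<notin> {s..t + 1 / real n}" for r
        proof (cases "r < s")
          case True
          with st have "real n * (r - s) \<le> 0" "real n * (r - t) \<le> 0"
            by (auto simp: mult_nonneg_nonpos)
          then show ?thesis using S(5) by (simp add: \<eta>_def)
        next
          case False
          with that have "r > t + 1 / real n" by auto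
          then have "real n * (r - t) \<ge> 1" using \<open>n > 0\<close> by (simp add: field_simps)
          moreover from this have "real n * (r - s) \<ge> 1"
            using st by (smt (verit) mult_left_mono of_nat_0_le_iff)
          ultimately show ?thesis using S(6) by (simp add: \<eta>_def)
        qed
      qed (use st in auto)
    qed
  qed
  moreover have "integral\<^sup>L (lebesgue_on {a..b}) (\<lambda>r. (w n s r - w n t r) * F r + \<eta> n r * f r)
      = integral\<^sup>L (lebesgue_on {a..b}) (\<lambda>r. w n s r * F r) - integral\<^sup>L (lebesgue_on {a..b}) (\<lambda>r. w n t r * F r)
        + integral\<^sup>L (lebesgue_on {a..b}) (\<lambda>r. \<eta> n r * f r)" for n
  proof -
    have "integrable (lebesgue_on {a..b}) (\<lambda>r. w n x r * F r)" for x
      by (intro continuous_imp_integrable_real continuous_intros w_cont F)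
    moreover have "integrable (lebesgue_on {a..b}) (\<lambda>r. \<eta> n r * f r)"
      by (rule integrable_continuous_mult[OF f \<eta>_cont])
    ultimately show ?thesis by (simp add: left_diff_distrib)
  qed
  moreover have "(\<lambda>n. integral\<^sup>L (lebesgue_on {a..b}) (\<lambda>r. \<eta> n r * f r))
      \<longlonglongrightarrow> integral\<^sup>L (lebesgue_on {a..b}) (\<lambda>r. indicator {s<..t} r * f r)"
  proof (rule integral_dominated_convergence[where w = "\<lambda>r. \<bar>f r\<bar>"])
    show "(\<lambda>r. indicat_real {s<..t} r * f r) \<in> borel_measurable (lebesgue_on {a..b})"
    proof (intro borel_measurable_times borel_measurable_indicator)
      show "{s<..t} \<in> sets (lebesgue_on {a..b})"
        using st by (auto simp: sets_restrict_space_iff)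
    qed (use f in auto)
    show "(\<lambda>r. \<eta> n r * f r) \<in> borel_measurable (lebesgue_on {a..b})" for n
      using integrable_continuous_mult[OF f \<eta>_cont] by auto
    show "AE r in lebesgue_on {a..b}. (\<lambda>n. \<eta> n r * f r) \<longlonglongrightarrow> indicat_real {s<..t} r * f r"
    proof (intro AE_I2 tendsto_mult_right)
      fix r
      \<comment> \<open>The limit holds at every \<open>r\<close>, endpoints included: the step at
        \<open>x\<close> vanishes at \<open>r = x\<close> because \<open>S 0 = 0\<close>. Hence the
        half-open interval.\<close>
      have lim: "(\<lambda>n. S (real n * (r - x))) \<longlonglongrightarrow> (if r > x then 1 else 0)" for x
      proof (cases "r > x")
        case True
        obtain n0 :: nat where n0: "1 / (r - x) < real n0"
          using reals_Archimedean2 by blast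
        have "eventually (\<lambda>n. S (real n * (r - x)) = 1) sequentially"
        proof (rule eventually_sequentiallyI)
          fix n assume "n0 \<le> n"
          with n0 have "1 / (r - x) < real n" by linarith
          then have "real n * (r - x) \<ge> 1" using True by (simp add: field_simps)
          then show "S (real n * (r - x)) = 1" by (rule S(6))
        qed
        then show ?thesis using True by (simp add: tendsto_eventually)
      next
        case False
        then have "S (real n * (r - x)) = 0" for n
          by (intro S(5)) (simp add: mult_nonneg_nonpos)
        then show ?thesis using False by simp
      qed
      show "(\<lambda>n. \<eta> n r) \<longlonglongrightarrow> indicat_real {s<..t} r"
        unfolding \<eta>_def using tendsto_diff[OF lim[of s] lim[of t]] st
        by (auto simp: indicator_def split: if_splits)
    qed
    have "\<bar>\<eta> n r\<bar> \<le> 1" for n r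
      using S01[of "real n * (r - s)"] S01[of "real n * (r - t)"] unfolding \<eta>_def by linarith
    then show "AE r in lebesgue_on {a..b}. norm (\<eta> n r * f r) \<le> \<bar>f r\<bar>" for n
      by (intro AE_I2) (simp add: abs_mult mult_left_le_one_le)
  qed (use f in auto)
  ultimately have "(\<lambda>n. 0) \<longlonglongrightarrow> F s - F t + integral\<^sup>L (lebesgue_on {a..b}) (\<lambda>r. indicator {s<..t} r * f r)"
    using lim_F[of s] lim_F[of t] st
    by (intro Lim_transform_eventually[OF tendsto_add[OF tendsto_diff]]) auto
  then have "F t - F s = integral\<^sup>L (lebesgue_on {a..b}) (\<lambda>r. indicator {s<..t} r * f r)"
    using LIMSEQ_unique[OF tendsto_const] by force
  also have "\<dots> = integral\<^sup>L lebesgue (\<lambda>r. indicator {a..b} r *\<^sub>R (indicator {s<..t} r * f r))"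
    by (simp add: integral_restrict_space)
  also have "\<dots> = integral\<^sup>L lebesgue (\<lambda>r. indicator {s..t} r *\<^sub>R f r)"
  proof (rule integral_cong_AE)
    have "AE r in lebesgue. r \<noteq> s"
      by (simp add: AE_completion AE_lborel_singleton)
    then show "AE r in lebesgue. indicator {a..b} r *\<^sub>R (indicator {s<..t} r * f r) = indicator {s..t} r *\<^sub>R f r"
      by eventually_elim (use st in \<open>auto simp: indicator_def\<close>)
    have "integrable (lebesgue_on {s..t}) f"
      using st by (intro integrable_subinterval[OF f]) auto
    then show "(\<lambda>r. indicator {s..t} r *\<^sub>R f r) \<in> borel_measurable lebesgue"
      by (intro borel_measurable_integrable) (simp add: integrable_restrict_space)
    have "(\<lambda>r. indicator {a..b} r *\<^sub>R f r) \<in> borel_measurable lebesgue"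
      using f by (intro borel_measurable_integrable) (simp add: integrable_restrict_space)
    then have "(\<lambda>r. indicator {s<..t} r * (indicator {a..b} r *\<^sub>R f r)) \<in> borel_measurable lebesgue"
      by (intro borel_measurable_times borel_measurable_indicator) auto
    then show "(\<lambda>r. indicator {a..b} r *\<^sub>R (indicator {s<..t} r * f r)) \<in> borel_measurable lebesgue"
      by (simp add: mult_ac)
  qed
  also have "\<dots> = integral\<^sup>L (lebesgue_on {s..t}) f"
    by (simp add: integral_restrict_space)
  finally show ?thesis .
qed

text \<open>\<open>F\<close> minus the integral of \<open>f\<close> is constant on the open interval
  by the preceding lemma; continuity carries this to the endpoints, which the supports of the test
  functions do not reach.\<close>

lemma weak_derivative_imp_integral:
  fixes F f :: "real \<Rightarrow> real"
  assumes "a < b" and F: "continuous_on {a..b} F" and f: "integrable (lebesgue_on {a..b}) f"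
    and weak: "\<forall>\<eta> \<eta>' l u. (\<forall>k. C_k k \<eta>) \<longrightarrow> (\<forall>x. (\<eta> has_real_derivative \<eta>' x) (at x)) \<longrightarrow>
        a < l \<longrightarrow> u < b \<longrightarrow> (\<forall>x. x \<notin> {l..u} \<longrightarrow> \<eta> x = 0) \<longrightarrow>
        integral\<^sup>L (lebesgue_on {a..b}) (\<lambda>r. \<eta>' r * F r + \<eta> r * f r) = 0"
    and t: "t \<in> {a..b}"
  shows "F t = F a + integral\<^sup>L (lebesgue_on {a..t}) f"
proof -
  define D where "D t = F t - integral\<^sup>L (lebesgue_on {a..t}) f" for t
  let ?m = "(a + b) / 2"
  have "continuous_on {a..b} D"
    unfolding D_def by (intro continuous_intros F indefinite_integral_continuous_real f)
  then have D: "continuous_on (closure {a<..<b}) D"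
    using \<open>a < b\<close> by simp
  have const: "D y = D ?m" if y: "y \<in> {a<..<b}" for y
  proof -
    have *: "D v = D u" if "a < u" "u \<le> v" "v < b" for u v
    proof -
      have "integrable (lebesgue_on {a..v}) f"
        using that by (intro integrable_subinterval[OF f]) auto
      moreover have "F v - F u = integral\<^sup>L (lebesgue_on {u..v}) f"
        by (rule weak_derivative_imp_integral_interior[OF F f weak that])
      ultimately show ?thesis
        using Equivalence_Measurable_On_Borel.integral_combine[of a v f u] that by (simp add: D_def)
    qed
    show ?thesis
    proof (cases "y \<le> ?m")
      case True
      then show ?thesis using *[of y ?m] y \<open>a < b\<close> by simp
    next
      case False
      then show ?thesis using *[of ?m y] y \<open>a < b\<close> by simp
    qed
  qed
  have "D y = D ?m" if "y \<in> {a..b}" for y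
    by (rule continuous_constant_on_closure[OF D const]) (use that \<open>a < b\<close> in auto)
  from this[of t] this[of a] have "D t = D a"
    using t \<open>a < b\<close> by simp
  then show ?thesis by (simp add: D_def)
qed

section \<open>Lipschitz flows\<close>

text \<open>The integrand varies with the parameter \<open>x\<close>. Pushing \<open>L x\<close>
  forward along \<open>y \<mapsto> (x, y)\<close> moves this dependence into the measure, so that
  one fixed function on the product space is integrated.\<close>

lemma integral_measurable_subprob_algebra2:
  fixes f :: "'a \<Rightarrow> 'b \<Rightarrow> real"
  assumes f[measurable]: "(\<lambda>(x, y). f x y) \<in> borel_measurable (M \<Otimes>\<^sub>M N)"
    and L[measurable]: "L \<in> M \<rightarrow>\<^sub>M subprob_algebra N"
  shows "(\<lambda>x. integral\<^sup>L (L x) (f x)) \<in> borel_measurable M"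
proof -
  note measurable_distr2[measurable]
  have "(\<lambda>x. integral\<^sup>L (distr (L x) (M \<Otimes>\<^sub>M N) (\<lambda>y. (x, y))) (\<lambda>(x, y). f x y)) \<in> borel_measurable M"
    by measurable
  then show ?thesis
    by (rule measurable_cong[THEN iffD1, rotated]) (simp add: integral_distr)
qed

lemma borel_measurable_lebesgue_on_of_borel:
  fixes f :: "'a::euclidean_space \<Rightarrow> real"
  assumes "f \<in> borel_measurable (restrict_space borel S)" "S \<in> sets borel"
  shows "f \<in> borel_measurable (lebesgue_on S)"
proof -
  have "(\<lambda>x. f x * indicator S x) \<in> borel_measurable lborel"
    using assms by (subst (asm) borel_measurable_restrict_space_iff) (auto simp: mult.commute)
  then have "(\<lambda>x. f x * indicator S x) \<in> borel_measurable lebesgue"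
    by (rule measurable_completion)
  then show ?thesis
    using assms by (subst borel_measurable_restrict_space_iff) (auto simp: mult.commute)
qed

section \<open>Measures with finite second moment\<close>

lemma P2_D:
  assumes "m \<in> P2"
  shows "prob_space m" "sets m = sets borel" "integrable m (\<lambda>x. (norm x)\<^sup>2)"
proof -
  show m: "prob_space m" "sets m = sets borel" using assms by (auto simp: P2_def)
  have [measurable_cong]: "sets m = sets borel" by fact
  show "integrable m (\<lambda>x. (norm x)\<^sup>2)"
    using assms by (intro integrableI_bounded) (auto simp: P2_def)
qed

lemma P2_integrable:
  fixes f :: "'a::euclidean_space \<Rightarrow> 'b::{banach, second_countable_topology}"
  assumes "m \<in> P2" "f \<in> borel_measurable borel" "\<And>x. norm (f x) \<le> A + B * (norm x)\<^sup>2"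
  shows "integrable m f"
proof (rule Bochner_Integration.integrable_bound)
  interpret prob_space m using P2_D(1)[OF assms(1)] .
  show "integrable m (\<lambda>x. A + B * (norm x)\<^sup>2)"
    using P2_D(3)[OF assms(1)] by simp
  show "f \<in> borel_measurable m"
    using assms(2) P2_D(2)[OF assms(1)] measurable_cong_sets by blast
  show "AE x in m. norm (f x) \<le> norm (A + B * (norm x)\<^sup>2)"
    using assms(3) by (intro AE_I2) (metis abs_ge_self order_trans real_norm_def)
qed

lemma norm_le_1_plus_square:
  fixes x :: "'a::real_normed_vector"
  shows "norm x \<le> 1 + (norm x)\<^sup>2"
proof -
  have "0 \<le> (1 - norm x)\<^sup>2" by simp
  then show ?thesis
    unfolding power2_diff power_one using norm_ge_zero[of x] zero_le_power2[of "norm x"] by linarith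
qed

lemma integrable_dist_P2:
  fixes \<nu> :: "'a::euclidean_space measure"
  assumes \<nu>: "\<nu> \<in> P2"
  shows "integrable \<nu> (\<lambda>y. dist x y)"
proof (rule P2_integrable[OF \<nu>, where A = "norm x + 1" and B = 1])
  show "norm (dist x y) \<le> norm x + 1 + 1 * (norm y)\<^sup>2" for y
    using norm_triangle_ineq4[of x y] norm_le_1_plus_square[of y] by (simp add: dist_norm)
qed simp

text \<open>This makes integrals over \<open>m t\<close> measurable in \<open>t\<close>. Open sets
  are an intersection-stable generator of the Borel sets, and the indicator of an open
  \<open>U\<close> is the limit of the bounded continuous functions
  \<open>min 1 (n * infdist x (- U))\<close>.\<close>

lemma narrowly_continuous_kernel:
  fixes m :: "real \<Rightarrow> 'a::euclidean_space measure"
  assumes "narrowly_continuous_P2 a b m"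
  shows "m \<in> restrict_space borel {a..b} \<rightarrow>\<^sub>M prob_algebra borel"
proof (rule measurable_prob_algebra_generated[where \<Omega> = UNIV and G = "{S. open S}"])
  show "sets borel = sigma_sets UNIV {S::'a set. open S}" by (simp add: borel_def)
  show "Int_stable {S::'a set. open S}" by (auto simp: Int_stable_def)
  have P2: "m t \<in> P2" if "t \<in> {a..b}" for t
    using assms that by (auto simp: narrowly_continuous_P2_def)
  then show "prob_space (m t)" "sets (m t) = sets borel" if "t \<in> space (restrict_space borel {a..b})" for t
    using that P2_D by (auto simp: space_restrict_space)
  fix U :: "'a set" assume "U \<in> {S. open S}"
  then have U: "open U" by simp
  show "(\<lambda>t. emeasure (m t) U) \<in> borel_measurable (restrict_space borel {a..b})"
  \<comment> \<open>The approximation fails for the whole space, since the distance to the empty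
    complement is 0 by convention.\<close>
  proof (cases "U = UNIV")
    case True
    have "emeasure (m t) U = 1" if "t \<in> {a..b}" for t
      using prob_space.emeasure_space_1[of "m t"] P2_D[OF P2[OF that]] sets_eq_imp_space_eq[of "m t" borel]
      by (simp add: True)
    then show ?thesis
      by (subst measurable_cong[of _ _ "\<lambda>t. 1"]) (auto simp: space_restrict_space)
  next
    case False
    define f where "f n x = min 1 (real n * infdist x (- U))" for n x
    have cont: "continuous_on UNIV (f n)" for n
      unfolding f_def by (intro continuous_intros)
    have bound: "0 \<le> f n x" "f n x \<le> 1" for n x
      by (auto simp: f_def infdist_nonneg)
    have lim: "(\<lambda>n. f n x) \<longlonglongrightarrow> indicator U x" for x
    proof (cases "x \<in> U")
      case True
      have "infdist x (- U) > 0"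
        using True U False by (subst infdist_pos_not_in_closed) auto
      then obtain n0 :: nat where n0: "1 / infdist x (- U) < real n0"
        using reals_Archimedean2 by blast
      have "f n x = 1" if "n \<ge> n0" for n
      proof -
        have "1 / infdist x (- U) < real n" using n0 that by linarith
        then have "1 \<le> real n * infdist x (- U)"
          using \<open>infdist x (- U) > 0\<close> by (simp add: field_simps)
        then show ?thesis by (simp add: f_def)
      qed
      then show ?thesis
        using True by (intro tendsto_eventually eventually_sequentiallyI[of n0]) auto
    next
      case False
      then show ?thesis by (simp add: f_def)
    qed
    have "(\<lambda>t. measure (m t) U) \<in> borel_measurable (restrict_space borel {a..b})"
    proof (rule borel_measurable_LIMSEQ_real)
      show "(\<lambda>t. \<integral>x. f n x \<partial>m t) \<in> borel_measurable (restrict_space borel {a..b})" for n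
      proof (rule borel_measurable_continuous_on_restrict)
        have "bounded (range (f n))"
          using bound by (auto simp: bounded_iff intro!: exI[of _ 1])
        then show "continuous_on {a..b} (\<lambda>t. \<integral>x. f n x \<partial>m t)"
          using assms cont by (auto simp: narrowly_continuous_P2_def)
      qed
      show "(\<lambda>n. \<integral>x. f n x \<partial>m t) \<longlonglongrightarrow> measure (m t) U" if "t \<in> space (restrict_space borel {a..b})" for t
      proof -
        have t: "m t \<in> P2" using that P2 by (simp add: space_restrict_space)
        interpret prob_space "m t" using P2_D(1)[OF t] .
        have [measurable_cong]: "sets (m t) = sets borel" using P2_D(2)[OF t] .
        have "(\<lambda>n. \<integral>x. f n x \<partial>m t) \<longlonglongrightarrow> (\<integral>x. indicat_real U x \<partial>m t)"
        proof (rule integral_dominated_convergence[where w = "\<lambda>_. 1"])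
          show "f n \<in> borel_measurable (m t)" for n
            using borel_measurable_continuous_onI[OF cont] by measurable
          show "indicat_real U \<in> borel_measurable (m t)"
            using U P2_D(2)[OF t] by (intro borel_measurable_indicator) simp
        qed (use bound lim in auto)
        moreover have "(\<integral>x. indicat_real U x \<partial>m t) = measure (m t) U"
          using U P2_D(2)[OF t] sets_eq_imp_space_eq[of "m t" borel] by simp
        ultimately show ?thesis by simp
      qed
    qed
    moreover have "emeasure (m t) U = ennreal (measure (m t) U)" if "t \<in> {a..b}" for t
    proof -
      interpret prob_space "m t" using P2_D(1)[OF P2[OF that]] .
      show ?thesis by (rule emeasure_eq_measure)
    qed
    ultimately show ?thesis
      by (subst measurable_cong[of _ _ "\<lambda>t. ennreal (measure (m t) U)"]) (auto simp: space_restrict_space)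
  qed
qed simp

text \<open>The infimum in \<open>Lip\<close> is attained: the difference quotient of any two
  distinct points is a lower bound of the set of all Lipschitz constants.\<close>

lemma lipschitz_on_Lip:
  assumes "L-lipschitz_on UNIV f"
  shows "(Lip f)-lipschitz_on UNIV f"
proof -
  let ?S = "{L. L-lipschitz_on UNIV f}"
  have ne: "?S \<noteq> {}" using assms by auto
  have bdd: "bdd_below ?S" by (rule bdd_belowI[of _ 0]) (auto dest: lipschitz_on_nonneg)
  show ?thesis
  proof (rule lipschitz_onI)
    show "0 \<le> Lip f"
      unfolding Lip_def using ne by (intro cInf_greatest) (auto dest: lipschitz_on_nonneg)
    fix x y
    show "dist (f x) (f y) \<le> Lip f * dist x y"
    proof (cases "x = y")
      case False
      have "dist (f x) (f y) / dist x y \<le> Lip f"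
        unfolding Lip_def
      proof (rule cInf_greatest[OF ne])
        fix L assume "L \<in> ?S"
        then have "dist (f x) (f y) \<le> L * dist x y" by (auto dest: lipschitz_onD)
        then show "dist (f x) (f y) / dist x y \<le> L" using False by (simp add: field_simps)
      qed
      then show ?thesis using False by (simp add: field_simps)
    qed simp
  qed
qed

section \<open>Compactly supported functions as test functions\<close>

lemma smooth_compact_support_derivative:
  fixes \<psi> :: "'a::euclidean_space \<Rightarrow> real"
  assumes smooth: "\<And>k. C_k k \<psi>" and supp: "{x. \<psi> x \<noteq> 0} \<subseteq> cball 0 R"
  shows "(\<psi> has_derivative frechet_derivative \<psi> (at x)) (at x)"
    and "continuous_on UNIV (\<lambda>x. frechet_derivative \<psi> (at x) v)"
    and "frechet_derivative \<psi> (at x) v = (\<Sum>i\<in>Basis. (v \<bullet> i) * frechet_derivative \<psi> (at x) i)"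
    and "norm x > R \<Longrightarrow> frechet_derivative \<psi> (at x) v = 0"
    and "\<exists>C\<ge>0. \<forall>x v. \<bar>frechet_derivative \<psi> (at x) v\<bar> \<le> C * norm v"
proof -
  let ?D = "\<lambda>x. frechet_derivative \<psi> (at x)"
  show D: "(\<psi> has_derivative ?D x) (at x)" for x
    using smooth[of 1] by (simp add: frechet_derivative_works[symmetric])
  show cont: "continuous_on UNIV (\<lambda>x. ?D x v)" for v
    using smooth[of 1] by simp
  have lin: "linear (?D x)" for x
    using D has_derivative_linear by blast
  \<comment> \<open>The basis expansion reduces a direction depending on the point to finitely many
    fixed directions, where continuity in \<open>x\<close> is known. Measurability of derivatives in
    the direction of a control is later derived from it.\<close>
  show sum: "?D x v = (\<Sum>i\<in>Basis. (v \<bullet> i) * ?D x i)" for x v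
  proof -
    have "?D x v = ?D x (\<Sum>i\<in>Basis. (v \<bullet> i) *\<^sub>R i)" by (simp add: euclidean_representation)
    also have "\<dots> = (\<Sum>i\<in>Basis. ?D x ((v \<bullet> i) *\<^sub>R i))" by (rule linear_sum[OF lin])
    finally show ?thesis by (simp add: linear_cmul[OF lin])
  qed
  show zero: "?D x v = 0" if "norm x > R" for x v
  proof -
    have "((\<lambda>x. 0) has_derivative (\<lambda>v. 0)) (at x)" by simp
    then have "(\<psi> has_derivative (\<lambda>v. 0)) (at x)"
      by (rule has_derivative_transform_within_open[where s = "{x. norm x > R}"])
        (use that supp in \<open>auto intro!: open_Collect_less continuous_intros\<close>)
    from has_derivative_unique[OF D this] show ?thesis by metis
  qed
  have ex: "\<exists>c. \<forall>x. \<bar>?D x i\<bar> \<le> c" for i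
  proof -
    have "compact ((\<lambda>x. ?D x i) ` cball 0 R)"
      by (intro compact_continuous_image continuous_on_subset[OF cont]) auto
    then have "bounded ((\<lambda>x. ?D x i) ` cball 0 R)"
      by (rule compact_imp_bounded)
    then obtain c where "\<forall>x\<in>cball 0 R. norm (?D x i) \<le> c"
      unfolding bounded_iff by blast
    then have c: "\<bar>?D x i\<bar> \<le> c" if "norm x \<le> R" for x
      using that by simp
    have "\<bar>?D x i\<bar> \<le> max c 0" for x
      using c[of x] zero[of x i] by (cases "norm x \<le> R") auto
    then show ?thesis by blast
  qed
  obtain c where c: "\<And>i x. \<bar>?D x i\<bar> \<le> c i"
    using ex choice[of "\<lambda>i c. \<forall>x. \<bar>?D x i\<bar> \<le> c"] by blast
  have "\<bar>?D x v\<bar> \<le> (\<Sum>i\<in>Basis. c i) * norm v" for x v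
  proof -
    have "\<bar>?D x v\<bar> \<le> (\<Sum>i\<in>Basis. \<bar>(v \<bullet> i) * ?D x i\<bar>)"
      by (subst sum) (rule sum_abs)
    also have "\<dots> \<le> (\<Sum>i\<in>Basis. norm v * c i)"
      by (intro sum_mono) (simp add: abs_mult mult_mono Basis_le_norm c)
    finally show ?thesis by (simp add: sum_distrib_left mult.commute)
  qed
  moreover have "0 \<le> (\<Sum>i\<in>Basis. c i)"
    by (intro sum_nonneg) (rule order_trans[OF abs_ge_zero c])
  ultimately show "\<exists>C\<ge>0. \<forall>x v. \<bar>?D x v\<bar> \<le> C * norm v" by blast
qed

text \<open>Such products suffice to extract from the continuity equation the evolution of the
  average of a function of space alone.\<close>

lemma product_test_function:
  fixes \<eta> :: "real \<Rightarrow> real" and \<psi> :: "'a::euclidean_space \<Rightarrow> real"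
  assumes "\<And>k. C_k k \<eta>" "\<And>k. C_k k \<psi>" "a < l" "u < b"
    and "\<And>t. t \<notin> {l..u} \<Longrightarrow> \<eta> t = 0" "{x. \<psi> x \<noteq> 0} \<subseteq> cball 0 R"
  shows "(\<lambda>z. \<eta> (fst z) * \<psi> (snd z)) \<in> test_functions ({a<..<b} \<times> UNIV)"
proof -
  let ?K = "{l..u} \<times> cball (0::'a) R"
  have smooth: "C_k k (\<lambda>z. \<eta> (fst z) * \<psi> (snd z))" for k
    by (intro C_k_mult C_k_compose_linear[OF assms(1) bounded_linear_fst]
        C_k_compose_linear[OF assms(2) bounded_linear_snd])
  have K: "compact ?K" by (intro compact_Times compact_cball) auto
  have "{z. \<eta> (fst z) * \<psi> (snd z) \<noteq> 0} \<subseteq> ?K"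
    using assms(5,6) by force
  then have sub: "closure {z. \<eta> (fst z) * \<psi> (snd z) \<noteq> 0} \<subseteq> ?K"
    by (intro closure_minimal compact_imp_closed K)
  then have "compact (closure {z. \<eta> (fst z) * \<psi> (snd z) \<noteq> 0})"
    using compact_Int_closed[OF K, of "closure {z. \<eta> (fst z) * \<psi> (snd z) \<noteq> 0}"]
    by (simp add: Int_absorb1)
  then show ?thesis
    using smooth sub assms(3,4) by (force simp: test_functions_def)
qed

section \<open>Averages along a solution with Lipschitz control\<close>

locale lipschitz_flow =
  fixes a b :: real and \<alpha> :: "real \<Rightarrow> 'a::euclidean_space \<Rightarrow> 'a" and m :: "real \<Rightarrow> 'a measure"
  assumes ab: "a < b" and L1: "L1_Lip a b \<alpha>" and narrow: "narrowly_continuous_P2 a b m"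
    and CE: "continuity_equation a b \<alpha> m"
begin

text \<open>One integrable weight controlling both the size at the origin and the Lipschitz
  constant, at the times where \<open>Lip\<close> is meaningful.\<close>

definition \<kappa> :: "real \<Rightarrow> real" where "\<kappa> t = norm (\<alpha> t 0) + Lip (\<alpha> t)"

text \<open>Collects the estimates that hold at almost every time. Where the control is not
  Lipschitz nothing is known about \<open>\<kappa>\<close>, so its sign is a clause too; membership
  in \<open>{a..b}\<close> gives access to \<open>m t \<in> P2\<close>.\<close>

definition regular :: "real \<Rightarrow> bool" where
  "regular t \<longleftrightarrow> t \<in> {a..b} \<and> 0 \<le> \<kappa> t \<and> (\<forall>x. norm (\<alpha> t x) \<le> \<kappa> t * (1 + norm x)) \<and>
     (\<forall>x y. norm (\<alpha> t x - \<alpha> t y) \<le> \<kappa> t * norm (x - y))"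

lemma P2: "t \<in> {a..b} \<Longrightarrow> m t \<in> P2"
  using narrow by (auto simp: narrowly_continuous_P2_def)

lemma integrable_\<kappa>: "integrable (lebesgue_on {a..b}) \<kappa>"
  using L1 by (simp add: L1_Lip_def \<kappa>_def[abs_def])

lemma AE_regular: "AE t in lebesgue_on {a..b}. regular t"
proof -
  have "AE t in lebesgue_on {a..b}. \<exists>L. L-lipschitz_on UNIV (\<alpha> t)"
    using L1 by (simp add: L1_Lip_def)
  then show ?thesis
    using AE_space
  proof eventually_elim
    case (elim t)
    then have lip: "(Lip (\<alpha> t))-lipschitz_on UNIV (\<alpha> t)" using lipschitz_on_Lip by blast
    have nonneg: "0 \<le> Lip (\<alpha> t)" using lipschitz_on_nonneg[OF lip] .
    have lip': "norm (\<alpha> t x - \<alpha> t y) \<le> Lip (\<alpha> t) * norm (x - y)" for x y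
      using lipschitz_onD[OF lip, of x y] by (simp add: dist_norm)
    have "norm (\<alpha> t x) \<le> \<kappa> t * (1 + norm x)" for x
    proof -
      have "norm (\<alpha> t x) \<le> norm (\<alpha> t 0) + Lip (\<alpha> t) * norm x"
        using norm_triangle_sub[of "\<alpha> t x" "\<alpha> t 0"] lip'[of x 0] by simp
      also have "\<dots> \<le> \<kappa> t * (1 + norm x)"
        using nonneg by (simp add: \<kappa>_def algebra_simps)
      finally show ?thesis .
    qed
    moreover have "norm (\<alpha> t x - \<alpha> t y) \<le> \<kappa> t * norm (x - y)" for x y
      using lip'[of x y] mult_right_mono[of "Lip (\<alpha> t)" "\<kappa> t" "norm (x - y)"]
      by (simp add: \<kappa>_def)
    ultimately show ?case
      using nonneg elim by (simp add: regular_def \<kappa>_def)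
  qed
qed

lemma AE_regular_sub:
  assumes "t \<in> {a..b}"
  shows "AE r in lebesgue_on {a..t}. regular r"
  using AE_regular assms by (auto simp: AE_restrict_space_iff elim: eventually_mono)

lemma regular_measurable:
  assumes "regular t"
  shows "\<alpha> t \<in> borel_measurable borel"
proof -
  have "(\<kappa> t)-lipschitz_on UNIV (\<alpha> t)"
    using assms by (auto simp: regular_def dist_norm intro!: lipschitz_onI)
  then show ?thesis
    by (intro borel_measurable_continuous_onI lipschitz_on_continuous_on)
qed

lemma control_measurable:
  "(\<lambda>(t, x). \<alpha> t x) \<in> borel_measurable (restrict_space borel {a..b} \<Otimes>\<^sub>M borel)"
proof -
  have "(\<lambda>z. z) \<in> restrict_space borel {a..b} \<Otimes>\<^sub>M borel \<rightarrow>\<^sub>M restrict_space (borel :: (real \<times> 'a) measure) ({a..b} \<times> UNIV)"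
  proof (rule measurable_restrict_space2)
    show "(\<lambda>z. z) \<in> restrict_space borel {a..b} \<Otimes>\<^sub>M borel \<rightarrow>\<^sub>M (borel :: (real \<times> 'a) measure)"
      unfolding borel_prod[symmetric]
    proof (rule measurable_pair)
      show "fst \<circ> (\<lambda>z. z) \<in> restrict_space borel {a..b} \<Otimes>\<^sub>M (borel :: 'a measure) \<rightarrow>\<^sub>M borel"
        using measurable_compose[OF measurable_fst measurable_restrict_space1[OF measurable_ident]]
        by (simp add: comp_def id_def)
    qed (simp add: comp_def)
  qed (auto simp: space_pair_measure space_restrict_space)
  from measurable_compose[OF this] show ?thesis
    using L1 by (auto simp: L1_Lip_def measurable_control_def)
qed

lemma average_measurable:
  fixes g :: "real \<Rightarrow> 'a \<Rightarrow> real"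
  assumes "(\<lambda>(t, x). g t x) \<in> borel_measurable (restrict_space borel {a..b} \<Otimes>\<^sub>M borel)"
  shows "(\<lambda>t. \<integral>x. g t x \<partial>m t) \<in> borel_measurable (lebesgue_on {a..b})"
  by (intro borel_measurable_lebesgue_on_of_borel integral_measurable_subprob_algebra2[OF assms]
      measurable_prob_algebraD narrowly_continuous_kernel narrow) auto

lemma average_bound:
  fixes g :: "'a \<Rightarrow> real"
  assumes t: "t \<in> {a..b}" and "\<And>x. \<bar>g x\<bar> \<le> C"
  shows "\<bar>\<integral>x. g x \<partial>m t\<bar> \<le> C"
proof -
  interpret prob_space "m t" using P2_D(1)[OF P2[OF t]] .
  show ?thesis
  proof (cases "integrable (m t) g")
    case True
    then have "\<bar>\<integral>x. g x \<partial>m t\<bar> \<le> (\<integral>x. C \<partial>m t)"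
      by (rule integral_abs_bound_integral) (use assms in auto)
    then show ?thesis by (simp add: prob_space)
  next
    \<comment> \<open>A non-integrable function has integral 0, and the bound itself forces
      \<open>C \<ge> 0\<close>.\<close>
    case False
    then show ?thesis
      using order_trans[OF abs_ge_zero assms(2)] by (simp add: not_integrable_integral_eq)
  qed
qed

text \<open>Testing the equation with \<open>\<eta> t * \<psi> x\<close> shows that the average of
  \<open>\<psi>\<close> has as weak time derivative the average of the derivative of
  \<open>\<psi>\<close> along the control. Being continuous by narrow continuity, the average of
  \<open>\<psi>\<close> is then an integral function.\<close>

lemma average_test_function:
  fixes \<psi> :: "'a \<Rightarrow> real"
  assumes smooth: "\<And>k. C_k k \<psi>" and supp: "{x. \<psi> x \<noteq> 0} \<subseteq> cball 0 R"
  shows "integrable (lebesgue_on {a..b}) (\<lambda>r. \<integral>x. frechet_derivative \<psi> (at x) (\<alpha> r x) \<partial>m r)"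
    and "t \<in> {a..b} \<Longrightarrow> (\<integral>x. \<psi> x \<partial>m t) = (\<integral>x. \<psi> x \<partial>m a) +
      integral\<^sup>L (lebesgue_on {a..t}) (\<lambda>r. \<integral>x. frechet_derivative \<psi> (at x) (\<alpha> r x) \<partial>m r)"
proof -
  let ?D = "\<lambda>x. frechet_derivative \<psi> (at x)"
  define f where "f r = (\<integral>x. ?D x (\<alpha> r x) \<partial>m r)" for r
  note D = smooth_compact_support_derivative[OF smooth supp]
  obtain C where C: "C \<ge> 0" "\<And>x v. \<bar>?D x v\<bar> \<le> C * norm v" using D(5) by blast
  have [measurable]: "(\<lambda>x. ?D x v) \<in> borel_measurable borel" for v
    using D(2) by (rule borel_measurable_continuous_onI)
  have [measurable]: "\<psi> \<in> borel_measurable borel"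
    using smooth[of 0] by (intro borel_measurable_continuous_onI) simp
  \<comment> \<open>The derivative of \<open>\<psi>\<close> vanishes outside the ball of radius
    \<open>R\<close>, so the linear growth of the control enters only through the factor
    \<open>1 + \<bar>R\<bar>\<close>.\<close>
  have bound: "\<bar>?D x (\<alpha> r x)\<bar> \<le> C * (1 + \<bar>R\<bar>) * \<kappa> r" if "regular r" for r x
  proof (cases "norm x > R")
    case True
    then show ?thesis using D(4) that C by (simp add: regular_def)
  next
    case False
    have "norm (\<alpha> r x) \<le> \<kappa> r * (1 + norm x)" using that by (auto simp: regular_def)
    also have "\<dots> \<le> \<kappa> r * (1 + \<bar>R\<bar>)"
      using that False by (intro mult_left_mono) (auto simp: regular_def)
    finally have "C * norm (\<alpha> r x) \<le> C * (\<kappa> r * (1 + \<bar>R\<bar>))"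
      using C by (intro mult_left_mono)
    with C(2)[of x "\<alpha> r x"] show ?thesis by (simp add: mult_ac)
  qed
  have meas: "f \<in> borel_measurable (lebesgue_on {a..b})"
    unfolding f_def
  proof (rule average_measurable)
    have [measurable]: "(\<lambda>z. \<alpha> (fst z) (snd z)) \<in> borel_measurable (restrict_space borel {a..b} \<Otimes>\<^sub>M borel)"
      using control_measurable by (simp add: case_prod_unfold)
    have "(\<lambda>z. \<Sum>i\<in>Basis. (\<alpha> (fst z) (snd z) \<bullet> i) * ?D (snd z) i)
        \<in> borel_measurable (restrict_space borel {a..b} \<Otimes>\<^sub>M borel)"
      by measurable
    then show "(\<lambda>(t, x). ?D x (\<alpha> t x)) \<in> borel_measurable (restrict_space borel {a..b} \<Otimes>\<^sub>M borel)"
      unfolding case_prod_unfold D(3)[symmetric] .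
  qed
  show f_int: "integrable (lebesgue_on {a..b}) (\<lambda>r. \<integral>x. ?D x (\<alpha> r x) \<partial>m r)"
    unfolding f_def[symmetric]
  proof (rule Bochner_Integration.integrable_bound[OF _ meas])
    show "integrable (lebesgue_on {a..b}) (\<lambda>r. C * (1 + \<bar>R\<bar>) * \<kappa> r)"
      using integrable_\<kappa> by simp
    show "AE r in lebesgue_on {a..b}. norm (f r) \<le> norm (C * (1 + \<bar>R\<bar>) * \<kappa> r)"
      using AE_regular
    proof eventually_elim
      case (elim r)
      then have "\<bar>f r\<bar> \<le> C * (1 + \<bar>R\<bar>) * \<kappa> r"
        unfolding f_def by (intro average_bound bound) (auto simp: regular_def)
      then show ?case by simp
    qed
  qed
  have psi_bounded: "bounded (range \<psi>)"
  proof -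
    have "compact (\<psi> ` cball 0 R)"
      using smooth[of 0] by (intro compact_continuous_image) (auto intro: continuous_on_subset)
    then have "bounded (insert 0 (\<psi> ` cball 0 R))" by (simp add: compact_imp_bounded)
    then show ?thesis
      by (rule bounded_subset) (use supp in force)
  qed
  then obtain B where B: "\<And>x. \<bar>\<psi> x\<bar> \<le> B" by (auto simp: bounded_iff)
  define F where "F t = (\<integral>x. \<psi> x \<partial>m t)" for t
  have F: "continuous_on {a..b} F"
    using narrow psi_bounded smooth[of 0] by (auto simp: narrowly_continuous_P2_def F_def)
  have weak: "integral\<^sup>L (lebesgue_on {a..b}) (\<lambda>r. \<eta>' r * F r + \<eta> r * f r) = 0"
    if \<eta>: "\<forall>k. C_k k \<eta>" "\<forall>x. (\<eta> has_real_derivative \<eta>' x) (at x)" "a < l" "u < b"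
      "\<forall>x. x \<notin> {l..u} \<longrightarrow> \<eta> x = 0" for \<eta> \<eta>' l u
  proof -
    let ?\<phi> = "\<lambda>z. \<eta> (fst z) * \<psi> (snd z)"
    have "?\<phi> \<in> test_functions ({a<..<b} \<times> UNIV)"
      by (rule product_test_function[of _ _ _ l u _ R]) (use \<eta> smooth supp in auto)
    then have "integral\<^sup>L (lebesgue_on {a..b})
        (\<lambda>t. \<integral>x. frechet_derivative ?\<phi> (at (t, x)) (1, \<alpha> t x) \<partial>m t) = 0"
      using CE by (auto simp: continuity_equation_def)
    moreover have der: "frechet_derivative ?\<phi> (at (t, x)) (1, v) = \<eta>' t * \<psi> x + \<eta> t * ?D x v" for t x v
    proof -
      have 1: "((\<lambda>z. \<eta> (fst z)) has_derivative (\<lambda>w. \<eta>' t * fst w)) (at (t, x))"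
        using \<eta>(2) by (intro has_derivative_compose[where g = \<eta> and f = fst, simplified])
          (auto simp: has_field_derivative_def intro: has_derivative_fst)
      have 2: "((\<lambda>z. \<psi> (snd z)) has_derivative (\<lambda>w. ?D x (snd w))) (at (t, x))"
        using D(1)[of x] by (intro has_derivative_compose[where g = \<psi> and f = snd, simplified])
          (auto intro: has_derivative_snd)
      have "(?\<phi> has_derivative (\<lambda>w. \<eta> t * ?D x (snd w) + \<eta>' t * fst w * \<psi> x)) (at (t, x))"
        using has_derivative_mult[OF 1 2] by simp
      from fun_cong[OF frechet_derivative_at[OF this], of "(1, v)"] show ?thesis
        by simp
    qed
    moreover have "integral\<^sup>L (lebesgue_on {a..b})
        (\<lambda>t. \<integral>x. \<eta>' t * \<psi> x + \<eta> t * ?D x (\<alpha> t x) \<partial>m t)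
      = integral\<^sup>L (lebesgue_on {a..b}) (\<lambda>r. \<eta>' r * F r + \<eta> r * f r)"
    proof (rule Bochner_Integration.integral_cong_AE)
      have \<eta>'_meas[measurable]: "\<eta>' \<in> borel_measurable borel" 
      proof -
        \<comment> \<open>\<open>\<eta>'\<close> is known only as the derivative of
          \<open>\<eta>\<close>; writing it as a directional derivative of a smooth function yields
          its continuity, hence measurability.\<close>
        have "\<eta>' = (\<lambda>x. frechet_derivative \<eta> (at x) 1)"
        proof
          fix x
          have "(\<eta> has_derivative (*) (\<eta>' x)) (at x)"
            using \<eta>(2) by (simp add: has_field_derivative_def)
          from frechet_derivative_at[OF this] show "\<eta>' x = frechet_derivative \<eta> (at x) 1"
            by (metis mult.right_neutral)
        qed
        moreover have "continuous_on UNIV (\<lambda>x. frechet_derivative \<eta> (at x) 1)"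
          using \<eta>(1)[rule_format, of 1] by simp
        ultimately show ?thesis by (simp add: borel_measurable_continuous_onI)
      qed
      have \<eta>_meas[measurable]: "\<eta> \<in> borel_measurable borel"
        using \<eta>(1)[rule_format, of 0] by (simp add: borel_measurable_continuous_onI)
      have leb: "g \<in> borel_measurable (lebesgue_on {a..b})" if "g \<in> borel_measurable borel" for g :: "real \<Rightarrow> real"
        using that by (intro borel_measurable_lebesgue_on_of_borel measurable_restrict_space1) auto
      have "F \<in> borel_measurable (lebesgue_on {a..b})"
        by (intro continuous_imp_measurable_on_sets_lebesgue F) auto
      with leb[OF \<eta>'_meas] leb[OF \<eta>_meas] meas
      show meas2: "(\<lambda>r. \<eta>' r * F r + \<eta> r * f r) \<in> borel_measurable (lebesgue_on {a..b})"
        by measurable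
      have [measurable]: "(\<lambda>z. \<alpha> (fst z) (snd z)) \<in> borel_measurable (restrict_space borel {a..b} \<Otimes>\<^sub>M borel)"
        using control_measurable by (simp add: case_prod_unfold)
      have [measurable]: "g \<in> borel_measurable (restrict_space borel {a..b})" if "g \<in> borel_measurable borel" for g :: "real \<Rightarrow> real"
        using that by (rule measurable_restrict_space1)
      show "(\<lambda>t. \<integral>x. \<eta>' t * \<psi> x + \<eta> t * ?D x (\<alpha> t x) \<partial>m t) \<in> borel_measurable (lebesgue_on {a..b})"
      proof (rule average_measurable)
        have "(\<lambda>z. \<eta>' (fst z) * \<psi> (snd z) + \<eta> (fst z) * (\<Sum>i\<in>Basis. (\<alpha> (fst z) (snd z) \<bullet> i) * ?D (snd z) i))
            \<in> borel_measurable (restrict_space borel {a..b} \<Otimes>\<^sub>M borel)"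
          by measurable
        then show "(\<lambda>(t, x). \<eta>' t * \<psi> x + \<eta> t * ?D x (\<alpha> t x)) \<in> borel_measurable (restrict_space borel {a..b} \<Otimes>\<^sub>M borel)"
          unfolding case_prod_unfold D(3)[symmetric] .
      qed
      show "AE t in lebesgue_on {a..b}. (\<integral>x. \<eta>' t * \<psi> x + \<eta> t * ?D x (\<alpha> t x) \<partial>m t) = \<eta>' t * F t + \<eta> t * f t"
        using AE_regular
      proof eventually_elim
        case (elim r)
        then have r: "m r \<in> P2" by (intro P2) (auto simp: regular_def)
        have [measurable]: "\<alpha> r \<in> borel_measurable borel" by (rule regular_measurable[OF elim])
        have "(\<lambda>x. \<Sum>i\<in>Basis. (\<alpha> r x \<bullet> i) * ?D x i) \<in> borel_measurable borel" by measurable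
        then have "(\<lambda>x. ?D x (\<alpha> r x)) \<in> borel_measurable borel"
          by (subst (asm) D(3)[symmetric])
        then have "integrable (m r) (\<lambda>x. ?D x (\<alpha> r x))"
          by (rule P2_integrable[OF r, where A = "C * (1 + \<bar>R\<bar>) * \<kappa> r" and B = 0])
            (use bound[OF elim] in auto)
        moreover have "integrable (m r) \<psi>"
          by (rule P2_integrable[OF r, where A = B and B = 0]) (use B in auto)
        ultimately show ?case by (simp add: F_def f_def)
      qed
    qed
    ultimately show ?thesis by simp
  qed
  show "(\<integral>x. \<psi> x \<partial>m t) = (\<integral>x. \<psi> x \<partial>m a) +
      integral\<^sup>L (lebesgue_on {a..t}) (\<lambda>r. \<integral>x. ?D x (\<alpha> r x) \<partial>m r)" if "t \<in> {a..b}"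
    using weak_derivative_imp_integral[OF ab F f_int[folded f_def] _ that] weak
    unfolding F_def f_def by blast
qed

end

section \<open>Moments along a Lipschitz flow\<close>

text \<open>Packages the properties delivered by \<open>smooth_truncation\<close>, so that a profile
  \<open>h\<close> with slope \<open>h'\<close> can be a hypothesis of the moment lemmas.\<close>

definition truncation :: "(real \<Rightarrow> real) \<Rightarrow> (real \<Rightarrow> real) \<Rightarrow> bool" where
  "truncation h h' \<longleftrightarrow> (\<forall>k. C_k k h) \<and> (\<forall>x. (h has_real_derivative h' x) (at x)) \<and>
     continuous_on UNIV h' \<and> (\<forall>x. 0 \<le> h' x \<and> h' x \<le> 1) \<and> (\<forall>x\<le>1. h x = x \<and> h' x = 1) \<and>
     (\<forall>x\<ge>2. h x = h 2 \<and> h' x = 0) \<and> (\<forall>x\<ge>0. 0 \<le> h x \<and> h x \<le> x \<and> x * h' x \<le> 2 * h x)"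

lemma truncation_exists: "\<exists>h h'. truncation h h'"
  by (rule smooth_truncation) (unfold truncation_def, blast)

lemma truncationD:
  assumes "truncation h h'"
  shows "C_k k h" "(h has_real_derivative h' x) (at x)" "continuous_on UNIV h'" "0 \<le> h' x" "h' x \<le> 1"
    "x \<le> 1 \<Longrightarrow> h x = x" "x \<le> 1 \<Longrightarrow> h' x = 1" "x \<ge> 2 \<Longrightarrow> h x = h 2" "x \<ge> 2 \<Longrightarrow> h' x = 0"
    "0 \<le> x \<Longrightarrow> 0 \<le> h x" "0 \<le> x \<Longrightarrow> h x \<le> x" "0 \<le> x \<Longrightarrow> x * h' x \<le> 2 * h x"
  using assms unfolding truncation_def by blast+

lemma truncation_measurable:
  assumes "truncation h h'"
  shows "h \<in> borel_measurable borel" "h' \<in> borel_measurable borel"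
  using truncationD(1)[OF assms, of 0] truncationD(3)[OF assms]
  by (auto intro: borel_measurable_continuous_onI)

section \<open>Truncated second moments and removal of the truncation\<close>

context lipschitz_flow
begin

text \<open>The integrand in the derivative of the second moment grows at most quadratically and is
  therefore integrable against measures in \<open>P2\<close>. The 4 combines the 2 on the left with
  \<open>(1 + norm x)\<^sup>2 \<le> 2 * (1 + (norm x)\<^sup>2)\<close>.\<close>

lemma regular_inner_bound:
  assumes "regular r"
  shows "\<bar>2 * ((x - z) \<bullet> \<alpha> r x)\<bar> \<le> 4 * (1 + norm z) * \<kappa> r * (1 + (norm x)\<^sup>2)"
proof -
  have "\<bar>(x - z) \<bullet> \<alpha> r x\<bar> \<le> norm (x - z) * norm (\<alpha> r x)"
    by (rule Cauchy_Schwarz_ineq2)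
  also have "\<dots> \<le> (norm x + norm z) * (\<kappa> r * (1 + norm x))"
    using assms by (intro mult_mono norm_triangle_ineq4) (auto simp: regular_def)
  also have "\<dots> \<le> ((1 + norm z) * (1 + norm x)) * (\<kappa> r * (1 + norm x))"
    using assms by (intro mult_right_mono) (auto simp: regular_def algebra_simps)
  also have "\<dots> = (1 + norm z) * \<kappa> r * (1 + norm x)\<^sup>2"
    by (simp add: power2_eq_square)
  also have "\<dots> \<le> (1 + norm z) * \<kappa> r * (2 * (1 + (norm x)\<^sup>2))"
  proof (rule mult_left_mono)
    have "0 \<le> (1 - norm x)\<^sup>2" by simp
    then show "(1 + norm x)\<^sup>2 \<le> 2 * (1 + (norm x)\<^sup>2)"
      unfolding power2_sum power2_diff by simp
  qed (use assms in \<open>auto simp: regular_def\<close>)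
  finally show ?thesis by (simp add: abs_mult algebra_simps)
qed

text \<open>The integrand of \<open>E\<close> is \<open>(norm (x - z))\<^sup>2\<close> within
  distance \<open>R\<close> of \<open>z\<close> and takes the constant value
  \<open>R\<^sup>2 * h 2\<close> where that square is at least \<open>2 * R\<^sup>2\<close>.
  Subtracting the constant gives a compactly supported test function, and the constant cancels
  because every \<open>m t\<close> has mass 1.\<close>

lemma truncated_moment:
  fixes z :: 'a
  assumes trunc: "truncation h h'" and R: "R > 0"
  defines "E \<equiv> \<lambda>t. \<integral>x. R\<^sup>2 * h ((norm (x - z))\<^sup>2 / R\<^sup>2) \<partial>m t"
    and "f \<equiv> \<lambda>r. \<integral>x. 2 * h' ((norm (x - z))\<^sup>2 / R\<^sup>2) * ((x - z) \<bullet> \<alpha> r x) \<partial>m r"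
  shows "continuous_on {a..b} E" "integrable (lebesgue_on {a..b}) f"
    and "t \<in> {a..b} \<Longrightarrow> E t = E a + integral\<^sup>L (lebesgue_on {a..t}) f"
proof -
  let ?s = "\<lambda>x. (norm (x - z))\<^sup>2 / R\<^sup>2"
  let ?\<psi> = "\<lambda>x. R\<^sup>2 * h (?s x)"
  define \<theta> where "\<theta> x = ?\<psi> x - R\<^sup>2 * h 2" for x
  have h_smooth: "C_k k h" for k by (rule truncationD(1)[OF trunc])
  have h_der: "(h has_real_derivative h' x) (at x)" for x by (rule truncationD(2)[OF trunc])
  have s_smooth: "C_k k ?s" for k
    using C_k_mult[OF C_k_norm_power2 C_k_const] by (simp add: divide_inverse)
  have \<psi>_smooth: "C_k k ?\<psi>" for k
    by (rule C_k_mult[OF C_k_const C_k_compose[OF h_smooth s_smooth]])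
  have \<theta>_smooth: "C_k k \<theta>" for k
    unfolding \<theta>_def by (rule C_k_diff[OF \<psi>_smooth C_k_const])
  have supp: "{x. \<theta> x \<noteq> 0} \<subseteq> cball 0 (norm z + 2 * R)"
  proof
    fix x assume "x \<in> {x. \<theta> x \<noteq> 0}"
    then have "h (?s x) \<noteq> h 2" by (auto simp: \<theta>_def)
    moreover have "h y = h 2" if "y \<ge> 2" for y
      using trunc that unfolding truncation_def by blast
    ultimately have "?s x < 2" by (meson not_le)
    then have "(norm (x - z))\<^sup>2 < 2 * R\<^sup>2"
      using R by (simp add: pos_divide_less_eq)
    then have "(norm (x - z))\<^sup>2 \<le> (2 * R)\<^sup>2"
    proof -
      have "(2 * R)\<^sup>2 = 4 * R\<^sup>2" by simp
      with \<open>(norm (x - z))\<^sup>2 < 2 * R\<^sup>2\<close> zero_le_power2[of R] show ?thesis by linarith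
    qed
    then have "norm (x - z) \<le> 2 * R"
      by (rule power2_le_imp_le) (use R in simp)
    then show "x \<in> cball 0 (norm z + 2 * R)"
      using norm_triangle_sub[of x z] by simp
  qed
  have der: "frechet_derivative \<theta> (at x) v = 2 * h' (?s x) * ((x - z) \<bullet> v)" for x v
  proof -
    have "(?s has_derivative (\<lambda>v. 2 * ((x - z) \<bullet> v) / R\<^sup>2)) (at x)"
    proof -
      have "((\<lambda>x. (norm (x - z))\<^sup>2) has_derivative (\<lambda>v. 2 * ((x - z) \<bullet> v))) (at x)"
        unfolding power2_norm_eq_inner by (auto intro!: derivative_eq_intros simp: inner_commute)
      from has_derivative_mult_left[OF this, of "inverse (R\<^sup>2)"] show ?thesis
        by (simp add: divide_inverse)
    qed
    from has_derivative_compose[OF this, of h "(*) (h' (?s x))"] h_der[of "?s x"]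
    have "((\<lambda>x. h (?s x)) has_derivative (\<lambda>v. h' (?s x) * (2 * ((x - z) \<bullet> v) / R\<^sup>2))) (at x)"
      by (simp add: has_field_derivative_def)
    then have "(\<theta> has_derivative (\<lambda>v. R\<^sup>2 * (h' (?s x) * (2 * ((x - z) \<bullet> v) / R\<^sup>2)))) (at x)"
      unfolding \<theta>_def by (auto intro!: derivative_eq_intros)
    from fun_cong[OF frechet_derivative_at[OF this], of v] show ?thesis using R by simp
  qed
  note avg = average_test_function[OF \<theta>_smooth supp, unfolded der]
  have bound: "\<bar>?\<psi> x\<bar> \<le> 3 * R\<^sup>2" for x
  proof -
    have s0: "0 \<le> ?s x" by simp
    have "h (?s x) \<le> 3" 
    proof (cases "?s x \<le> 2")
      case True
      moreover have "h (?s x) \<le> ?s x" using trunc s0 unfolding truncation_def by blast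
      ultimately show ?thesis by linarith
    next
      case False
      then have "?s x \<ge> 2" by linarith
      then have "h (?s x) = h 2" using trunc unfolding truncation_def by blast
      moreover have "h 2 \<le> 2" using truncationD(11)[OF trunc, of 2] by simp
      ultimately show ?thesis by simp
    qed
    moreover have "0 \<le> h (?s x)" using trunc s0 unfolding truncation_def by blast
    moreover from calculation have "R\<^sup>2 * h (?s x) \<le> R\<^sup>2 * 3" by (intro mult_left_mono) auto
    ultimately show ?thesis by (simp add: abs_mult)
  qed
  have cont: "continuous_on UNIV ?\<psi>" using \<psi>_smooth[of 0] by simp
  have "bounded (range ?\<psi>)"
    unfolding bounded_iff by (intro exI[of _ "3 * R\<^sup>2"] ballI, elim rangeE) (simp only: real_norm_def bound)
  then show "continuous_on {a..b} E"
    using narrow cont by (auto simp: narrowly_continuous_P2_def E_def)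
  show "integrable (lebesgue_on {a..b}) f"
    using avg(1) by (simp add: f_def)
  have "(\<integral>x. \<theta> x \<partial>(m t)) = E t - R\<^sup>2 * h 2" if t: "t \<in> {a..b}" for t
  proof -
    interpret prob_space "m t" using P2_D(1)[OF P2[OF t]] .
    have "integrable (m t) ?\<psi>"
      by (rule P2_integrable[OF P2[OF t] borel_measurable_continuous_onI[OF cont], where A = "3 * R\<^sup>2" and B = 0])
        (use bound in simp)
    then show ?thesis by (simp add: \<theta>_def E_def prob_space)
  qed
  from this[of t] this[of a] show "E t = E a + integral\<^sup>L (lebesgue_on {a..t}) f" if "t \<in> {a..b}"
    using avg(2)[OF that] that ab by (simp add: f_def)
qed

text \<open>The square itself dominates because \<open>0 \<le> h s \<le> s\<close>, and at each
  \<open>x\<close> the sequence is eventually constant because \<open>h s = s\<close> for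
  \<open>s \<le> 1\<close>. The radii \<open>Suc n\<close> are positive from the start.\<close>

lemma truncated_moment_tendsto:
  fixes z :: 'a
  assumes trunc: "truncation h h'" and t: "t \<in> {a..b}"
  shows "(\<lambda>n. \<integral>x. (real (Suc n))\<^sup>2 * h ((norm (x - z))\<^sup>2 / (real (Suc n))\<^sup>2) \<partial>m t)
    \<longlonglongrightarrow> (\<integral>x. (norm (x - z))\<^sup>2 \<partial>m t)"
proof (rule integral_dominated_convergence[where w = "\<lambda>x. (norm (x - z))\<^sup>2"])
  have [measurable_cong]: "sets (m t) = sets borel" using P2_D(2)[OF P2[OF t]] .
  note truncation_measurable(1)[OF trunc, measurable]
  show "(\<lambda>x. (norm (x - z))\<^sup>2) \<in> borel_measurable (m t)"
    "(\<lambda>x. (real (Suc n))\<^sup>2 * h ((norm (x - z))\<^sup>2 / (real (Suc n))\<^sup>2)) \<in> borel_measurable (m t)" for n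
    by measurable
  show "integrable (m t) (\<lambda>x. (norm (x - z))\<^sup>2)"
  proof (rule P2_integrable[OF P2[OF t], where A = "2 * (norm z)\<^sup>2" and B = 2])
    fix x
    have "(norm (x - z))\<^sup>2 \<le> (norm x + norm z)\<^sup>2"
      by (intro power_mono norm_triangle_ineq4) auto
    also have "\<dots> \<le> 2 * (norm z)\<^sup>2 + 2 * (norm x)\<^sup>2"
      using zero_le_power2[of "norm x - norm z"] unfolding power2_sum power2_diff by simp
    finally show "norm ((norm (x - z))\<^sup>2) \<le> 2 * (norm z)\<^sup>2 + 2 * (norm x)\<^sup>2" by simp
  qed simp
  show "AE x in m t. (\<lambda>n. (real (Suc n))\<^sup>2 * h ((norm (x - z))\<^sup>2 / (real (Suc n))\<^sup>2)) \<longlonglongrightarrow> (norm (x - z))\<^sup>2"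
  proof (intro AE_I2 tendsto_eventually)
    fix x
    obtain n0 :: nat where n0: "norm (x - z) < real n0" using reals_Archimedean2 by blast
    show "\<forall>\<^sub>F n in sequentially. (real (Suc n))\<^sup>2 * h ((norm (x - z))\<^sup>2 / (real (Suc n))\<^sup>2) = (norm (x - z))\<^sup>2"
    proof (rule eventually_sequentiallyI)
      fix n assume "n0 \<le> n"
      with n0 have "norm (x - z) \<le> real (Suc n)" by linarith
      then have "(norm (x - z))\<^sup>2 / (real (Suc n))\<^sup>2 \<le> 1"
        using power_mono[of "norm (x - z)" "real (Suc n)" 2] by (simp add: field_simps del: of_nat_Suc)
      then have "h ((norm (x - z))\<^sup>2 / (real (Suc n))\<^sup>2) = (norm (x - z))\<^sup>2 / (real (Suc n))\<^sup>2"
        using trunc unfolding truncation_def by blast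
      then show "(real (Suc n))\<^sup>2 * h ((norm (x - z))\<^sup>2 / (real (Suc n))\<^sup>2) = (norm (x - z))\<^sup>2"
        by (simp del: of_nat_Suc)
    qed
  qed
  show "AE x in m t. norm ((real (Suc n))\<^sup>2 * h ((norm (x - z))\<^sup>2 / (real (Suc n))\<^sup>2)) \<le> (norm (x - z))\<^sup>2" for n
  proof (intro AE_I2)
    fix x
    let ?s = "(norm (x - z))\<^sup>2 / (real (Suc n))\<^sup>2"
    have "0 \<le> ?s" by simp
    then have "0 \<le> h ?s" "h ?s \<le> ?s" using trunc unfolding truncation_def by blast+
    then have "\<bar>h ?s\<bar> \<le> ?s" by simp
    then have "(real (Suc n))\<^sup>2 * \<bar>h ?s\<bar> \<le> (real (Suc n))\<^sup>2 * ?s" by (intro mult_left_mono) auto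
    then show "norm ((real (Suc n))\<^sup>2 * h ?s) \<le> (norm (x - z))\<^sup>2"
      by (simp add: abs_mult del: of_nat_Suc)
  qed
qed

text \<open>Each \<open>m t\<close> has a finite second moment, but narrow continuity alone gives no
  uniform bound. Gronwall for the truncated moments gives one independent of the radius; it supplies
  the dominating function in \<open>second_moment_derivative\<close>.\<close>

lemma second_moment_bounded:
  obtains C where "0 \<le> C" "\<And>t. t \<in> {a..b} \<Longrightarrow> (\<integral>x. (norm x)\<^sup>2 \<partial>m t) \<le> C"
proof -
  obtain h h' where trunc: "truncation h h'" using truncation_exists by blast
  define C where "C = (2 + 8 * (\<integral>x. (norm x)\<^sup>2 \<partial>m a)) * exp (8 * integral\<^sup>L (lebesgue_on {a..b}) \<kappa>)"
  have C0: "C \<ge> 0" by (simp add: C_def)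
  define E where "E n t = (\<integral>x. (real (Suc n))\<^sup>2 * h ((norm (x - 0))\<^sup>2 / (real (Suc n))\<^sup>2) \<partial>m t)" for n t
  define f where "f n r = (\<integral>x. 2 * h' ((norm (x - 0))\<^sup>2 / (real (Suc n))\<^sup>2) * ((x - 0) \<bullet> \<alpha> r x) \<partial>m r)" for n r
  have h: "0 \<le> h s" "h s \<le> s" "s * h' s \<le> 2 * h s" if "0 \<le> s" for s
    using trunc that unfolding truncation_def by blast+
  have h': "0 \<le> h' s" "h' s \<le> 1" for s
    using trunc unfolding truncation_def by blast+
  note truncation_measurable[OF trunc, measurable]
  have E_bound: "E n t \<le> C" if t: "t \<in> {a..b}" for n t
  proof -
    note tm = truncated_moment[where R = "real (Suc n)" and z = 0, OF trunc, folded E_def f_def]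
    have E_nonneg: "E n r \<ge> 0" for r
      unfolding E_def by (intro Bochner_Integration.integral_nonneg) (simp add: h)
    \<comment> \<open>The inner product of \<open>x\<close> and the control is at most
      \<open>\<kappa> r * (1 + 2 * (norm x)\<^sup>2)\<close>. After multiplication by
      \<open>2 * h'\<close>, the bound \<open>h' \<le> 1\<close> gives the 2, and
      \<open>s * h' s \<le> 2 * h s\<close> turns \<open>4 * h' * (norm x)\<^sup>2\<close> into 8
      times the truncated square.\<close>
    have f_le: "f n r \<le> \<kappa> r * (2 + 8 * E n r)" if reg: "regular r" for r
    proof -
      let ?s = "\<lambda>x::'a. (norm (x - 0))\<^sup>2 / (real (Suc n))\<^sup>2"
      have r: "m r \<in> P2" using reg P2 by (simp add: regular_def)
      interpret prob_space "m r" using P2_D(1)[OF r] .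
      have [measurable]: "\<alpha> r \<in> borel_measurable borel" using regular_measurable[OF reg] .
      have int1: "integrable (m r) (\<lambda>x. 2 * h' (?s x) * ((x - 0) \<bullet> \<alpha> r x))"
      proof (rule P2_integrable[OF r, where A = "4 * \<kappa> r" and B = "4 * \<kappa> r"])
        fix x
        have "norm (2 * h' (?s x) * ((x - 0) \<bullet> \<alpha> r x)) = h' (?s x) * \<bar>2 * ((x - 0) \<bullet> \<alpha> r x)\<bar>"
          using h'(1) by (simp add: abs_mult)
        also have "\<dots> \<le> 1 * \<bar>2 * ((x - 0) \<bullet> \<alpha> r x)\<bar>"
          using h' by (intro mult_right_mono) auto
        also have "\<dots> \<le> 4 * \<kappa> r + 4 * \<kappa> r * (norm x)\<^sup>2"
          using regular_inner_bound[OF reg, of x 0] by (simp add: algebra_simps)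
        finally show "norm (2 * h' (?s x) * ((x - 0) \<bullet> \<alpha> r x)) \<le> 4 * \<kappa> r + 4 * \<kappa> r * (norm x)\<^sup>2" .
      qed measurable
      have int2: "integrable (m r) (\<lambda>x. (real (Suc n))\<^sup>2 * h (?s x))"
      proof (rule P2_integrable[OF r, where A = 0 and B = 1])
        fix x
        have "(real (Suc n))\<^sup>2 * h (?s x) \<le> (real (Suc n))\<^sup>2 * ?s x"
          by (intro mult_left_mono h) auto
        then show "norm ((real (Suc n))\<^sup>2 * h (?s x)) \<le> 0 + 1 * (norm x)\<^sup>2"
          using h(1)[of "?s x"] by (simp add: abs_mult del: of_nat_Suc)
      qed measurable
      have "f n r \<le> (\<integral>x. \<kappa> r * (2 + 8 * ((real (Suc n))\<^sup>2 * h (?s x))) \<partial>m r)"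
        unfolding f_def
      proof (rule integral_mono[OF int1])
        fix x :: 'a
        have k: "0 \<le> \<kappa> r" using reg by (simp add: regular_def)
        have sn: "(real (Suc n))\<^sup>2 * ?s x = (norm x)\<^sup>2" by (simp del: of_nat_Suc)
        have hs: "h' (?s x) * (norm x)\<^sup>2 \<le> 2 * ((real (Suc n))\<^sup>2 * h (?s x))"
        proof -
          have "(real (Suc n))\<^sup>2 * (?s x * h' (?s x)) \<le> (real (Suc n))\<^sup>2 * (2 * h (?s x))"
            by (intro mult_left_mono h) auto
          moreover have "h' (?s x) * (norm x)\<^sup>2 = (real (Suc n))\<^sup>2 * (?s x * h' (?s x))"
            by (simp only: sn[symmetric] mult_ac)
          ultimately show ?thesis by (simp only: mult_ac)
        qed
        have "(x - 0) \<bullet> \<alpha> r x \<le> norm x * norm (\<alpha> r x)"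
          using norm_cauchy_schwarz[of x "\<alpha> r x"] by simp
        also have "\<dots> \<le> norm x * (\<kappa> r * (1 + norm x))"
          using reg by (intro mult_left_mono) (auto simp: regular_def)
        also have "\<dots> = \<kappa> r * (norm x + (norm x)\<^sup>2)"
          by (simp add: power2_eq_square algebra_simps)
        also have "\<dots> \<le> \<kappa> r * (1 + 2 * (norm x)\<^sup>2)"
          using norm_le_1_plus_square[of x] by (intro mult_left_mono k) simp
        finally have "2 * h' (?s x) * ((x - 0) \<bullet> \<alpha> r x) \<le> 2 * h' (?s x) * (\<kappa> r * (1 + 2 * (norm x)\<^sup>2))"
          using h' by (intro mult_left_mono) auto
        also have "\<dots> = \<kappa> r * (2 * h' (?s x) + 4 * (h' (?s x) * (norm x)\<^sup>2))"
          by (simp add: algebra_simps)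
        also have "\<dots> \<le> \<kappa> r * (2 + 8 * ((real (Suc n))\<^sup>2 * h (?s x)))"
          using h'(2)[of "?s x"] hs by (intro mult_left_mono k) linarith
        finally show "2 * h' (?s x) * ((x - 0) \<bullet> \<alpha> r x) \<le> \<kappa> r * (2 + 8 * ((real (Suc n))\<^sup>2 * h (?s x)))" .
      qed (use int2 in simp)
      also have "\<dots> = \<kappa> r * (2 + 8 * E n r)"
        using int2 by (simp add: E_def prob_space del: of_nat_Suc)
      finally show ?thesis .
    qed
    have cont: "continuous_on {a..b} (\<lambda>r. 2 + 8 * E n r)"
      by (intro continuous_intros tm(1)) auto
    have ku: "integrable (lebesgue_on {a..b}) (\<lambda>r. 8 * \<kappa> r * (2 + 8 * E n r))"
      using integrable_mult_right[OF integrable_continuous_mult[OF integrable_\<kappa> cont], of 8]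
      by (simp add: mult_ac del: integrable_mult_right_iff)
    \<comment> \<open>The unknown \<open>2 + 8 * E n\<close> is chosen because its derivative
      \<open>8 * f n\<close> is at most \<open>8 * \<kappa>\<close> times itself.\<close>
    have "2 + 8 * E n t \<le> (2 + 8 * E n a) * exp (integral\<^sup>L (lebesgue_on {a..t}) (\<lambda>r. 8 * \<kappa> r))"
    proof (rule gronwall_integral[OF _ _ ku _ _ _ t])
      show "integrable (lebesgue_on {a..b}) (\<lambda>r. 8 * \<kappa> r)" using integrable_\<kappa> by simp
      show "AE r in lebesgue_on {a..b}. 0 \<le> 8 * \<kappa> r"
        using AE_regular by eventually_elim (simp add: regular_def)
      show "0 \<le> 2 + 8 * E n r" for r using E_nonneg[of r] by simp
      show "0 < 2 + 8 * E n a" using E_nonneg[of a] by simp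
      show "2 + 8 * E n r \<le> 2 + 8 * E n a + integral\<^sup>L (lebesgue_on {a..r}) (\<lambda>r. 8 * \<kappa> r * (2 + 8 * E n r))"
        if r: "r \<in> {a..b}" for r
      proof -
        have sub: "{a..r} \<subseteq> {a..b}" using r by auto
        have "integral\<^sup>L (lebesgue_on {a..r}) (f n) \<le> integral\<^sup>L (lebesgue_on {a..r}) (\<lambda>r. \<kappa> r * (2 + 8 * E n r))"
        proof (rule integral_mono_AE)
          show "integrable (lebesgue_on {a..r}) (f n)"
            using integrable_subinterval[OF tm(2) sub] by simp
          have "integrable (lebesgue_on {a..b}) (\<lambda>r. \<kappa> r * (2 + 8 * E n r))"
            using integrable_continuous_mult[OF integrable_\<kappa> cont] by (simp add: mult_ac)
          from integrable_subinterval[OF this sub]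
          show "integrable (lebesgue_on {a..r}) (\<lambda>r. \<kappa> r * (2 + 8 * E n r))" .
          show "AE r in lebesgue_on {a..r}. f n r \<le> \<kappa> r * (2 + 8 * E n r)"
            using AE_regular_sub[OF r] by eventually_elim (rule f_le)
        qed
        then have "8 * integral\<^sup>L (lebesgue_on {a..r}) (f n)
            \<le> integral\<^sup>L (lebesgue_on {a..r}) (\<lambda>r. 8 * \<kappa> r * (2 + 8 * E n r))"
          by (simp add: mult.assoc)
        then show ?thesis using tm(3)[OF _ r] by simp
      qed
    qed
    also have "\<dots> \<le> C"
      unfolding C_def
    proof (intro mult_mono)
      have "E n a \<le> (\<integral>x. (norm x)\<^sup>2 \<partial>m a)"
        unfolding E_def
      proof (rule integral_mono')
        show "integrable (m a) (\<lambda>x. (norm x)\<^sup>2)" using P2_D(3)[OF P2] ab by simp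
        fix x :: 'a
        have "(real (Suc n))\<^sup>2 * h ((norm (x - 0))\<^sup>2 / (real (Suc n))\<^sup>2)
            \<le> (real (Suc n))\<^sup>2 * ((norm (x - 0))\<^sup>2 / (real (Suc n))\<^sup>2)"
          by (intro mult_left_mono h) auto
        then show "(real (Suc n))\<^sup>2 * h ((norm (x - 0))\<^sup>2 / (real (Suc n))\<^sup>2) \<le> (norm x)\<^sup>2"
          by (simp del: of_nat_Suc)
      qed simp
      then show "2 + 8 * E n a \<le> 2 + 8 * (\<integral>x. (norm x)\<^sup>2 \<partial>m a)" by simp
      have "integral\<^sup>L (lebesgue_on {a..b}) \<kappa> = integral\<^sup>L (lebesgue_on {a..t}) \<kappa> + integral\<^sup>L (lebesgue_on {t..b}) \<kappa>"
        using t by (intro Equivalence_Measurable_On_Borel.integral_combine integrable_\<kappa>) auto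
      moreover have "0 \<le> integral\<^sup>L (lebesgue_on {t..b}) \<kappa>"
      proof (rule integral_nonneg_AE)
        show "AE r in lebesgue_on {t..b}. 0 \<le> \<kappa> r"
          using AE_regular t by (auto simp: AE_restrict_space_iff regular_def elim: eventually_mono)
      qed
      ultimately show "exp (integral\<^sup>L (lebesgue_on {a..t}) (\<lambda>r. 8 * \<kappa> r)) \<le> exp (8 * integral\<^sup>L (lebesgue_on {a..b}) \<kappa>)"
        by simp
    qed auto
    finally show ?thesis using E_nonneg[of t] by simp
  qed
  show ?thesis
  proof (rule that[OF C0])
    fix t assume t: "t \<in> {a..b}"
    have "E n t \<le> C" for n using E_bound[OF t] .
    with truncated_moment_tendsto[OF trunc t, of 0] show "(\<integral>x. (norm x)\<^sup>2 \<partial>m t) \<le> C"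
      unfolding E_def by (intro LIMSEQ_le_const2) auto
  qed
qed

section \<open>Mean and variance of a solution\<close>

definition drift :: "'a \<Rightarrow> real \<Rightarrow> real" where
  "drift z r = (\<integral>x. 2 * ((x - z) \<bullet> \<alpha> r x) \<partial>m r)"

definition mean :: "real \<Rightarrow> 'a" where
  "mean t = (\<integral>x. x \<partial>m t)"

definition spread :: "real \<Rightarrow> real" where
  "spread t = (\<integral>x. (norm (x - mean t))\<^sup>2 \<partial>m t)"

text \<open>The truncation radius tends to infinity in \<open>truncated_moment\<close>. At a fixed
  regular time the limit is dominated by a multiple of \<open>1 + (norm x)\<^sup>2\<close>; in the
  time integral it is dominated by \<open>K * \<kappa> r\<close>, where \<open>K\<close> is finite
  thanks to the uniform moment bound.\<close>

lemma second_moment_derivative: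
  fixes z :: 'a
  shows "integrable (lebesgue_on {a..b}) (drift z)"
    and "t \<in> {a..b} \<Longrightarrow> (\<integral>x. (norm (x - z))\<^sup>2 \<partial>m t) =
      (\<integral>x. (norm (x - z))\<^sup>2 \<partial>m a) + integral\<^sup>L (lebesgue_on {a..t}) (drift z)"
proof -
  obtain h h' where trunc: "truncation h h'" using truncation_exists by blast
  obtain C where C: "0 \<le> C" "\<And>t. t \<in> {a..b} \<Longrightarrow> (\<integral>x. (norm x)\<^sup>2 \<partial>m t) \<le> C"
    by (rule second_moment_bounded) blast
  note truncation_measurable[OF trunc, measurable]
  note h' = truncationD(4,5)[OF trunc]
  let ?s = "\<lambda>n x. (norm (x - z))\<^sup>2 / (real (Suc n))\<^sup>2"
  define E where "E n t = (\<integral>x. (real (Suc n))\<^sup>2 * h (?s n x) \<partial>m t)" for n t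
  define f where "f n r = (\<integral>x. 2 * h' (?s n x) * ((x - z) \<bullet> \<alpha> r x) \<partial>m r)" for n r
  note tm = truncated_moment[where R = "real (Suc n)" and z = z for n, OF trunc, folded E_def f_def]
  define K where "K = 4 * (1 + norm z) * (1 + C)"
  have integrable_inner: "integrable (m r) (\<lambda>x. 4 * (1 + norm z) * \<kappa> r * (1 + (norm x)\<^sup>2))"
    and integral_inner: "(\<integral>x. 4 * (1 + norm z) * \<kappa> r * (1 + (norm x)\<^sup>2) \<partial>m r) \<le> K * \<kappa> r"
    if reg: "regular r" for r
  proof -
    have r: "r \<in> {a..b}" "m r \<in> P2" using reg P2 by (auto simp: regular_def)
    interpret prob_space "m r" using P2_D(1)[OF r(2)] .
    have int: "integrable (m r) (\<lambda>x. 1 + (norm x)\<^sup>2)" using P2_D(3)[OF r(2)] by simp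
    then show "integrable (m r) (\<lambda>x. 4 * (1 + norm z) * \<kappa> r * (1 + (norm x)\<^sup>2))" by simp
    have "(\<integral>x. 4 * (1 + norm z) * \<kappa> r * (1 + (norm x)\<^sup>2) \<partial>m r)
        = 4 * (1 + norm z) * \<kappa> r * (\<integral>x. 1 + (norm x)\<^sup>2 \<partial>m r)" by simp
    also have "(\<integral>x. 1 + (norm x)\<^sup>2 \<partial>m r) = 1 + (\<integral>x. (norm x)\<^sup>2 \<partial>m r)"
      using P2_D(3)[OF r(2)] by (simp add: prob_space)
    also have "4 * (1 + norm z) * \<kappa> r * (1 + (\<integral>x. (norm x)\<^sup>2 \<partial>m r)) \<le> 4 * (1 + norm z) * \<kappa> r * (1 + C)"
      using C(2)[OF r(1)] reg by (intro mult_left_mono) (auto simp: regular_def)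
    finally show "(\<integral>x. 4 * (1 + norm z) * \<kappa> r * (1 + (norm x)\<^sup>2) \<partial>m r) \<le> K * \<kappa> r"
      by (simp add: K_def mult_ac)
  qed
  have bound: "\<bar>\<integral>x. g x \<partial>m r\<bar> \<le> K * \<kappa> r"
    if reg: "regular r" and g: "\<And>x. \<bar>g x\<bar> \<le> \<bar>2 * ((x - z) \<bullet> \<alpha> r x)\<bar>" for r g
  proof (cases "integrable (m r) g")
    case True
    have "\<bar>\<integral>x. g x \<partial>m r\<bar> \<le> (\<integral>x. 4 * (1 + norm z) * \<kappa> r * (1 + (norm x)\<^sup>2) \<partial>m r)"
      using True integrable_inner[OF reg]
      by (rule integral_abs_bound_integral) (rule order_trans[OF g regular_inner_bound[OF reg]])
    then show ?thesis using integral_inner[OF reg] by simp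
  next
    case False
    then show ?thesis
      using reg C by (simp add: not_integrable_integral_eq regular_def K_def)
  qed
  have h'_le: "\<bar>2 * h' s * y\<bar> \<le> \<bar>2 * y\<bar>" for s y
    using h'[of s] by (simp add: abs_mult mult_left_le_one_le)
  have f_bound: "\<bar>f n r\<bar> \<le> K * \<kappa> r" if "regular r" for n r
    unfolding f_def by (rule bound[OF that h'_le])
  have drift_bound: "\<bar>drift z r\<bar> \<le> K * \<kappa> r" if "regular r" for r
    unfolding drift_def by (rule bound[OF that order_refl])
  have [measurable]: "(\<lambda>w. \<alpha> (fst w) (snd w)) \<in> borel_measurable (restrict_space borel {a..b} \<Otimes>\<^sub>M borel)"
    using control_measurable by (simp add: case_prod_unfold)
  have drift_meas: "drift z \<in> borel_measurable (lebesgue_on {a..b})"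
    unfolding drift_def[abs_def]
  proof (rule average_measurable)
    have "(\<lambda>w. 2 * ((snd w - z) \<bullet> \<alpha> (fst w) (snd w))) \<in> borel_measurable (restrict_space borel {a..b} \<Otimes>\<^sub>M borel)"
      by measurable
    then show "(\<lambda>(r, x). 2 * ((x - z) \<bullet> \<alpha> r x)) \<in> borel_measurable (restrict_space borel {a..b} \<Otimes>\<^sub>M borel)"
      by (simp add: case_prod_unfold)
  qed
  show int_drift: "integrable (lebesgue_on {a..b}) (drift z)"
  proof (rule Bochner_Integration.integrable_bound[OF _ drift_meas])
    show "integrable (lebesgue_on {a..b}) (\<lambda>r. K * \<kappa> r)" using integrable_\<kappa> by simp
    show "AE r in lebesgue_on {a..b}. norm (drift z r) \<le> norm (K * \<kappa> r)"
      using AE_regular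
    proof eventually_elim
      case (elim r)
      then show ?case using drift_bound[OF elim] by simp
    qed
  qed
  have f_lim: "(\<lambda>n. f n r) \<longlonglongrightarrow> drift z r" if reg: "regular r" for r
    unfolding f_def drift_def
  proof (rule integral_dominated_convergence[OF _ _ integrable_inner[OF reg]])
    have [measurable]: "\<alpha> r \<in> borel_measurable borel" using regular_measurable[OF reg] .
    have [measurable_cong]: "sets (m r) = sets borel"
      using reg P2_D(2)[OF P2] by (auto simp: regular_def)
    show "(\<lambda>x. 2 * ((x - z) \<bullet> \<alpha> r x)) \<in> borel_measurable (m r)"
      "(\<lambda>x. 2 * h' (?s n x) * ((x - z) \<bullet> \<alpha> r x)) \<in> borel_measurable (m r)" for n
      by measurable
    show "AE x in m r. (\<lambda>n. 2 * h' (?s n x) * ((x - z) \<bullet> \<alpha> r x)) \<longlonglongrightarrow> 2 * ((x - z) \<bullet> \<alpha> r x)"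
    proof (intro AE_I2 tendsto_eventually)
      fix x
      obtain n0 :: nat where n0: "norm (x - z) < real n0" using reals_Archimedean2 by blast
      show "\<forall>\<^sub>F n in sequentially. 2 * h' (?s n x) * ((x - z) \<bullet> \<alpha> r x) = 2 * ((x - z) \<bullet> \<alpha> r x)"
      proof (rule eventually_sequentiallyI)
        fix n assume "n0 \<le> n"
        with n0 have "norm (x - z) \<le> real (Suc n)" by linarith
        then have "?s n x \<le> 1"
          using power_mono[of "norm (x - z)" "real (Suc n)" 2] by (simp add: field_simps del: of_nat_Suc)
        then show "2 * h' (?s n x) * ((x - z) \<bullet> \<alpha> r x) = 2 * ((x - z) \<bullet> \<alpha> r x)"
          using truncationD(7)[OF trunc] by simp
      qed
    qed
    show "AE x in m r. norm (2 * h' (?s n x) * ((x - z) \<bullet> \<alpha> r x)) \<le> 4 * (1 + norm z) * \<kappa> r * (1 + (norm x)\<^sup>2)" for n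
      unfolding real_norm_def
      by (intro AE_I2 order_trans[OF h'_le regular_inner_bound[OF reg]])
  qed
  show "(\<integral>x. (norm (x - z))\<^sup>2 \<partial>m t) =
      (\<integral>x. (norm (x - z))\<^sup>2 \<partial>m a) + integral\<^sup>L (lebesgue_on {a..t}) (drift z)" if t: "t \<in> {a..b}"
  proof (rule LIMSEQ_unique)
    have a: "a \<in> {a..b}" using ab by simp
    have sub: "{a..t} \<subseteq> {a..b}" using t by auto
    show "(\<lambda>n. E n t) \<longlonglongrightarrow> (\<integral>x. (norm (x - z))\<^sup>2 \<partial>m t)"
      unfolding E_def by (rule truncated_moment_tendsto[OF trunc t])
    have "(\<lambda>n. integral\<^sup>L (lebesgue_on {a..t}) (f n)) \<longlonglongrightarrow> integral\<^sup>L (lebesgue_on {a..t}) (drift z)"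
    proof (rule integral_dominated_convergence[where w = "\<lambda>r. K * \<kappa> r"])
      show "drift z \<in> borel_measurable (lebesgue_on {a..t})"
        using integrable_subinterval[OF int_drift sub] by simp
      show "f n \<in> borel_measurable (lebesgue_on {a..t})" for n
        using integrable_subinterval[OF tm(2) sub] by simp
      show "integrable (lebesgue_on {a..t}) (\<lambda>r. K * \<kappa> r)"
        using integrable_subinterval[OF integrable_\<kappa> sub] by simp
      show "AE r in lebesgue_on {a..t}. (\<lambda>n. f n r) \<longlonglongrightarrow> drift z r"
        using AE_regular_sub[OF t] by eventually_elim (rule f_lim)
      show "AE r in lebesgue_on {a..t}. norm (f n r) \<le> K * \<kappa> r" for n
        unfolding real_norm_def using AE_regular_sub[OF t] by eventually_elim (rule f_bound)
    qed
    then have "(\<lambda>n. E n a + integral\<^sup>L (lebesgue_on {a..t}) (f n)) \<longlonglongrightarrow>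
        (\<integral>x. (norm (x - z))\<^sup>2 \<partial>m a) + integral\<^sup>L (lebesgue_on {a..t}) (drift z)"
      unfolding E_def by (intro tendsto_add truncated_moment_tendsto[OF trunc a])
    then show "(\<lambda>n. E n t) \<longlonglongrightarrow> (\<integral>x. (norm (x - z))\<^sup>2 \<partial>m a) + integral\<^sup>L (lebesgue_on {a..t}) (drift z)"
      using tm(3)[OF _ t] by simp
  qed
qed

lemma integrable_norm_square:
  fixes z :: 'a
  assumes t: "t \<in> {a..b}"
  shows "integrable (m t) (\<lambda>x. (norm (x - z))\<^sup>2)"
proof (rule P2_integrable[OF P2[OF t], where A = "2 * (norm z)\<^sup>2" and B = 2])
  fix x
  have "(norm (x - z))\<^sup>2 \<le> (norm x + norm z)\<^sup>2"
    by (intro power_mono norm_triangle_ineq4) auto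
  also have "\<dots> \<le> 2 * (norm z)\<^sup>2 + 2 * (norm x)\<^sup>2"
    using zero_le_power2[of "norm x - norm z"] unfolding power2_sum power2_diff by simp
  finally show "norm ((norm (x - z))\<^sup>2) \<le> 2 * (norm z)\<^sup>2 + 2 * (norm x)\<^sup>2" by simp
qed simp

lemma integrable_id:
  assumes t: "t \<in> {a..b}"
  shows "integrable (m t) (\<lambda>x. x)"
  by (rule P2_integrable[OF P2[OF t], where A = 1 and B = 1]) (use norm_le_1_plus_square in auto)

lemma integrable_control:
  assumes "regular r"
  shows "integrable (m r) (\<alpha> r)"
proof (rule P2_integrable[where A = "2 * \<kappa> r" and B = "\<kappa> r"])
  show "m r \<in> P2" using assms P2 by (simp add: regular_def)
  show "\<alpha> r \<in> borel_measurable borel" by (rule regular_measurable[OF assms])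
  fix x
  have "norm (\<alpha> r x) \<le> \<kappa> r * (1 + norm x)" using assms by (auto simp: regular_def)
  also have "\<dots> \<le> \<kappa> r * (1 + (1 + (norm x)\<^sup>2))"
    using assms by (intro mult_left_mono add_left_mono norm_le_1_plus_square) (auto simp: regular_def)
  finally show "norm (\<alpha> r x) \<le> 2 * \<kappa> r + \<kappa> r * (norm x)\<^sup>2" by (simp add: algebra_simps)
qed

lemma integrable_inner_control:
  assumes reg: "regular r"
  shows "integrable (m r) (\<lambda>x. 2 * ((x - z) \<bullet> \<alpha> r x))"
proof (rule P2_integrable[where A = "4 * (1 + norm z) * \<kappa> r" and B = "4 * (1 + norm z) * \<kappa> r"])
  have [measurable]: "\<alpha> r \<in> borel_measurable borel" by (rule regular_measurable[OF reg])
  show "m r \<in> P2" using assms P2 by (simp add: regular_def)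
  show "(\<lambda>x. 2 * ((x - z) \<bullet> \<alpha> r x)) \<in> borel_measurable borel" by measurable
  show "norm (2 * ((x - z) \<bullet> \<alpha> r x)) \<le> 4 * (1 + norm z) * \<kappa> r + 4 * (1 + norm z) * \<kappa> r * (norm x)\<^sup>2" for x
    using regular_inner_bound[OF reg, of x z] by (simp add: algebra_simps)
qed

lemma drift_shift:
  assumes "regular r"
  shows "drift z r = drift 0 r - 2 * (z \<bullet> (\<integral>x. \<alpha> r x \<partial>m r))"
proof -
  have "drift 0 r - drift z r = (\<integral>x. 2 * ((x - 0) \<bullet> \<alpha> r x) - 2 * ((x - z) \<bullet> \<alpha> r x) \<partial>m r)"
    unfolding drift_def
    by (rule Bochner_Integration.integral_diff[symmetric]; rule integrable_inner_control[OF assms])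
  also have "\<dots> = (\<integral>x. 2 * (z \<bullet> \<alpha> r x) \<partial>m r)"
    by (intro Bochner_Integration.integral_cong refl) (simp add: inner_diff_left)
  also have "\<dots> = 2 * (z \<bullet> (\<integral>x. \<alpha> r x \<partial>m r))"
    using integrable_control[OF assms] by simp
  finally show ?thesis by simp
qed

lemma second_moment_shift:
  assumes t: "t \<in> {a..b}"
  shows "(\<integral>x. (norm (x - z))\<^sup>2 \<partial>m t) = (\<integral>x. (norm (x - 0))\<^sup>2 \<partial>m t) - 2 * (z \<bullet> mean t) + (norm z)\<^sup>2"
proof -
  interpret prob_space "m t" using P2_D(1)[OF P2[OF t]] .
  have "(\<integral>x. (norm (x - z))\<^sup>2 \<partial>m t) = (\<integral>x. (norm (x - 0))\<^sup>2 - 2 * (z \<bullet> x) + (norm z)\<^sup>2 \<partial>m t)"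
    by (intro Bochner_Integration.integral_cong refl)
      (simp add: power2_norm_eq_inner inner_diff_left inner_diff_right inner_commute)
  also have "\<dots> = (\<integral>x. (norm (x - 0))\<^sup>2 \<partial>m t) - 2 * (z \<bullet> mean t) + (norm z)\<^sup>2"
    using integrable_norm_square[OF t, of 0] integrable_id[OF t]
    by (simp add: mean_def prob_space)
  finally show ?thesis .
qed

text \<open>Second moments about \<open>z\<close> and about 0 differ by an affine function of the
  mean, so the evolution of the mean is read off from theirs without truncating linear test
  functions. By \<open>drift_shift\<close> the integrand is, at regular times, the inner product of
  \<open>z\<close> with the mean velocity.\<close>

lemma mean_derivative:
  assumes t: "t \<in> {a..b}"
  shows "mean t \<bullet> z = mean a \<bullet> z + integral\<^sup>L (lebesgue_on {a..t}) (\<lambda>r. (drift 0 r - drift z r) / 2)"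
proof -
  have a: "a \<in> {a..b}" and sub: "{a..t} \<subseteq> {a..b}" using t by auto
  have "integrable (lebesgue_on {a..t}) (drift w)" for w
    by (rule integrable_subinterval[OF second_moment_derivative(1) sub])
  then show ?thesis
    using second_moment_derivative(2)[OF t, of z] second_moment_derivative(2)[OF t, of 0]
      second_moment_shift[OF t, of z] second_moment_shift[OF a, of z]
    by (simp add: inner_commute field_simps)
qed

lemma spread_eq:
  assumes "t \<in> {a..b}"
  shows "spread t = (\<integral>x. (norm (x - 0))\<^sup>2 \<partial>m t) - (\<Sum>i\<in>Basis. (mean t \<bullet> i)\<^sup>2)"
proof -
  have "mean t \<bullet> mean t = (\<Sum>i\<in>Basis. (mean t \<bullet> i)\<^sup>2)"
    by (subst euclidean_inner) (simp add: power2_eq_square)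
  then show ?thesis
    unfolding spread_def second_moment_shift[OF assms, of "mean t"]
    by (simp add: power2_norm_eq_inner)
qed

text \<open>Centering at the mean lets \<open>\<alpha> r x\<close> be replaced by \<open>\<alpha> r x - \<alpha> r (mean r)\<close>.\<close>

lemma drift_mean_le:
  assumes reg: "regular r"
  shows "drift (mean r) r \<le> 2 * \<kappa> r * spread r"
proof -
  have r: "r \<in> {a..b}" using reg by (simp add: regular_def)
  interpret prob_space "m r" using P2_D(1)[OF P2[OF r]] .
  let ?c = "mean r"
  have int_id: "integrable (m r) (\<lambda>x. x)" by (rule integrable_id[OF r])
  have int_c: "integrable (m r) (\<lambda>x. 2 * ((x - ?c) \<bullet> \<alpha> r ?c))"
    using int_id by simp
  have "(\<integral>x. 2 * ((x - ?c) \<bullet> \<alpha> r ?c) \<partial>m r) = 2 * ((\<integral>x. x - ?c \<partial>m r) \<bullet> \<alpha> r ?c)"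
    using int_id by simp
  also have "(\<integral>x. x - ?c \<partial>m r) = 0"
    using int_id by (simp add: mean_def prob_space)
  finally have "drift ?c r = (\<integral>x. 2 * ((x - ?c) \<bullet> \<alpha> r x) \<partial>m r) - (\<integral>x. 2 * ((x - ?c) \<bullet> \<alpha> r ?c) \<partial>m r)"
    by (simp add: drift_def)
  also have "\<dots> = (\<integral>x. 2 * ((x - ?c) \<bullet> \<alpha> r x) - 2 * ((x - ?c) \<bullet> \<alpha> r ?c) \<partial>m r)"
    by (rule Bochner_Integration.integral_diff[symmetric, OF integrable_inner_control[OF reg] int_c])
  also have "\<dots> \<le> (\<integral>x. 2 * \<kappa> r * (norm (x - ?c))\<^sup>2 \<partial>m r)"
  proof (rule integral_mono)
    show "integrable (m r) (\<lambda>x. 2 * ((x - ?c) \<bullet> \<alpha> r x) - 2 * ((x - ?c) \<bullet> \<alpha> r ?c))"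
      by (rule Bochner_Integration.integrable_diff[OF integrable_inner_control[OF reg] int_c])
    show "integrable (m r) (\<lambda>x. 2 * \<kappa> r * (norm (x - ?c))\<^sup>2)"
      using integrable_norm_square[OF r] by simp
    fix x
    have "(x - ?c) \<bullet> (\<alpha> r x - \<alpha> r ?c) \<le> norm (x - ?c) * norm (\<alpha> r x - \<alpha> r ?c)"
      by (rule norm_cauchy_schwarz)
    also have "\<dots> \<le> norm (x - ?c) * (\<kappa> r * norm (x - ?c))"
      using reg by (intro mult_left_mono) (auto simp: regular_def)
    finally show "2 * ((x - ?c) \<bullet> \<alpha> r x) - 2 * ((x - ?c) \<bullet> \<alpha> r ?c) \<le> 2 * \<kappa> r * (norm (x - ?c))\<^sup>2"
      by (simp add: inner_diff_right power2_eq_square mult_ac)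
  qed
  also have "\<dots> = 2 * \<kappa> r * spread r"
    by (simp add: spread_def)
  finally show ?thesis .
qed

text \<open>Combines \<open>spread_eq\<close> with the chain rule for the squared components of the
  mean. The motion of the centre adds no term, because the second moment about \<open>z\<close> is
  stationary in \<open>z\<close> at the mean; only the drift about the current mean remains.\<close>

lemma spread_derivative:
  shows "integrable (lebesgue_on {a..b}) (\<lambda>r. drift (mean r) r)"
    and "t \<in> {a..b} \<Longrightarrow> spread t = spread a + integral\<^sup>L (lebesgue_on {a..t}) (\<lambda>r. drift (mean r) r)"
proof -
  define q where "q i r = (drift 0 r - drift i r) / 2" for i r
  have q_int: "integrable (lebesgue_on {a..b}) (q i)" for i
    unfolding q_def using second_moment_derivative(1) by simp
  have mean_q: "mean t \<bullet> i = mean a \<bullet> i + integral\<^sup>L (lebesgue_on {a..t}) (q i)" if "t \<in> {a..b}" for t i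
    unfolding q_def by (rule mean_derivative[OF that])
  have mean_cont: "continuous_on {a..b} (\<lambda>t. mean t \<bullet> i)" for i
  proof -
    have "continuous_on {a..b} (\<lambda>t. mean a \<bullet> i + integral\<^sup>L (lebesgue_on {a..t}) (q i))"
      by (intro continuous_intros indefinite_integral_continuous_real q_int)
    then show ?thesis
      by (rule continuous_on_eq) (rule mean_q[symmetric])
  qed
  \<comment> \<open>The derivative obtained term by term from \<open>spread_eq\<close>. At regular
    times it is the drift about the mean, since \<open>q i r\<close> is then the component of the
    mean velocity along \<open>i\<close>.\<close>
  define g where "g r = drift 0 r - (\<Sum>i\<in>Basis. 2 * (mean r \<bullet> i) * q i r)" for r
  have mq_int: "integrable (lebesgue_on {a..b}) (\<lambda>r. 2 * (mean r \<bullet> i) * q i r)" for i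
    using integrable_mult_right[OF integrable_continuous_mult[OF q_int mean_cont], of 2]
    by (simp add: mult_ac del: integrable_mult_right_iff)
  have g_int: "integrable (lebesgue_on {a..b}) g"
    unfolding g_def
    by (intro Bochner_Integration.integrable_diff Bochner_Integration.integrable_sum mq_int second_moment_derivative(1))
  have g_eq: "drift (mean r) r = g r" if "regular r" for r
  proof -
    have "q i r = (\<integral>x. \<alpha> r x \<partial>m r) \<bullet> i" for i
      using drift_shift[OF that, of i] by (simp add: q_def inner_commute)
    then have "(\<Sum>i\<in>Basis. 2 * (mean r \<bullet> i) * q i r) = 2 * (mean r \<bullet> (\<integral>x. \<alpha> r x \<partial>m r))"
      by (subst (2) euclidean_inner) (simp add: sum_distrib_left mult_ac)
    then show ?thesis using drift_shift[OF that, of "mean r"] by (simp add: g_def)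
  qed
  have meas: "(\<lambda>r. drift (mean r) r) \<in> borel_measurable (lebesgue_on {a..b})"
  proof -
    have [measurable]: "(\<lambda>w. \<alpha> (fst w) (snd w)) \<in> borel_measurable (restrict_space borel {a..b} \<Otimes>\<^sub>M borel)"
      using control_measurable by (simp add: case_prod_unfold)
    have "continuous_on {a..b} mean"
      using mean_cont by (rule continuous_on_componentwise[THEN iffD2, rule_format])
    then have [measurable]: "mean \<in> borel_measurable (restrict_space borel {a..b})"
      by (rule borel_measurable_continuous_on_restrict)
    show ?thesis
      unfolding drift_def[abs_def]
    proof (rule average_measurable)
      have "(\<lambda>w. 2 * ((snd w - mean (fst w)) \<bullet> \<alpha> (fst w) (snd w))) \<in> borel_measurable (restrict_space borel {a..b} \<Otimes>\<^sub>M borel)"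
        by measurable
      then show "(\<lambda>(r, x). 2 * ((x - mean r) \<bullet> \<alpha> r x)) \<in> borel_measurable (restrict_space borel {a..b} \<Otimes>\<^sub>M borel)"
        by (simp add: case_prod_unfold)
    qed
  qed
  show int: "integrable (lebesgue_on {a..b}) (\<lambda>r. drift (mean r) r)"
    by (rule integrable_cong_AE_imp[OF g_int meas])
      (use AE_regular in eventually_elim, simp add: g_eq)
  assume t: "t \<in> {a..b}"
  then have a: "a \<in> {a..b}" and sub: "{a..t} \<subseteq> {a..b}" by auto
  have sq: "(mean t \<bullet> i)\<^sup>2 - (mean a \<bullet> i)\<^sup>2 = integral\<^sup>L (lebesgue_on {a..t}) (\<lambda>r. 2 * (mean r \<bullet> i) * q i r)" for i
  proof (rule integral_function_chain_rule[where \<phi> = "\<lambda>y. y\<^sup>2" and \<phi>' = "\<lambda>y. 2 * y"])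
    show "integrable (lebesgue_on {a..t}) (q i)" by (rule integrable_subinterval[OF q_int sub])
    show "continuous_on {a..t} (\<lambda>t. 2 * (mean t \<bullet> i))"
      by (intro continuous_intros continuous_on_subset[OF mean_cont sub])
    show "mean r \<bullet> i = mean a \<bullet> i + integral\<^sup>L (lebesgue_on {a..r}) (q i)" if "r \<in> {a..t}" for r
      using that sub by (intro mean_q) auto
    show "((\<lambda>y. y\<^sup>2) has_real_derivative 2 * (mean r \<bullet> i)) (at (mean r \<bullet> i))" for r
      by (auto intro!: derivative_eq_intros)
  qed (use t in auto)
  have "integral\<^sup>L (lebesgue_on {a..t}) (\<lambda>r. drift (mean r) r) = integral\<^sup>L (lebesgue_on {a..t}) g"
  proof (rule Bochner_Integration.integral_cong_AE)
    show "(\<lambda>r. drift (mean r) r) \<in> borel_measurable (lebesgue_on {a..t})" "g \<in> borel_measurable (lebesgue_on {a..t})"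
      using integrable_subinterval[OF int sub] integrable_subinterval[OF g_int sub] by auto
    show "AE r in lebesgue_on {a..t}. drift (mean r) r = g r"
      using AE_regular_sub[OF t] by eventually_elim (rule g_eq)
  qed
  also have "\<dots> = integral\<^sup>L (lebesgue_on {a..t}) (drift 0)
      - (\<Sum>i\<in>Basis. integral\<^sup>L (lebesgue_on {a..t}) (\<lambda>r. 2 * (mean r \<bullet> i) * q i r))"
    unfolding g_def
    by (subst Bochner_Integration.integral_diff)
      (intro integrable_subinterval[OF second_moment_derivative(1) sub] Bochner_Integration.integrable_sum
        integrable_subinterval[OF mq_int sub] Bochner_Integration.integral_sum arg_cong2[where f = minus] refl)+
  also have "\<dots> = integral\<^sup>L (lebesgue_on {a..t}) (drift 0) - (\<Sum>i\<in>Basis. (mean t \<bullet> i)\<^sup>2 - (mean a \<bullet> i)\<^sup>2)"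
    by (simp add: sq)
  finally show "spread t = spread a + integral\<^sup>L (lebesgue_on {a..t}) (\<lambda>r. drift (mean r) r)"
    using second_moment_derivative(2)[OF t, of 0] spread_eq[OF t] spread_eq[OF a]
    by (simp add: sum_subtractf)
qed

lemma spread_nonneg: "0 \<le> spread t"
  unfolding spread_def by (intro Bochner_Integration.integral_nonneg) simp

text \<open>The Gronwall lemma needs a positive constant, so it is applied with every
  \<open>e > 0\<close> in place of the initial value 0, and \<open>e\<close> tends to 0.\<close>

lemma spread_zero:
  assumes "spread a = 0" and t: "t \<in> {a..b}"
  shows "spread t = 0"
proof -
  have cont: "continuous_on {a..b} spread"
  proof -
    have "continuous_on {a..b} (\<lambda>t. spread a + integral\<^sup>L (lebesgue_on {a..t}) (\<lambda>r. drift (mean r) r))"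
      by (intro continuous_intros indefinite_integral_continuous_real spread_derivative(1))
    then show ?thesis
      by (rule continuous_on_eq) (rule spread_derivative(2)[symmetric])
  qed
  have kV: "integrable (lebesgue_on {a..b}) (\<lambda>r. 2 * \<kappa> r * spread r)"
    using integrable_mult_right[OF integrable_continuous_mult[OF integrable_\<kappa> cont], of 2]
    by (simp add: mult_ac del: integrable_mult_right_iff)
  have le: "spread t \<le> e * exp (integral\<^sup>L (lebesgue_on {a..t}) (\<lambda>r. 2 * \<kappa> r))" if "e > 0" for e
  proof (rule gronwall_integral[OF _ _ kV _ _ that t])
    show "integrable (lebesgue_on {a..b}) (\<lambda>r. 2 * \<kappa> r)" using integrable_\<kappa> by simp
    show "AE r in lebesgue_on {a..b}. 0 \<le> 2 * \<kappa> r"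
      using AE_regular by eventually_elim (simp add: regular_def)
    show "0 \<le> spread r" for r by (rule spread_nonneg)
    show "spread r \<le> e + integral\<^sup>L (lebesgue_on {a..r}) (\<lambda>r. 2 * \<kappa> r * spread r)" if r: "r \<in> {a..b}" for r
    proof -
      have sub: "{a..r} \<subseteq> {a..b}" using r by auto
      have "integral\<^sup>L (lebesgue_on {a..r}) (\<lambda>r. drift (mean r) r)
          \<le> integral\<^sup>L (lebesgue_on {a..r}) (\<lambda>r. 2 * \<kappa> r * spread r)"
      proof (rule integral_mono_AE)
        show "AE r in lebesgue_on {a..r}. drift (mean r) r \<le> 2 * \<kappa> r * spread r"
          using AE_regular_sub[OF r] by eventually_elim (rule drift_mean_le)
      qed (rule integrable_subinterval[OF spread_derivative(1) sub] integrable_subinterval[OF kV sub])+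
      then show ?thesis
        using spread_derivative(2)[OF r] assms(1) \<open>e > 0\<close> by simp
    qed
  qed
  define X where "X = exp (integral\<^sup>L (lebesgue_on {a..t}) (\<lambda>r. 2 * \<kappa> r))"
  have "X > 0" by (simp add: X_def)
  have le_X: "spread t \<le> e * X" if "e > 0" for e
    using le[OF that] unfolding X_def .
  have "spread t \<le> 0"
  proof (rule field_le_epsilon)
    fix e :: real assume "e > 0"
    then show "spread t \<le> 0 + e"
      using le_X[of "e / X"] \<open>X > 0\<close> by simp
  qed
  then show ?thesis using spread_nonneg[of t] by simp
qed

text \<open>Vanishing variance concentrates \<open>m t\<close> at its mean. This is all that the
  lower bound for feedback controls extracts from the Lipschitz condition.\<close>

lemma dirac_stays_dirac:
  assumes "m a = return borel c" and t: "t \<in> {a..b}"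
  shows "m t = return borel (mean t)"
proof -
  have "mean a = c"
    unfolding mean_def assms(1) by (subst integral_return) auto
  then have "spread a = 0"
    unfolding spread_def assms(1) by (subst integral_return) auto
  then have "spread t = 0" using spread_zero t by blast
  then have "AE x in m t. (norm (x - mean t))\<^sup>2 = 0"
    unfolding spread_def
    by (subst (asm) integral_nonneg_eq_0_iff_AE) (auto intro: integrable_norm_square[OF t])
  then have AE: "AE x in m t. x = mean t" by simp
  interpret prob_space "m t" using P2_D(1)[OF P2[OF t]] .
  have sets: "sets (m t) = sets borel" by (rule P2_D(2)[OF P2[OF t]])
  show ?thesis
  proof (rule measure_eqI)
    show "sets (m t) = sets (return borel (mean t))" using sets by simp
    fix A assume A: "A \<in> sets (m t)"
    have "emeasure (m t) A = emeasure (m t) (if mean t \<in> A then space (m t) else {})"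
      by (rule emeasure_eq_AE) (use AE A in \<open>auto elim!: eventually_mono\<close>)
    then show "emeasure (m t) A = emeasure (return borel (mean t)) A"
      using A sets by (auto simp: emeasure_space_1 indicator_def)
  qed
qed

end

section \<open>Wasserstein distances of push-forwards\<close>

lemma distr_P2:
  fixes f :: "'a::euclidean_space \<Rightarrow> 'a"
  assumes \<nu>: "\<nu> \<in> P2" and f: "f \<in> borel_measurable borel" and bound: "\<And>x. (norm (f x))\<^sup>2 \<le> A + B * (norm x)\<^sup>2"
  shows "distr \<nu> borel f \<in> P2"
proof -
  interpret prob_space \<nu> using P2_D(1)[OF \<nu>] .
  have [measurable_cong]: "sets \<nu> = sets borel" using P2_D(2)[OF \<nu>] .
  note f[measurable]
  have "integrable \<nu> (\<lambda>x. (norm (f x))\<^sup>2)"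
    by (rule P2_integrable[OF \<nu>, where A = A and B = B]) (use bound in auto)
  then have "(\<integral>\<^sup>+ x. ennreal ((norm (f x))\<^sup>2) \<partial>\<nu>) < \<infinity>"
    by (simp add: integrable_iff_bounded)
  then show ?thesis
    by (simp add: P2_def prob_space_distr nn_integral_distr)
qed

lemma borel_measurable_fst_snd [measurable]:
  "(fst :: 'a::euclidean_space \<times> 'a \<Rightarrow> 'a) \<in> borel_measurable borel"
  "(snd :: 'a::euclidean_space \<times> 'a \<Rightarrow> 'a) \<in> borel_measurable borel"
  unfolding borel_prod[symmetric] by measurable

text \<open>The joint law of \<open>f\<close> and \<open>g\<close> under \<open>\<nu>\<close> is a
  coupling of the two push-forwards. Integrability keeps its cost finite, as monotonicity of
  \<open>enn2real\<close> requires.\<close>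

lemma wasserstein_distr_le:
  fixes f g :: "'a::euclidean_space \<Rightarrow> 'a"
  assumes \<nu>: "sets \<nu> = sets borel" and fg: "f \<in> borel_measurable borel" "g \<in> borel_measurable borel"
    and int: "integrable \<nu> (\<lambda>x. dist (f x) (g x) ^ p)" and "p > 0"
  shows "wasserstein p (distr \<nu> borel f) (distr \<nu> borel g) \<le> root p (\<integral>x. dist (f x) (g x) ^ p \<partial>\<nu>)"
proof -
  have [measurable_cong]: "sets \<nu> = sets borel" by fact
  note fg[measurable]
  have [measurable]: "(\<lambda>x. (f x, g x)) \<in> \<nu> \<rightarrow>\<^sub>M borel"
    unfolding borel_prod[symmetric] by measurable
  let ?\<pi> = "distr \<nu> borel (\<lambda>x. (f x, g x))"
  have "?\<pi> \<in> couplings (distr \<nu> borel f) (distr \<nu> borel g)"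
    by (simp add: couplings_def distr_distr comp_def)
  then have "(INF \<pi>\<in>couplings (distr \<nu> borel f) (distr \<nu> borel g). \<integral>\<^sup>+ z. ennreal (dist (fst z) (snd z) ^ p) \<partial>\<pi>)
      \<le> (\<integral>\<^sup>+ z. ennreal (dist (fst z) (snd z) ^ p) \<partial>?\<pi>)"
    by (rule INF_lower)
  also have "\<dots> = (\<integral>\<^sup>+ x. ennreal (dist (f x) (g x) ^ p) \<partial>\<nu>)"
    by (subst nn_integral_distr) (auto intro!: measurable_compose[OF _ measurable_ennreal])
  also have "\<dots> = ennreal (\<integral>x. dist (f x) (g x) ^ p \<partial>\<nu>)"
    by (rule nn_integral_eq_integral[OF int]) simp
  finally have "enn2real (INF \<pi>\<in>couplings (distr \<nu> borel f) (distr \<nu> borel g). \<integral>\<^sup>+ z. ennreal (dist (fst z) (snd z) ^ p) \<partial>\<pi>)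
      \<le> enn2real (ennreal (\<integral>x. dist (f x) (g x) ^ p \<partial>\<nu>))"
    by (rule enn2real_mono) simp
  then show ?thesis
    using \<open>p > 0\<close> by (simp add: wasserstein_def)
qed

text \<open>In every coupling with a point mass the first coordinate is almost surely
  \<open>x\<close>, so all couplings have the same cost.\<close>

lemma wasserstein_return_ge:
  fixes \<nu> :: "'a::euclidean_space measure"
  assumes \<nu>: "\<nu> \<in> P2"
  shows "(\<integral>y. dist x y \<partial>\<nu>) \<le> wasserstein 1 (return borel x) \<nu>"
proof -
  interpret prob_space \<nu> using P2_D(1)[OF \<nu>] .
  have sets[measurable_cong]: "sets \<nu> = sets borel" using P2_D(2)[OF \<nu>] .
  have int: "integrable \<nu> (\<lambda>y. dist x y)" by (rule integrable_dist_P2[OF \<nu>])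
  let ?v = "ennreal (\<integral>y. dist x y \<partial>\<nu>)"
  have v: "?v = (\<integral>\<^sup>+ y. ennreal (dist x y) \<partial>\<nu>)"
    by (rule nn_integral_eq_integral[OF int, symmetric]) simp
  have cost: "(\<integral>\<^sup>+ z. ennreal (dist (fst z) (snd z) ^ 1) \<partial>\<pi>) = ?v" if \<pi>: "\<pi> \<in> couplings (return borel x) \<nu>" for \<pi>
  proof -
    have [measurable_cong]: "sets \<pi> = sets borel" and fst: "distr \<pi> borel fst = return borel x"
      and snd: "distr \<pi> borel snd = \<nu>"
      using \<pi> by (auto simp: couplings_def)
    have "AE y in distr \<pi> borel fst. y = x"
      unfolding fst by (simp add: AE_return)
    then have "AE z in \<pi>. fst z = x"
      by (subst (asm) AE_distr_iff) auto
    then have "(\<integral>\<^sup>+ z. ennreal (dist (fst z) (snd z) ^ 1) \<partial>\<pi>) = (\<integral>\<^sup>+ z. ennreal (dist x (snd z)) \<partial>\<pi>)"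
      by (intro nn_integral_cong_AE) auto
    also have "\<dots> = (\<integral>\<^sup>+ y. ennreal (dist x y) \<partial>distr \<pi> borel snd)"
      by (simp add: nn_integral_distr)
    finally show ?thesis by (simp add: snd v)
  qed
  \<comment> \<open>A coupling has to be exhibited: the infimum over an empty set is infinite, and
    \<open>enn2real\<close> would turn it into 0.\<close>
  have "distr \<nu> borel (\<lambda>y. (x, y)) \<in> couplings (return borel x) \<nu>"
  proof -
    have "distr \<nu> borel (\<lambda>y. x) = return borel x"
      by (rule measure_eqI) (auto simp: emeasure_distr emeasure_space_1 indicator_def vimage_def)
    moreover have "distr \<nu> borel (\<lambda>y. y) = \<nu>"
      by (rule distr_id2) (simp add: sets)
    moreover have [measurable]: "(\<lambda>y. (x, y)) \<in> \<nu> \<rightarrow>\<^sub>M borel"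
      unfolding borel_prod[symmetric] by measurable
    ultimately show ?thesis by (simp add: couplings_def distr_distr comp_def)
  qed
  then have "couplings (return borel x) \<nu> \<noteq> {}" by blast
  then have "(INF \<pi>\<in>couplings (return borel x) \<nu>. \<integral>\<^sup>+ z. ennreal (dist (fst z) (snd z) ^ 1) \<partial>\<pi>) = ?v"
    using cost by simp
  then show ?thesis by (simp add: wasserstein_def)
qed

section \<open>Dilations\<close>

locale dilation =
  fixes \<nu> :: "'a::euclidean_space measure" and c :: 'a and T \<theta> :: real
  assumes \<nu>: "\<nu> \<in> P2" and T: "0 < T" and \<theta>: "0 \<le> \<theta>" "\<theta> \<le> 1"
begin

definition flow :: "real \<Rightarrow> 'a \<Rightarrow> 'a" where
  "flow t y = c + (\<theta> / T * t) *\<^sub>R (y - c)"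

definition curve :: "real \<Rightarrow> 'a measure" where
  "curve t = distr \<nu> borel (flow t)"

text \<open>The velocity of \<open>flow\<close> expressed through the current position. The
  parameter \<open>\<theta>\<close> disappears because displacement and velocity are both
  proportional to it. At \<open>t = 0\<close> the convention \<open>1 / 0 = 0\<close> makes the
  field vanish.\<close>

definition control :: "real \<Rightarrow> 'a \<Rightarrow> 'a" where
  "control t x = (1 / t) *\<^sub>R (x - c)"

definition E2 :: real where "E2 = (\<integral>y. (norm (y - c))\<^sup>2 \<partial>\<nu>)"

sublocale \<nu>: prob_space \<nu> using P2_D(1)[OF \<nu>] .

lemma sets_\<nu> [measurable_cong]: "sets \<nu> = sets borel" using P2_D(2)[OF \<nu>] .

text \<open>An instance of \<open>(p + q)^2 \<le> 2 p^2 + 2 q^2\<close>, general enough to serve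
  both \<open>flow\<close> and \<open>y - c\<close>.\<close>

lemma square_bound: "(norm (u + s *\<^sub>R (y - w)))\<^sup>2 \<le> 2 * (norm (u - s *\<^sub>R w))\<^sup>2 + 2 * s\<^sup>2 * (norm (y :: 'a))\<^sup>2"
proof -
  have "norm (u + s *\<^sub>R (y - w)) = norm ((u - s *\<^sub>R w) + s *\<^sub>R y)"
    by (simp add: algebra_simps)
  also have "\<dots> \<le> norm (u - s *\<^sub>R w) + \<bar>s\<bar> * norm y"
    by (rule order_trans[OF norm_triangle_ineq]) simp
  finally have "(norm (u + s *\<^sub>R (y - w)))\<^sup>2 \<le> (norm (u - s *\<^sub>R w) + \<bar>s\<bar> * norm y)\<^sup>2"
    by (intro power_mono) auto
  also have "\<dots> \<le> 2 * (norm (u - s *\<^sub>R w))\<^sup>2 + 2 * s\<^sup>2 * (norm y)\<^sup>2"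
    using zero_le_power2[of "norm (u - s *\<^sub>R w) - \<bar>s\<bar> * norm y"]
    unfolding power2_sum power2_diff by (simp add: power_mult_distrib)
  finally show ?thesis .
qed

lemma integrable_square: "integrable \<nu> (\<lambda>y. (norm (y - c))\<^sup>2)"
proof (rule P2_integrable[OF \<nu>, where A = "2 * (norm c)\<^sup>2" and B = 2])
  show "norm ((norm (y - c))\<^sup>2) \<le> 2 * (norm c)\<^sup>2 + 2 * (norm y)\<^sup>2" for y
    using square_bound[of 0 1 y c] by simp
qed simp

lemma integrable_norm: "integrable \<nu> (\<lambda>y. norm (y - c))"
  using integrable_dist_P2[OF \<nu>, of c] by (simp add: dist_norm norm_minus_commute)

lemma E2_nonneg: "0 \<le> E2"
  unfolding E2_def by (intro Bochner_Integration.integral_nonneg) simp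

lemma flow_measurable [measurable]: "flow t \<in> borel_measurable borel"
  unfolding flow_def[abs_def] by measurable

text \<open>The factor \<open>1 / t\<close> cancels against the displacement, which is proportional
  to \<open>t\<close>. So the singularity is invisible to the energy, and only \<open>t = 0\<close>
  is exceptional.\<close>

lemma control_flow: "control t (flow t y) = (if t = 0 then 0 else (\<theta> / T) *\<^sub>R (y - c))"
  by (simp add: control_def flow_def)

lemma curve_P2: "curve t \<in> P2"
  unfolding curve_def by (rule distr_P2[OF \<nu> flow_measurable]) (unfold flow_def, rule square_bound)

lemma curve_0: "curve 0 = return borel c"
  unfolding curve_def flow_def
  by (rule measure_eqI) (auto simp: emeasure_distr \<nu>.emeasure_space_1 indicator_def vimage_def)

text \<open>Coupling \<open>flow s\<close> with \<open>flow t\<close> through the common starting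
  label \<open>y\<close> shows that the curve is Lipschitz in time, so a constant serves as the
  integrable density.\<close>

lemma curve_AC: "AC_P2 0 T curve"
  unfolding AC_P2_def
proof (intro conjI ballI exI[of _ "\<lambda>_. \<theta> / T * sqrt E2"] allI impI)
  show "curve t \<in> P2" for t by (rule curve_P2)
  show "set_integrable lebesgue {0..T} (\<lambda>_. \<theta> / T * sqrt E2)"
    by (intro absolutely_integrable_continuous_real continuous_intros)
  fix s t assume st: "0 \<le> s \<and> s \<le> t \<and> t \<le> T"
  have eq: "dist (flow s y) (flow t y) ^ 2 = (\<theta> / T * (t - s))\<^sup>2 * (norm (y - c))\<^sup>2" for y
  proof -
    have "flow s y - flow t y = (\<theta> / T * (s - t)) *\<^sub>R (y - c)"
      by (simp add: flow_def scaleR_left_diff_distrib[symmetric] right_diff_distrib)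
    then have "dist (flow s y) (flow t y) = \<bar>\<theta> / T * (s - t)\<bar> * norm (y - c)"
      by (simp only: dist_norm norm_scaleR)
    then have "dist (flow s y) (flow t y) ^ 2 = (\<theta> / T * (s - t))\<^sup>2 * (norm (y - c))\<^sup>2"
      by (simp only: power_mult_distrib power2_abs)
    moreover have "(\<theta> / T * (s - t))\<^sup>2 = (\<theta> / T * (t - s))\<^sup>2"
      by (simp only: power_mult_distrib power2_commute[of s t])
    ultimately show ?thesis by (simp only:)
  qed
  have "wasserstein 2 (curve s) (curve t) \<le> root 2 (\<integral>y. dist (flow s y) (flow t y) ^ 2 \<partial>\<nu>)"
    unfolding curve_def
    by (rule wasserstein_distr_le[OF sets_\<nu>]) (use integrable_square in \<open>auto simp: eq\<close>)
  also have "\<dots> = sqrt ((\<theta> / T * (t - s))\<^sup>2 * E2)"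
    unfolding eq by (simp add: sqrt_def E2_def)
  also have "\<dots> = \<theta> / T * (t - s) * sqrt E2"
    using st T \<theta> by (simp add: real_sqrt_mult)
  also have "\<dots> = (LINT r:{s..t}|lebesgue. \<theta> / T * sqrt E2)"
    using st by (simp add: set_integral_const)
  finally show "wasserstein 2 (curve s) (curve t) \<le> (LINT r:{s..t}|lebesgue. \<theta> / T * sqrt E2)" .
qed

lemma control_measurable [measurable]:
  "(\<lambda>z. control (fst z) (snd z)) \<in> borel_measurable (borel \<Otimes>\<^sub>M borel)"
  unfolding control_def by measurable

lemma control_measurable_control: "measurable_control 0 T control"
  unfolding measurable_control_def case_prod_unfold
  by (rule measurable_restrict_space1) (simp add: borel_prod[symmetric] control_measurable)

text \<open>Only an inequality, because the control vanishes at \<open>t = 0\<close>.\<close>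

lemma control_energy:
  "(\<integral>\<^sup>+ x. ennreal (norm (control t x) ^ 2) \<partial>curve t) \<le> ennreal ((\<theta> / T)\<^sup>2 * E2)"
proof -
  have [measurable]: "control t \<in> borel_measurable borel"
    unfolding control_def[abs_def] by measurable
  have "(\<integral>\<^sup>+ x. ennreal (norm (control t x) ^ 2) \<partial>curve t) = (\<integral>\<^sup>+ y. ennreal (norm (control t (flow t y)) ^ 2) \<partial>\<nu>)"
    unfolding curve_def by (simp add: nn_integral_distr)
  also have "\<dots> \<le> (\<integral>\<^sup>+ y. ennreal ((\<theta> / T)\<^sup>2 * (norm (y - c))\<^sup>2) \<partial>\<nu>)"
    by (intro nn_integral_mono ennreal_leI) (simp add: control_flow power_mult_distrib power_divide)
  also have "\<dots> = ennreal ((\<theta> / T)\<^sup>2 * E2)"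
    unfolding E2_def using integrable_square by (subst nn_integral_eq_integral) auto
  finally show ?thesis .
qed

lemma emeasure_lebesgue_on_Icc: "emeasure (lebesgue_on {0..T}) {0..T} = ennreal T"
  using T by (simp add: emeasure_restrict_space)

lemma control_L2: "L2_control 0 T curve control"
  unfolding L2_control_def
proof
  have "(\<integral>\<^sup>+ t. (\<integral>\<^sup>+ x. ennreal (norm (control t x) ^ 2) \<partial>curve t) \<partial>lebesgue_on {0..T})
      \<le> (\<integral>\<^sup>+ t. ennreal ((\<theta> / T)\<^sup>2 * E2) \<partial>lebesgue_on {0..T})"
    by (intro nn_integral_mono control_energy)
  also have "\<dots> < \<infinity>"
    using emeasure_lebesgue_on_Icc by (simp add: ennreal_mult_less_top)
  finally show "(\<integral>\<^sup>+ t. (\<integral>\<^sup>+ x. ennreal (norm (control t x) ^ 2) \<partial>curve t) \<partial>lebesgue_on {0..T}) < \<infinity>" .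
qed (rule control_measurable_control)

lemma kinetic_energy_le: "kinetic_energy 0 T control curve \<le> ennreal (\<theta>\<^sup>2 * E2 / (2 * T))"
proof -
  have inner: "(\<integral>\<^sup>+ x. ennreal (norm (control t x) ^ 2 / 2) \<partial>curve t) \<le> ennreal ((\<theta> / T)\<^sup>2 * E2 / 2)" for t
  proof -
    have [measurable]: "control t \<in> borel_measurable (curve t)"
      unfolding control_def[abs_def] curve_def by measurable
    have "(\<integral>\<^sup>+ x. ennreal (norm (control t x) ^ 2 / 2) \<partial>curve t)
        = (\<integral>\<^sup>+ x. ennreal (1/2) * ennreal (norm (control t x) ^ 2) \<partial>curve t)"
      by (intro nn_integral_cong, subst ennreal_mult'[symmetric]) auto
    also have "\<dots> = ennreal (1/2) * (\<integral>\<^sup>+ x. ennreal (norm (control t x) ^ 2) \<partial>curve t)"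
      by (intro nn_integral_cmult) measurable
    also have "\<dots> \<le> ennreal (1/2) * ennreal ((\<theta> / T)\<^sup>2 * E2)"
      by (intro mult_left_mono control_energy) auto
    also have "\<dots> = ennreal ((\<theta> / T)\<^sup>2 * E2 / 2)"
      by (subst ennreal_mult'[symmetric]) auto
    finally show ?thesis .
  qed
  have "kinetic_energy 0 T control curve \<le> (\<integral>\<^sup>+ t. ennreal ((\<theta> / T)\<^sup>2 * E2 / 2) \<partial>lebesgue_on {0..T})"
    unfolding kinetic_energy_def by (intro nn_integral_mono inner)
  also have "\<dots> = ennreal ((\<theta> / T)\<^sup>2 * E2 / 2) * ennreal T"
    using emeasure_lebesgue_on_Icc by simp
  also have "\<dots> = ennreal (\<theta>\<^sup>2 * E2 / (2 * T))"
  proof -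
    have "(\<theta> / T)\<^sup>2 * E2 / 2 * T = \<theta>\<^sup>2 * E2 / (2 * T)"
      using T by (simp add: power2_eq_square)
    with ennreal_mult''[OF less_imp_le[OF T], of "(\<theta> / T)\<^sup>2 * E2 / 2"] show ?thesis
      by (simp only:)
  qed
  finally show ?thesis .
qed

text \<open>The label \<open>y\<close> is coupled with its own endpoint \<open>flow T y\<close>,
  which has covered the fraction \<open>\<theta>\<close> of the segment from \<open>c\<close> to
  \<open>y\<close>.\<close>

lemma terminal_distance: "wasserstein 1 (curve T) \<nu> \<le> (1 - \<theta>) * (\<integral>y. dist c y \<partial>\<nu>)"
proof -
  have eq: "dist (flow T y) y ^ 1 = (1 - \<theta>) * dist c y" for y
  proof -
    have "flow T y - y = (1 - \<theta>) *\<^sub>R (c - y)"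
      using T by (simp add: flow_def algebra_simps)
    then show ?thesis using \<theta> by (simp add: dist_norm)
  qed
  have "integrable \<nu> (\<lambda>y. dist c y)" by (rule integrable_dist_P2[OF \<nu>])
  then have "wasserstein 1 (curve T) (distr \<nu> borel (\<lambda>y. y)) \<le> root 1 (\<integral>y. dist (flow T y) y ^ 1 \<partial>\<nu>)"
    unfolding curve_def by (intro wasserstein_distr_le[OF sets_\<nu>]) (auto simp only: eq intro: integrable_mult_right flow_measurable measurable_ident_sets)
  then show ?thesis
    unfolding eq by (simp add: distr_id2[OF sets_\<nu>[symmetric]])
qed

text \<open>Along trajectories the integrand is the time derivative of
  \<open>\<phi> (t, flow t y)\<close>. After exchanging the integrals, each trajectory contributes
  the difference of \<open>\<phi>\<close> at times \<open>T\<close> and 0, where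
  \<open>\<phi>\<close> vanishes because its support lies in the open time interval.\<close>

lemma curve_continuity_equation: "continuity_equation 0 T control curve"
  unfolding continuity_equation_def
proof
  fix \<phi> :: "real \<times> 'a \<Rightarrow> real"
  assume \<phi>: "\<phi> \<in> test_functions ({0<..<T} \<times> UNIV)"
  let ?D = "\<lambda>z. frechet_derivative \<phi> (at z)"
  have smooth: "C_k k \<phi>" for k using \<phi> by (simp add: test_functions_def)
  have closure: "closure {z. \<phi> z \<noteq> 0} \<subseteq> {0<..<T} \<times> UNIV" "compact (closure {z. \<phi> z \<noteq> 0})"
    using \<phi> by (auto simp: test_functions_def)
  obtain R where "\<forall>z\<in>closure {z. \<phi> z \<noteq> 0}. norm z \<le> R"
    using compact_imp_bounded[OF closure(2)] unfolding bounded_iff by blast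
  then have supp: "{z. \<phi> z \<noteq> 0} \<subseteq> cball 0 R"
    using closure_subset[of "{z. \<phi> z \<noteq> 0}"] by auto
  have boundary: "\<phi> (0, x) = 0" "\<phi> (T, x) = 0" for x
  proof -
    have "\<phi> z = 0" if "z \<notin> {0<..<T} \<times> UNIV" for z
      using that closure(1) closure_subset[of "{z. \<phi> z \<noteq> 0}"] by blast
    from this[of "(0, x)"] this[of "(T, x)"] show "\<phi> (0, x) = 0" "\<phi> (T, x) = 0" by simp_all
  qed
  note D = smooth_compact_support_derivative[OF smooth supp]
  obtain C where C: "C \<ge> 0" "\<And>z v. \<bar>?D z v\<bar> \<le> C * norm v" using D(5) by blast
  have D_meas: "(\<lambda>z. ?D z v) \<in> borel_measurable (borel \<Otimes>\<^sub>M borel)" for v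
    unfolding borel_prod using D(2) by (rule borel_measurable_continuous_onI)
  \<comment> \<open>The integrand along a trajectory with the constant velocity in place of the
    control. It has no exceptional behaviour at \<open>t = 0\<close>, so the fundamental theorem of
    calculus applies on the closed interval.\<close>
  define H where "H t y = ?D (t, flow t y) (1, (\<theta> / T) *\<^sub>R (y - c))" for t y
  have H_sum: "H t y = (\<Sum>i\<in>Basis. ((1, (\<theta> / T) *\<^sub>R (y - c)) \<bullet> i) * ?D (t, flow t y) i)" for t y
    unfolding H_def by (rule D(3))
  have flow2_meas: "(\<lambda>w. (fst w, flow (fst w) (snd w))) \<in> borel \<Otimes>\<^sub>M borel \<rightarrow>\<^sub>M borel \<Otimes>\<^sub>M borel"
    unfolding flow_def by measurable
  have [measurable]: "(\<lambda>w. H (fst w) (snd w)) \<in> borel_measurable (borel \<Otimes>\<^sub>M borel)"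
  proof -
    have [measurable]: "(\<lambda>w. ?D (fst w, flow (fst w) (snd w)) i) \<in> borel_measurable (borel \<Otimes>\<^sub>M borel)" for i
      by (rule measurable_compose[OF flow2_meas D_meas])
    have "(\<lambda>w::real \<times> 'a. (1::real, (\<theta> / T) *\<^sub>R (snd w - c))) \<in> borel \<Otimes>\<^sub>M borel \<rightarrow>\<^sub>M borel"
      unfolding borel_prod[symmetric] by measurable
    then have [measurable]: "(\<lambda>w::real \<times> 'a. (1::real, (\<theta> / T) *\<^sub>R (snd w - c)) \<bullet> i) \<in> borel_measurable (borel \<Otimes>\<^sub>M borel)" for i
      by (rule borel_measurable_inner) simp
    show ?thesis unfolding H_sum by measurable
  qed
  have H_bound: "\<bar>H t y\<bar> \<le> C * (1 + \<theta> / T * norm (y - c))" for t y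
  proof -
    have "norm (1::real, (\<theta> / T) *\<^sub>R (y - c)) \<le> 1 + \<theta> / T * norm (y - c)"
      using norm_Pair_le[of "1::real" "(\<theta> / T) *\<^sub>R (y - c)"] \<theta> T by simp
    then have "C * norm (1::real, (\<theta> / T) *\<^sub>R (y - c)) \<le> C * (1 + \<theta> / T * norm (y - c))"
      using C by (intro mult_left_mono)
    with C(2)[of "(t, flow t y)" "(1, (\<theta> / T) *\<^sub>R (y - c))"] show ?thesis
      by (simp add: H_def)
  qed
  have bound_int: "integrable \<nu> (\<lambda>y. C * (1 + \<theta> / T * norm (y - c)))"
    using integrable_norm by simp
  have H_int: "integrable \<nu> (H t)" for t
  proof (rule Bochner_Integration.integrable_bound[OF bound_int])
    have "(\<lambda>y. H (fst (t, y)) (snd (t, y))) \<in> borel_measurable borel"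
      by (rule measurable_compose[where N = "borel \<Otimes>\<^sub>M borel"]) measurable
    then show "H t \<in> borel_measurable \<nu>"
      using measurable_cong_sets[OF sets_\<nu> refl] by simp
    show "AE y in \<nu>. norm (H t y) \<le> norm (C * (1 + \<theta> / T * norm (y - c)))"
      using H_bound by (intro AE_I2) (metis abs_ge_self order_trans real_norm_def)
  qed
  have flow_der: "((\<lambda>t. flow t y) has_vector_derivative (\<theta> / T) *\<^sub>R (y - c)) (at t within S)" for t y S
    unfolding flow_def using T by (auto intro!: derivative_eq_intros)
  have FTC: "(\<integral>t. indicator {0..T} t *\<^sub>R H t y \<partial>lborel) = 0" for y
  proof -
    have "(\<integral>t. indicator {0..T} t *\<^sub>R H t y \<partial>lborel) = \<phi> (T, flow T y) - \<phi> (0, flow 0 y)"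
    proof (rule integral_FTC_Icc)
      show "0 \<le> T" using T by simp
      have cont_flow: "continuous_on {0..T} (\<lambda>t. (t, flow t y))"
        unfolding flow_def by (intro continuous_intros)
      show "continuous_on {0..T} (\<lambda>t. H t y)"
        unfolding H_sum
        by (intro continuous_intros continuous_on_compose2[OF D(2) cont_flow]) auto
      fix t :: real
      have "((\<lambda>t. (t, flow t y)) has_derivative (\<lambda>s. (s, s *\<^sub>R (\<theta> / T) *\<^sub>R (y - c)))) (at t within {0..T})"
        using flow_der[of y t "{0..T}"] unfolding has_vector_derivative_def
        by (intro has_derivative_Pair has_derivative_ident)
      from has_derivative_compose[OF this D(1)]
      have "((\<lambda>t. \<phi> (t, flow t y)) has_derivative (\<lambda>s. ?D (t, flow t y) (s, s *\<^sub>R (\<theta> / T) *\<^sub>R (y - c)))) (at t within {0..T})" .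
      moreover have "?D (t, flow t y) (s, s *\<^sub>R (\<theta> / T) *\<^sub>R (y - c)) = s *\<^sub>R H t y" for s
      proof -
        have "linear (?D (t, flow t y))" using D(1) has_derivative_linear by blast
        from linear_cmul[OF this, of s "(1, (\<theta> / T) *\<^sub>R (y - c))"] show ?thesis
          by (simp add: H_def)
      qed
      ultimately show "((\<lambda>t. \<phi> (t, flow t y)) has_vector_derivative H t y) (at t within {0..T})"
        by (simp add: has_vector_derivative_def)
    qed
    then show ?thesis by (simp add: boundary)
  qed
  have inner: "(\<integral>x. ?D (t, x) (1, control t x) \<partial>curve t) = (\<integral>y. H t y \<partial>\<nu>)" if "t \<noteq> 0" for t
  proof -
    have "(\<lambda>x. \<Sum>i\<in>Basis. ((1, control t x) \<bullet> i) * ?D (t, x) i) \<in> borel_measurable borel"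
    proof (intro borel_measurable_sum borel_measurable_times)
      have "(\<lambda>x. (1::real, control t x)) \<in> borel_measurable borel"
        unfolding control_def borel_prod[symmetric] by measurable
      then show "(\<lambda>x. (1::real, control t x) \<bullet> i) \<in> borel_measurable borel" for i
        by (rule borel_measurable_inner) simp
      show "(\<lambda>x. ?D (t, x) i) \<in> borel_measurable borel" for i
        by (rule measurable_compose[OF _ D_meas]) measurable
    qed
    then have "(\<lambda>x. ?D (t, x) (1, control t x)) \<in> borel_measurable borel"
      unfolding D(3)[symmetric] .
    then have "(\<integral>x. ?D (t, x) (1, control t x) \<partial>curve t) = (\<integral>y. ?D (t, flow t y) (1, control t (flow t y)) \<partial>\<nu>)"
      unfolding curve_def by (intro integral_distr) measurable
    then show ?thesis using that by (simp add: control_flow H_def)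
  qed
  interpret pair_sigma_finite lborel \<nu>
    by (intro pair_sigma_finite.intro lborel.sigma_finite_measure_axioms \<nu>.sigma_finite_measure_axioms)
  define K where "K = (\<integral>y. C * (1 + \<theta> / T * norm (y - c)) \<partial>\<nu>)"
  have F_meas: "(\<lambda>w. indicator {0..T} (fst w) *\<^sub>R H (fst w) (snd w)) \<in> borel_measurable (lborel \<Otimes>\<^sub>M \<nu>)"
    by measurable
  have pair_int: "integrable (lborel \<Otimes>\<^sub>M \<nu>) (\<lambda>w. indicator {0..T} (fst w) *\<^sub>R H (fst w) (snd w))"
  proof (rule Fubini_integrable[OF F_meas])
    show "integrable lborel (\<lambda>t. \<integral>y. norm (indicator {0..T} (fst (t, y)) *\<^sub>R H (fst (t, y)) (snd (t, y))) \<partial>\<nu>)"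
    proof (rule Bochner_Integration.integrable_bound)
      show "integrable lborel (\<lambda>t. indicator {0..T} t * K)"
        using T by (intro integrable_mult_left integrable_real_indicator) auto
      show "(\<lambda>t. \<integral>y. norm (indicator {0..T} (fst (t, y)) *\<^sub>R H (fst (t, y)) (snd (t, y))) \<partial>\<nu>) \<in> borel_measurable lborel"
        by measurable
      have le: "(\<integral>y. \<bar>H t y\<bar> \<partial>\<nu>) \<le> K" for t
        unfolding K_def by (intro integral_mono integrable_abs H_int bound_int H_bound)
      have "0 \<le> K"
        unfolding K_def using C \<theta> T by (intro Bochner_Integration.integral_nonneg) simp
      with le show "AE t in lborel. norm (\<integral>y. norm (indicator {0..T} (fst (t, y)) *\<^sub>R H (fst (t, y)) (snd (t, y))) \<partial>\<nu>)
          \<le> norm (indicator {0..T} t * K)"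
        by (intro AE_I2) (auto simp: indicator_def)
    qed
    show "AE t in lborel. integrable \<nu> (\<lambda>y. indicator {0..T} (fst (t, y)) *\<^sub>R H (fst (t, y)) (snd (t, y)))"
      using H_int by simp
  qed
  define F where "F t = (\<integral>y. H t y \<partial>\<nu>)" for t
  have F_borel: "F \<in> borel_measurable borel"
  proof -
    have "(\<lambda>w. H (fst w) (snd w)) \<in> borel_measurable (borel \<Otimes>\<^sub>M \<nu>)"
      by measurable
    then have "(\<lambda>t. \<integral>y. H (fst (t, y)) (snd (t, y)) \<partial>\<nu>) \<in> borel_measurable borel"
      by (intro \<nu>.borel_measurable_lebesgue_integral) simp
    then show ?thesis by (simp add: F_def[abs_def])
  qed
  have ae: "AE t in lebesgue_on {0..T}. (\<integral>x. ?D (t, x) (1, control t x) \<partial>curve t) = F t"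
  proof -
    have "AE t in lebesgue. t \<noteq> (0::real)" by (simp add: AE_completion AE_lborel_singleton)
    then show ?thesis
      by (auto simp: AE_restrict_space_iff inner F_def elim: eventually_mono)
  qed
  have F_leb: "F \<in> borel_measurable (lebesgue_on {0..T})"
    using F_borel by (intro borel_measurable_lebesgue_on_of_borel measurable_restrict_space1) auto
  have "(\<integral>t. (\<integral>x. ?D (t, x) (1, control t x) \<partial>curve t) \<partial>lebesgue_on {0..T}) = (\<integral>t. F t \<partial>lebesgue_on {0..T})"
  proof (rule Bochner_Integration.integral_cong_AE[OF _ F_leb ae])
    \<comment> \<open>The slice \<open>t = 0\<close>, where the control is not the velocity of the
      flow, is split off so that measurability in \<open>t\<close> reduces to that of
      \<open>F\<close>.\<close>
    have eq: "(\<integral>x. ?D (t, x) (1, control t x) \<partial>curve t) =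
        (if t = 0 then (\<integral>x. ?D (0, x) (1, control 0 x) \<partial>curve 0) else F t)" for t
      by (simp add: inner F_def)
    show "(\<lambda>t. \<integral>x. ?D (t, x) (1, control t x) \<partial>curve t) \<in> borel_measurable (lebesgue_on {0..T})"
      using F_borel by (subst eq, intro borel_measurable_lebesgue_on_of_borel measurable_restrict_space1 measurable_If) auto
  qed
  also have "\<dots> = (\<integral>t. indicator {0..T} t *\<^sub>R F t \<partial>lebesgue)"
    by (simp add: integral_restrict_space)
  also have "\<dots> = (\<integral>t. indicator {0..T} t *\<^sub>R F t \<partial>lborel)"
    using F_borel by (intro integral_completion borel_measurable_scaleR borel_measurable_indicator) auto
  also have "\<dots> = (\<integral>t. (\<integral>y. indicator {0..T} t *\<^sub>R H t y \<partial>\<nu>) \<partial>lborel)"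
    by (simp add: F_def)
  also have "\<dots> = (\<integral>y. (\<integral>t. indicator {0..T} t *\<^sub>R H t y \<partial>lborel) \<partial>\<nu>)"
    using pair_int by (intro Fubini_integral[symmetric]) (simp add: case_prod_unfold)
  also have "\<dots> = 0"
    unfolding FTC by simp
  finally show "(\<integral>t. (\<integral>x. ?D (t, x) (1, control t x) \<partial>curve t) \<partial>lebesgue_on {0..T}) = 0" .
qed

end

section \<open>The value functions at a point mass\<close>

lemma mean_field_value_le_dilation:
  assumes \<nu>: "\<nu> \<in> P2" and T: "0 < T" and \<theta>: "0 \<le> \<theta>" "\<theta> \<le> 1"
    and G: "\<And>m. m \<in> P2 \<Longrightarrow> G m = wasserstein 1 m \<nu>"
  shows "mean_field_value T G 0 (return borel c) \<le>
    ereal (\<theta>\<^sup>2 * (\<integral>y. (norm (y - c))\<^sup>2 \<partial>\<nu>) / (2 * T) + (1 - \<theta>) * (\<integral>y. dist c y \<partial>\<nu>))"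
proof -
  interpret dilation \<nu> c T \<theta>
    using assms by unfold_locales
  have "mean_field_value T G 0 (return borel c) \<le> total_cost T G 0 curve control"
    unfolding mean_field_value_def
    by (rule Inf_lower) (use curve_AC control_L2 curve_continuity_equation curve_0 in blast)
  also have "\<dots> \<le> ereal (\<theta>\<^sup>2 * E2 / (2 * T)) + ereal ((1 - \<theta>) * (\<integral>y. dist c y \<partial>\<nu>))"
    unfolding total_cost_def
  proof (intro add_mono)
    have "enn2ereal (kinetic_energy 0 T control curve) \<le> enn2ereal (ennreal (\<theta>\<^sup>2 * E2 / (2 * T)))"
      using kinetic_energy_le by (simp add: less_eq_ennreal.rep_eq)
    then show "enn2ereal (kinetic_energy 0 T control curve) \<le> ereal (\<theta>\<^sup>2 * E2 / (2 * T))"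
      using E2_nonneg T by (simp add: enn2ereal_ennreal)
    show "ereal (G (curve T)) \<le> ereal ((1 - \<theta>) * (\<integral>y. dist c y \<partial>\<nu>))"
      using terminal_distance G[OF curve_P2] by simp
  qed
  finally show ?thesis by (simp add: E2_def)
qed

text \<open>The energy is bounded below by 0, and the final law is a point mass, whose distance to
  \<open>\<nu>\<close> is at least \<open>M\<close>. The bound is the same for every starting point
  \<open>z\<close>.\<close>

lemma Lipschitz_feedback_value_ge:
  assumes \<nu>: "\<nu> \<in> P2" and T: "0 < T"
    and G: "\<And>m. m \<in> P2 \<Longrightarrow> G m = wasserstein 1 m \<nu>"
    and c: "\<And>x. M \<le> (\<integral>y. dist x y \<partial>\<nu>)"
  shows "ereal M \<le> Lipschitz_feedback_value T G 0 (return borel z)"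
  unfolding Lipschitz_feedback_value_def
proof (rule Inf_greatest, clarify)
  fix m \<alpha>
  assume "L1_Lip 0 T \<alpha>" "narrowly_continuous_P2 0 T m" "continuity_equation 0 T \<alpha> m" and m0: "m 0 = return borel z"
  then interpret lipschitz_flow 0 T \<alpha> m
    using T by unfold_locales
  have T': "T \<in> {0..T}" using T by simp
  have "M \<le> (\<integral>y. dist (mean T) y \<partial>\<nu>)" by (rule c)
  also have "\<dots> \<le> wasserstein 1 (return borel (mean T)) \<nu>" by (rule wasserstein_return_ge[OF \<nu>])
  also have "\<dots> = G (m T)" using dirac_stays_dirac[OF m0 T'] G[OF P2[OF T']] by simp
  finally have "ereal M \<le> 0 + ereal (G (m T))" by simp
  also have "\<dots> \<le> total_cost T G 0 m \<alpha>"
    unfolding total_cost_def by (intro add_mono enn2ereal_nonneg order_refl)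
  finally show "ereal M \<le> total_cost T G 0 m \<alpha>" .
qed

text \<open>The mean distance \<open>M\<close> is 1-Lipschitz and satisfies
  \<open>dist x 0 \<le> M x + M 0\<close>. Outside the ball of radius \<open>2 * M 0\<close> this
  gives \<open>M x \<ge> M 0\<close>, so a minimum over the compact ball is global.\<close>

lemma median_exists:
  fixes \<nu> :: "'a::euclidean_space measure"
  assumes \<nu>: "\<nu> \<in> P2"
  obtains c where "\<And>x. (\<integral>y. dist c y \<partial>\<nu>) \<le> (\<integral>y. dist x y \<partial>\<nu>)"
proof -
  interpret prob_space \<nu> using P2_D(1)[OF \<nu>] .
  define M where "M x = (\<integral>y. dist x y \<partial>\<nu>)" for x
  note int = integrable_dist_P2[OF \<nu>]
  have lip: "M x \<le> M x' + dist x x'" for x x'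
  proof -
    have "M x \<le> (\<integral>y. dist x' y + dist x x' \<partial>\<nu>)"
      unfolding M_def
    proof (rule integral_mono)
      show "dist x y \<le> dist x' y + dist x x'" for y
        using dist_triangle[of x y x'] by simp
    qed (use int in auto)
    also have "\<dots> = M x' + dist x x'"
      using int by (simp add: M_def prob_space)
    finally show ?thesis .
  qed
  have "1-lipschitz_on UNIV M"
  proof (rule lipschitz_onI)
    show "dist (M x) (M x') \<le> 1 * dist x x'" for x x'
      using lip[of x x'] lip[of x' x] by (simp add: dist_real_def abs_le_iff dist_commute)
  qed simp
  then have cont: "continuous_on S M" for S
    by (meson continuous_on_subset lipschitz_on_continuous_on subset_UNIV)
  have M0: "0 \<le> M 0" unfolding M_def by (intro Bochner_Integration.integral_nonneg) simp
  obtain c where c: "c \<in> cball 0 (2 * M 0)" "\<And>x. x \<in> cball 0 (2 * M 0) \<Longrightarrow> M c \<le> M x"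
    using continuous_attains_inf[OF compact_cball _ cont, of 0 "2 * M 0"] M0 by auto
  have "M c \<le> M x" for x
  proof (cases "x \<in> cball 0 (2 * M 0)")
    case False
    have "dist x 0 = (\<integral>y. dist x 0 \<partial>\<nu>)" by (simp add: prob_space)
    also have "\<dots> \<le> (\<integral>y. dist x y + dist 0 y \<partial>\<nu>)"
      by (intro integral_mono Bochner_Integration.integrable_add int dist_triangle2) simp
    also have "\<dots> = M x + M 0"
      by (simp only: M_def Bochner_Integration.integral_add[OF int int])
    finally have "M 0 \<le> M x" using False by simp
    moreover have "M c \<le> M 0" using c(2)[of 0] M0 by simp
    ultimately show ?thesis by simp
  qed (rule c(2))
  then show ?thesis by (intro that[of c]) (simp add: M_def)
qed

text \<open>Since no point carries mass, \<open>\<nu>\<close> is not concentrated at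
  \<open>c\<close>. Hence the mean distance \<open>M\<close> is positive, and approaching
  \<open>\<nu>\<close> by a small dilation gains something.\<close>

lemma value_gap:
  fixes \<nu> :: "'a::euclidean_space measure"
  assumes \<nu>: "\<nu> \<in> P2" and T: "0 < T" and no_atom: "\<And>x. AE y in \<nu>. y \<noteq> x"
    and G: "\<And>m. m \<in> P2 \<Longrightarrow> G m = wasserstein 1 m \<nu>"
  obtains c where "mean_field_value T G 0 (return borel c) < Lipschitz_feedback_value T G 0 (return borel c)"
proof -
  interpret prob_space \<nu> using P2_D(1)[OF \<nu>] .
  obtain c where c: "\<And>x. (\<integral>y. dist c y \<partial>\<nu>) \<le> (\<integral>y. dist x y \<partial>\<nu>)"
    by (rule median_exists[OF \<nu>]) blast
  define M where "M = (\<integral>y. dist c y \<partial>\<nu>)"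
  define V where "V = (\<integral>y. (norm (y - c))\<^sup>2 \<partial>\<nu>)"
  have "M \<noteq> 0"
  proof
    assume "M = 0"
    then have "AE y in \<nu>. dist c y = 0"
      unfolding M_def by (subst (asm) integral_nonneg_eq_0_iff_AE) (auto intro: integrable_dist_P2[OF \<nu>])
    with no_atom[of c] have "AE y in \<nu>. False"
      by eventually_elim auto
    then show False by simp
  qed
  moreover have "0 \<le> M"
    unfolding M_def by (intro Bochner_Integration.integral_nonneg) simp
  ultimately have M: "0 < M" by simp
  have V: "0 \<le> V"
    unfolding V_def by (intro Bochner_Integration.integral_nonneg) simp
  \<comment> \<open>Any positive value below \<open>2 * T * M / V\<close> makes the energy
    \<open>\<theta>\<^sup>2 * V / (2 * T)\<close> smaller than the gain \<open>\<theta> * M\<close>;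
    the denominator \<open>V + 1\<close> stays positive when \<open>V = 0\<close>, and the minimum
    keeps \<open>\<theta>\<close> admissible for the dilation.\<close>
  define \<theta> where "\<theta> = min 1 (T * M / (V + 1))"
  have \<theta>: "0 < \<theta>" "\<theta> \<le> 1" "\<theta> \<le> T * M / (V + 1)"
    using M V T by (auto simp: \<theta>_def)
  have "\<theta> * V / (2 * T) \<le> T * M / (V + 1) * V / (2 * T)"
    using \<theta> V T by (intro divide_right_mono mult_right_mono) auto
  also have "\<dots> = M * (V / (2 * (V + 1)))"
    using T by simp
  also have "\<dots> < M * 1"
    using M V by (intro mult_strict_left_mono) auto
  finally have "\<theta> * (\<theta> * V / (2 * T)) < \<theta> * M"
    using \<theta>(1) by (intro mult_strict_left_mono) auto
  then have "\<theta>\<^sup>2 * V / (2 * T) + (1 - \<theta>) * M < M"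
    by (simp add: power2_eq_square algebra_simps)
  then have "ereal (\<theta>\<^sup>2 * V / (2 * T) + (1 - \<theta>) * M) < ereal M" by simp
  with mean_field_value_le_dilation[OF \<nu> T less_imp_le[OF \<theta>(1)] \<theta>(2) G, of c, folded M_def V_def]
    Lipschitz_feedback_value_ge[OF \<nu> T G c, folded M_def, of c]
  have "mean_field_value T G 0 (return borel c) < Lipschitz_feedback_value T G 0 (return borel c)"
    by (meson le_less_trans less_le_trans)
  then show ?thesis by (rule that)
qed

lemma return_P2: "return borel c \<in> P2"
  by (simp add: P2_def prob_space_return nn_integral_return)

lemma Leb_unit_cube_eq:
  "(Leb_unit_cube :: (real ^ 'n) measure) = density lborel (indicator (cbox 0 1))"
proof -
  have "{x :: real ^ 'n. \<forall>i. 0 \<le> x $ i \<and> x $ i \<le> 1} = cbox 0 1"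
    by (auto simp: mem_box_cart)
  then show ?thesis by (simp add: Leb_unit_cube_def)
qed

lemma Leb_unit_cube_P2: "(Leb_unit_cube :: (real ^ 'n) measure) \<in> P2"
proof -
  let ?Q = "cbox 0 1 :: (real ^ 'n) set"
  have vol: "emeasure lborel ?Q = 1"
  proof -
    have one: "1 \<bullet> b = 1" if "b \<in> Basis" for b :: "real ^ 'n"
      using that by (auto simp: Basis_vec_def inner_axis)
    then have "(\<Prod>b\<in>(Basis :: (real ^ 'n) set). (1 - 0) \<bullet> b) = (1::real)"
      by (intro prod.neutral) auto
    with one show ?thesis by (simp add: emeasure_lborel_cbox_eq)
  qed
  have "prob_space (density lborel (indicator ?Q))"
    by (rule prob_spaceI) (simp add: emeasure_density vol)
  moreover have "(\<integral>\<^sup>+ x. ennreal (norm x ^ 2) \<partial>density lborel (indicator ?Q)) < \<infinity>"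
  proof -
    have "bounded ?Q" by simp
    then obtain B where B: "\<And>x. x \<in> ?Q \<Longrightarrow> norm x \<le> B" unfolding bounded_iff by blast
    have "(\<integral>\<^sup>+ x. ennreal (norm x ^ 2) \<partial>density lborel (indicator ?Q))
        = (\<integral>\<^sup>+ x. indicator ?Q x * ennreal (norm x ^ 2) \<partial>lborel)"
      by (rule nn_integral_density) auto
    also have "\<dots> \<le> (\<integral>\<^sup>+ x. ennreal (B ^ 2) * indicator ?Q x \<partial>lborel)"
      by (intro nn_integral_mono) (auto simp: indicator_def B intro!: ennreal_leI power_mono)
    also have "\<dots> < \<infinity>" by (simp add: vol nn_integral_cmult_indicator)
    finally show ?thesis .
  qed
  ultimately show ?thesis by (simp add: P2_def Leb_unit_cube_eq)
qed

lemma Leb_unit_cube_no_atom: "AE y in (Leb_unit_cube :: (real ^ 'n) measure). y \<noteq> x"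
  unfolding Leb_unit_cube_eq
  by (subst AE_density) (auto intro: eventually_mono[OF AE_lborel_singleton[of x]])

theorem corollary6p9:
  fixes T :: real and G :: "(real ^ 'n) measure \<Rightarrow> real"
  assumes "T \<ge> 1/2"
    and "\<And>m. m \<in> P2 \<Longrightarrow> G m = wasserstein 1 m Leb_unit_cube"
  shows "\<exists>t\<^sub>0\<in>{0..T}. \<exists>m\<^sub>0\<in>P2. mean_field_value T G t\<^sub>0 m\<^sub>0 < Lipschitz_feedback_value T G t\<^sub>0 m\<^sub>0"
proof -
  have "0 < T" using assms(1) by simp
  then obtain c where "mean_field_value T G 0 (return borel c) < Lipschitz_feedback_value T G 0 (return borel c)"
    using value_gap[OF Leb_unit_cube_P2 _ Leb_unit_cube_no_atom assms(2)] by blast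
  then show ?thesis
    using \<open>0 < T\<close> return_P2 by (intro bexI[of _ 0] bexI[of _ "return borel c"]) auto
qed

end
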